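(* Let $d,m,N\ge 1$ be integers, let $\boldsymbol{L}=(\boldsymbol{L}(t))_{t\in\mathbb{R}}$ be a two-sided $\mathbb{R}^m$-valued Lévy process with $\mathbb{E}\boldsymbol{L}(1)=0$ and $\mathbb{E}\|\boldsymbol{L}(1)\|^2<\infty$, and let $A\in M_N(\mathbb{R})$, $B\in M_{N,m}(\mathbb{R})$, $C\in M_{d,N}(\mathbb{R})$, where all eigenvalues of $A$ have strictly negative real parts. Let $\boldsymbol{Y}$ be the output process of the linear state space model $$\mathrm{d}\boldsymbol{X}(t)=A\boldsymbol{X}(t)\,\mathrm{d}t+B\,\mathrm{d}\boldsymbol{L}(t),\qquad \boldsymbol{Y}(t)=C\boldsymbol{X}(t),\qquad t\in\mathbb{R}.$$ Then there exist $p\in\mathbb{N}$, $p\ge 1$, and matrices $\widetilde A_1,\ldots,\widetilde A_p\in M_m(\mathbb{R})$, $\widetilde B_0,\ldots,\widetilde B_{p-1}\in M_{d,m}(\mathbb{R})$ such that, with $$\mathfrak{A}=\begin{pmatrix}0&\mathbb{I}_m&0&\cdots&0\\0&0&\mathbb{I}_m&\ddots&\vdots\\\vdots&&\ddots&\ddots&0\\0&\cdots&\cdots&0&\mathbb{I}_m\\-\widetilde A_p&-\widetilde A_{p-1}&\cdots&\cdots&-\widetilde A_1\end{pmatrix}\in M_{pm}(\mathbb{R}),$$ $$\mathfrak{B}=(0_m,\ldots,0_m,\mathbb{I}_m)^T\in M_{pm,m}(\mathbb{R}),\qquad \mathfrak{C}=(\widetilde B_0,\ldots,\widetilde B_{p-1})\in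 M_{d,pm}(\mathbb{R}),$$ $\boldsymbol{Y}$ is the output process of the linear state space model in controller canonical form $$\mathrm{d}\widetilde{\boldsymbol{G}}(t)=\mathfrak{A}\widetilde{\boldsymbol{G}}(t)\,\mathrm{d}t+\mathfrak{B}\,\mathrm{d}\boldsymbol{L}(t),\qquad \boldsymbol{Y}(t)=\mathfrak{C}\widetilde{\boldsymbol{G}}(t),\qquad t\in\mathbb{R},$$ driven by the same Lévy process $\boldsymbol{L}$.
   Context: $M_{k,l}(\mathbb{R})$ denotes the real $k\times l$ matrices, $M_k(\mathbb{R})=M_{k,k}(\mathbb{R})$, $\mathbb{I}_k$ is the $k\times k$ identity matrix and $0_k$ the $k\times k$ zero matrix. Output process: for a linear state space model $(A,B,C,\boldsymbol{L})$ whose state matrix $A$ has only eigenvalues with strictly negative real parts, the state equation $\mathrm{d}\boldsymbol{X}(t)=A\boldsymbol{X}(t)\,\mathrm{d}t+B\,\mathrm{d}\boldsymbol{L}(t)$ has a unique strictly stationary causal solution $\boldsymbol{X}(t)=\int_{-\infty}^t e^{A(t-u)}B\,\mathrm{d}\boldsymbol{L}(u)$. The output process of the model is $$\boldsymbol{Y}(t)=C\boldsymbol{X}(t)=\int_{-\infty}^t Ce^{A(t-u)}B\,\mathrm{d}\boldsymbol{L}(u),\qquad t\in\mathbb{R}.$$ Saying that $\boldsymbol{Y}$ is the output process of a model includes that the state matrix of that model has only eigenvalues with strictly negative real parts. *)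

theory Defs
  imports "HOL-Probability.Probability" "Jordan_Normal_Form.Char_Poly"
begin

unbundle no vec_syntax
unbundle no inner_syntax

text \<open>
  The dimension \<open>p * m\<close> of the canonical form is existentially quantified, so vectors and matrices
  are those of \<open>Jordan_Normal_Form\<close>, with dimensions given by \<open>carrier_vec\<close> and \<open>carrier_mat\<close>.
  That type of vectors carries neither a topology nor a norm.
\<close>

section \<open>Vectors and matrices\<close>

text \<open>The Borel \<open>\<sigma>\<close>-algebra of \<open>\<real>\<^sup>k\<close>, i.e. the product one, transported to \<open>carrier_vec k\<close>.\<close>

definition vec_borel :: "nat \<Rightarrow> real Matrix.vec measure" where
  "vec_borel k = vimage_algebra (carrier_vec k) (\<lambda>v. \<lambda>i\<in>{..<k}. v $ i) (Pi\<^sub>M {..<k} (\<lambda>_. borel))"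

definition vec_sqnorm :: "real Matrix.vec \<Rightarrow> real" where
  "vec_sqnorm v = v \<bullet> v"

definition mat_sqnorm :: "real mat \<Rightarrow> real" where
  "mat_sqnorm F = (\<Sum>i<dim_row F. \<Sum>j<dim_col F. (F $$ (i, j))\<^sup>2)"

definition mat_exp :: "real mat \<Rightarrow> real mat" where
  "mat_exp A = mat (dim_row A) (dim_row A) (\<lambda>(i, j). \<Sum>k. (A ^\<^sub>m k) $$ (i, j) / fact k)"

definition stable_mat :: "real mat \<Rightarrow> bool" where
  "stable_mat A \<longleftrightarrow> (\<forall>z. eigenvalue (map_mat complex_of_real A) z \<longrightarrow> Re z < 0)"

text \<open>The matrix made of \<open>p\<close> by \<open>q\<close> blocks \<open>F a b\<close>, each of dimension \<open>k\<close> by \<open>l\<close>; \<open>a\<close>, \<open>b\<close> count from \<open>0\<close>.\<close>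

definition block_mat :: "nat \<Rightarrow> nat \<Rightarrow> nat \<Rightarrow> nat \<Rightarrow> (nat \<Rightarrow> nat \<Rightarrow> real mat) \<Rightarrow> real mat" where
  "block_mat p q k l F =
     mat (p * k) (q * l) (\<lambda>(i, j). F (i div k) (j div l) $$ (i mod k, j mod l))"

definition controller_A :: "nat \<Rightarrow> nat \<Rightarrow> (nat \<Rightarrow> real mat) \<Rightarrow> real mat" where
  "controller_A m p At = block_mat p p m m (\<lambda>a b.
     if a = p - 1 then - At (p - b) else if b = a + 1 then 1\<^sub>m m else 0\<^sub>m m m)"

definition controller_B :: "nat \<Rightarrow> nat \<Rightarrow> real mat" where
  "controller_B m p = block_mat p 1 m m (\<lambda>a b. if a = p - 1 then 1\<^sub>m m else 0\<^sub>m m m)"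

definition controller_C :: "nat \<Rightarrow> nat \<Rightarrow> nat \<Rightarrow> (nat \<Rightarrow> real mat) \<Rightarrow> real mat" where
  "controller_C d m p Bt = block_mat 1 p d m (\<lambda>a b. Bt b)"

section \<open>Two-sided Levy processes\<close>

definition levy_process :: "'w measure \<Rightarrow> nat \<Rightarrow> (real \<Rightarrow> 'w \<Rightarrow> real Matrix.vec) \<Rightarrow> bool" where
  "levy_process M m L \<longleftrightarrow>
     prob_space M \<and>
     (\<forall>t. L t \<in> measurable M (vec_borel m)) \<and>
     (AE \<omega> in M. L 0 \<omega> = 0\<^sub>v m) \<and>
     \<comment> \<open>independent increments\<close>
     (\<forall>ts. sorted_wrt (<) ts \<longrightarrow>
        prob_space.indep_vars M (\<lambda>_. vec_borel m)
          (\<lambda>i \<omega>. L (ts ! Suc i) \<omega> - L (ts ! i) \<omega>) {i. Suc i < length ts}) \<and>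
     \<comment> \<open>stationary increments\<close>
     (\<forall>s t h. distr M (vec_borel m) (\<lambda>\<omega>. L (t + h) \<omega> - L (s + h) \<omega>) =
              distr M (vec_borel m) (\<lambda>\<omega>. L t \<omega> - L s \<omega>)) \<and>
     \<comment> \<open>continuity in probability\<close>
     (\<forall>t. \<forall>\<epsilon>>0. ((\<lambda>s. measure M {\<omega> \<in> space M. vec_sqnorm (L s \<omega> - L t \<omega>) > \<epsilon>}) \<longlongrightarrow> 0) (at t)) \<and>
     \<comment> \<open>right-continuous paths with left limits\<close>
     (AE \<omega> in M. \<forall>t. \<forall>i<m. ((\<lambda>s. L s \<omega> $ i) \<longlongrightarrow> L t \<omega> $ i) (at_right t) \<and>
                          (\<exists>l. ((\<lambda>s. L s \<omega> $ i) \<longlongrightarrow> l) (at_left t)))"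

section \<open>Integrals of deterministic functions\<close>

text \<open>
  The integral of a deterministic matrix-valued function with respect to a centred
  square-integrable Levy process is the continuous linear extension, from step functions to
  square-integrable functions, of the elementary integral. A list entry \<open>(s, t, F)\<close> stands for the
  step function equal to \<open>F\<close> on \<open>{s<..t}\<close> and to zero elsewhere.
\<close>

type_synonym step = "real \<times> real \<times> real mat"

definition step_list :: "nat \<Rightarrow> nat \<Rightarrow> step list \<Rightarrow> bool" where
  "step_list k m ss \<longleftrightarrow> (\<forall>(s, t, F) \<in> set ss. s \<le> t \<and> F \<in> carrier_mat k m)"

definition step_fun :: "nat \<Rightarrow> nat \<Rightarrow> step list \<Rightarrow> real \<Rightarrow> real mat" where
  "step_fun k m ss u = mat k m (\<lambda>(i, j). \<Sum>(s, t, F)\<leftarrow>ss. indicator {s<..t} u * F $$ (i, j))"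

definition step_integral ::
    "nat \<Rightarrow> (real \<Rightarrow> 'w \<Rightarrow> real Matrix.vec) \<Rightarrow> step list \<Rightarrow> 'w \<Rightarrow> real Matrix.vec" where
  "step_integral k L ss \<omega> = vec k (\<lambda>i. \<Sum>(s, t, F)\<leftarrow>ss. (F *\<^sub>v (L t \<omega> - L s \<omega>)) $ i)"

text \<open>
  \<open>Z\<close> is (a version of) the integral over the real line of the \<open>k\<close> by \<open>m\<close> matrix function \<open>f\<close>.
  Nonnegative integrals are used so that both limits include finiteness.
\<close>

definition has_levy_integral ::
    "'w measure \<Rightarrow> nat \<Rightarrow> nat \<Rightarrow> (real \<Rightarrow> 'w \<Rightarrow> real Matrix.vec) \<Rightarrow> (real \<Rightarrow> real mat) \<Rightarrow>
      ('w \<Rightarrow> real Matrix.vec) \<Rightarrow> bool" where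
  "has_levy_integral M k m L f Z \<longleftrightarrow>
     Z \<in> measurable M (vec_borel k) \<and>
     (\<forall>u. f u \<in> carrier_mat k m) \<and>
     (\<forall>i<k. \<forall>j<m. (\<lambda>u. f u $$ (i, j)) \<in> borel_measurable borel) \<and>
     (\<exists>S. (\<forall>n. step_list k m (S n)) \<and>
        (\<lambda>n. \<integral>\<^sup>+u. ennreal (mat_sqnorm (step_fun k m (S n) u - f u)) \<partial>lborel) \<longlonglongrightarrow> 0 \<and>
        (\<lambda>n. \<integral>\<^sup>+\<omega>. ennreal (vec_sqnorm (step_integral k L (S n) \<omega> - Z \<omega>)) \<partial>M) \<longlonglongrightarrow> 0)"

section \<open>Linear state space models\<close>

text \<open>\<open>dX(t) = A X(t) dt + B dL(t)\<close>, in integrated form and pathwise.\<close>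

definition state_equation ::
    "'w measure \<Rightarrow> (real \<Rightarrow> 'w \<Rightarrow> real Matrix.vec) \<Rightarrow> real mat \<Rightarrow> real mat \<Rightarrow>
      (real \<Rightarrow> 'w \<Rightarrow> real Matrix.vec) \<Rightarrow> bool" where
  "state_equation M L A B X \<longleftrightarrow>
     (AE \<omega> in M. \<forall>s t. s \<le> t \<longrightarrow>
        (\<forall>i<dim_row A. set_integrable lborel {s..t} (\<lambda>u. (A *\<^sub>v X u \<omega>) $ i)) \<and>
        X t \<omega> = X s \<omega> + vec (dim_row A) (\<lambda>i. LINT u:{s..t}|lborel. (A *\<^sub>v X u \<omega>) $ i)
                       + B *\<^sub>v (L t \<omega> - L s \<omega>))"

text \<open>
  For stable \<open>A\<close>, the strictly stationary causal solution of the state equation: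
  \<open>X t\<close> is almost surely the integral of \<open>exp (A (t - u)) B\<close> over \<open>{..t}\<close>.
  This formula determines \<open>X t\<close> up to a null set.
\<close>

definition state_process ::
    "'w measure \<Rightarrow> (real \<Rightarrow> 'w \<Rightarrow> real Matrix.vec) \<Rightarrow> real mat \<Rightarrow> real mat \<Rightarrow>
      (real \<Rightarrow> 'w \<Rightarrow> real Matrix.vec) \<Rightarrow> bool" where
  "state_process M L A B X \<longleftrightarrow>
     state_equation M L A B X \<and>
     (\<forall>t. has_levy_integral M (dim_row A) (dim_col B) L
        (\<lambda>u. if u \<le> t then mat_exp ((t - u) \<cdot>\<^sub>m A) * B else 0\<^sub>m (dim_row A) (dim_col B)) (X t))"

definition output_process ::
    "'w measure \<Rightarrow> (real \<Rightarrow> 'w \<Rightarrow> real Matrix.vec) \<Rightarrow> real mat \<Rightarrow> real mat \<Rightarrow> real mat \<Rightarrow>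
      (real \<Rightarrow> 'w \<Rightarrow> real Matrix.vec) \<Rightarrow> bool" where
  "output_process M L A B C Y \<longleftrightarrow>
     stable_mat A \<and>
     (\<forall>t. Y t \<in> measurable M (vec_borel (dim_row C))) \<and>
     (\<exists>X. state_process M L A B X \<and> (AE \<omega> in M. \<forall>t. Y t \<omega> = C *\<^sub>v X t \<omega>))"

end

theory Submission
  imports Defs "Jordan_Normal_Form.Schur_Decomposition" "HOL-Real_Asymp.Real_Asymp"
begin

text \<open>
  Take \<open>p = N\<close> and \<open>At i = a\<^sub>i I\<close>, where \<open>x\<^sup>N + a\<^sub>1 x\<^bsup>N-1\<^esup> + \<dots> + a\<^sub>N\<close> is the characteristic polynomial of
  \<open>A\<close>. The coefficients \<open>D\<^sub>k\<close> of \<open>adj (x I - A)\<close> give a block row \<open>T = (D\<^sub>0 B, \<dots>, D\<^bsub>N-1\<^esub> B)\<close> which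
  intertwines the two models: with \<open>Bt k = C D\<^sub>k B\<close>, the controller form \<open>(\<AA>, \<BB>, \<CC>)\<close> satisfies
  \<open>T \<AA> = A T\<close>, \<open>T \<BB> = B\<close> and \<open>\<CC> = C T\<close>. So \<open>T\<close> maps a state process of the controller form, which
  is stable because the eigenvalues of \<open>\<AA>\<close> are among those of \<open>A\<close>, to a state process of the given model.

  A state process for \<open>(\<AA>, \<BB>)\<close> is given pathwise by partial integration of the stochastic integral,
  \<open>B L(t) + \<integral> A exp (s A) B L(t - s) ds\<close> over \<open>s \<ge> 0\<close>; it is the \<open>L\<^sup>2\<close>-limit of Riemann sums because increments of
  \<open>L\<close> over intervals of length \<open>h\<close> have second moment proportional to \<open>h\<close>. Two state processes of one model agree
  almost surely at each rational time by the isometry, hence at all times since by the state equation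
  their difference is continuous.
\<close>

section \<open>The matrix exponential of a stable matrix\<close>

text \<open>The block row \<open>T\<close> leads from the larger state space to the given one and
  has no inverse in general. A state of the controller form can therefore not be read off from a
  given state; it has to be built from \<open>L\<close>. \<open>state_process\<close> asks for two
  things of different kinds: an L2 limit at each fixed time, and the state equation for all times
  outside one null set. The limits fix each \<open>X t\<close> only up to a null set of its own,
  which is why a pathwise formula is needed. Both models use it with the same paths, so
  \<open>T\<close> maps one formula into the other identically, and uniqueness serves to replace the
  unknown state behind \<open>Y\<close> by the explicit one. Square integrability is assumed at time
  1 only and the coordinates of \<open>L\<close> may be correlated. Hence the second moments are
  first derived for scalar processes, and the vector case is reduced to them by
  inequalities.\<close>

lemma index_mult_mat_sum:
  assumes "A \<in> carrier_mat n k" "B \<in> carrier_mat k m" "i < n" "j < m"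
  shows "(A * B) $$ (i, j) = (\<Sum>l<k. A $$ (i, l) * B $$ (l, j))"
  using assms by (simp add: scalar_prod_def lessThan_atLeast0)

lemma smult_pow_mat:
  fixes A :: "'a::comm_ring_1 mat"
  assumes A: "A \<in> carrier_mat n n"
  shows "(s \<cdot>\<^sub>m A) ^\<^sub>m k = s ^ k \<cdot>\<^sub>m A ^\<^sub>m k"
proof (induction k)
  case 0
  then show ?case using A by auto
next
  case (Suc k)
  have P: "A ^\<^sub>m k \<in> carrier_mat n n" using A by simp
  have "(s \<cdot>\<^sub>m A) ^\<^sub>m Suc k = (s ^ k \<cdot>\<^sub>m A ^\<^sub>m k) * (s \<cdot>\<^sub>m A)" by (simp add: Suc)
  also have "\<dots> = s ^ Suc k \<cdot>\<^sub>m A ^\<^sub>m Suc k"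
    using A P by (auto simp: mult.assoc intro!: eq_matI)
  finally show ?case .
qed

text \<open>With \<open>a\<close> the sum of all absolute entries, each further factor multiplies
  the bound by a column sum, which is at most \<open>a\<close>. One number for all entries makes the
  exponential series of \<open>a\<close> a common majorant.\<close>

lemma abs_pow_mat_le:
  fixes A :: "real mat"
  assumes A: "A \<in> carrier_mat n n" and "i < n" "j < n"
  shows "\<bar>(A ^\<^sub>m k) $$ (i, j)\<bar> \<le> (\<Sum>i<n. \<Sum>j<n. \<bar>A $$ (i, j)\<bar>) ^ k"
  using \<open>j < n\<close>
proof (induction k arbitrary: j)
  case 0
  then show ?case using assms by simp
next
  case (Suc k)
  let ?a = "\<Sum>i<n. \<Sum>j<n. \<bar>A $$ (i, j)\<bar>"
  have P: "A ^\<^sub>m k \<in> carrier_mat n n" using A by simp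
  have "(A ^\<^sub>m Suc k) $$ (i, j) = (\<Sum>l<n. (A ^\<^sub>m k) $$ (i, l) * A $$ (l, j))"
    using A P Suc.prems \<open>i < n\<close> by (simp add: scalar_prod_def lessThan_atLeast0)
  also have "\<bar>\<dots>\<bar> \<le> (\<Sum>l<n. ?a ^ k * \<bar>A $$ (l, j)\<bar>)"
    by (rule order_trans[OF sum_abs], rule sum_mono)
       (auto simp: abs_mult intro!: mult_right_mono Suc.IH)
  also have "\<dots> = ?a ^ k * (\<Sum>l<n. \<bar>A $$ (l, j)\<bar>)" by (simp add: sum_distrib_left)
  also have "\<dots> \<le> ?a ^ k * ?a"
    using Suc.prems
    by (intro mult_left_mono sum_mono member_le_sum) (auto intro!: sum_nonneg zero_le_power)
  finally show ?case by (simp add: mult.commute)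
qed

text \<open>Stated as a power series in \<open>s\<close>, because the series is also differentiated
  term by term in \<open>s\<close>.\<close>

lemma summable_mat_exp:
  fixes A :: "real mat"
  assumes A: "A \<in> carrier_mat n n" and ij: "i < n" "j < n"
  shows "summable (\<lambda>k. (A ^\<^sub>m k) $$ (i, j) / fact k * s ^ k)"
proof (rule summable_comparison_test')
  let ?a = "\<Sum>i<n. \<Sum>j<n. \<bar>A $$ (i, j)\<bar>"
  show "summable (\<lambda>k. (?a * \<bar>s\<bar>) ^ k /\<^sub>R fact k)" by (rule summable_exp_generic)
  fix k :: nat
  assume "k \<ge> 0"
  have "\<bar>(A ^\<^sub>m k) $$ (i, j)\<bar> / fact k * \<bar>s\<bar> ^ k \<le> ?a ^ k / fact k * \<bar>s\<bar> ^ k"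
    by (intro mult_right_mono divide_right_mono abs_pow_mat_le[OF A] ij) auto
  then show "norm ((A ^\<^sub>m k) $$ (i, j) / fact k * s ^ k) \<le> (?a * \<bar>s\<bar>) ^ k /\<^sub>R fact k"
    by (simp add: abs_mult power_abs power_mult_distrib field_simps)
qed

lemma mat_exp_smult_index:
  fixes A :: "real mat"
  assumes A: "A \<in> carrier_mat n n" and ij: "i < n" "j < n"
  shows "mat_exp (s \<cdot>\<^sub>m A) $$ (i, j) = (\<Sum>k. (A ^\<^sub>m k) $$ (i, j) / fact k * s ^ k)"
proof -
  have "A ^\<^sub>m k \<in> carrier_mat n n" for k using A by simp
  then show ?thesis
    using A ij by (simp add: mat_exp_def smult_pow_mat[OF A] mult.commute)
qed

lemma mat_exp_carrier [simp, intro]: "A \<in> carrier_mat n n \<Longrightarrow> mat_exp A \<in> carrier_mat n n"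
  by (auto simp: mat_exp_def)

lemma mat_exp_zero:
  assumes A: "A \<in> carrier_mat n n"
  shows "mat_exp (0 \<cdot>\<^sub>m A) = 1\<^sub>m n"
proof (rule eq_matI)
  fix i j assume ij: "i < dim_row (1\<^sub>m n :: real mat)" "j < dim_col (1\<^sub>m n :: real mat)"
  then show "mat_exp (0 \<cdot>\<^sub>m A) $$ (i, j) = 1\<^sub>m n $$ (i, j)"
    using A powser_zero[of "\<lambda>k. (A ^\<^sub>m k) $$ (i, j) / fact k"]
    by (simp add: mat_exp_smult_index[OF A] del: powser_zero times_divide_eq_left)
qed (use A in \<open>auto simp: mat_exp_def\<close>)

text \<open>\<open>T\<close> may be rectangular, and \<open>T = A = A'\<close> says that
  \<open>A\<close> commutes with its powers; both cases are used.\<close>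

lemma pow_mat_intertwine:
  fixes A A' T :: "'a::semiring_1 mat"
  assumes A: "A \<in> carrier_mat n n" and A': "A' \<in> carrier_mat n' n'" and T: "T \<in> carrier_mat n n'"
    and eq: "T * A' = A * T"
  shows "T * A' ^\<^sub>m k = A ^\<^sub>m k * T"
proof (induction k)
  case 0
  then show ?case using assms by simp
next
  case (Suc k)
  have P: "A ^\<^sub>m k \<in> carrier_mat n n" "A' ^\<^sub>m k \<in> carrier_mat n' n'" using A A' by auto
  have "T * A' ^\<^sub>m Suc k = (T * A' ^\<^sub>m k) * A'"
    using T P A' by (simp add: assoc_mult_mat[of T n n' _ n' A' n'])
  also have "\<dots> = A ^\<^sub>m k * (T * A')"
    using T P A' by (simp add: Suc assoc_mult_mat[of _ n n T n' A' n'])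
  also have "\<dots> = A ^\<^sub>m Suc k * T"
    using T P A by (simp add: eq assoc_mult_mat[of _ n n A n T n'])
  finally show ?case .
qed

lemma suminf_sum_mult_left:
  fixes c :: "'b \<Rightarrow> nat \<Rightarrow> real"
  assumes "\<And>l. l \<in> I \<Longrightarrow> summable (c l)"
  shows "(\<Sum>k. \<Sum>l\<in>I. t l * c l k) = (\<Sum>l\<in>I. t l * (\<Sum>k. c l k))"
  using assms by (subst suminf_sum) (auto intro!: summable_mult sum.cong suminf_mult)

lemma mat_exp_intertwine:
  fixes A A' T :: "real mat"
  assumes A: "A \<in> carrier_mat n n" and A': "A' \<in> carrier_mat n' n'" and T: "T \<in> carrier_mat n n'"
    and eq: "T * A' = A * T"
  shows "T * mat_exp (s \<cdot>\<^sub>m A') = mat_exp (s \<cdot>\<^sub>m A) * T"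
proof (rule eq_matI)
  fix i j
  assume "i < dim_row (mat_exp (s \<cdot>\<^sub>m A) * T)" "j < dim_col (mat_exp (s \<cdot>\<^sub>m A) * T)"
  then have i: "i < n" and j: "j < n'" using A T by (auto simp: mat_exp_def)
  have E: "mat_exp (s \<cdot>\<^sub>m A) \<in> carrier_mat n n" "mat_exp (s \<cdot>\<^sub>m A') \<in> carrier_mat n' n'"
    using A A' by auto
  have P: "A ^\<^sub>m k \<in> carrier_mat n n" "A' ^\<^sub>m k \<in> carrier_mat n' n'" for k using A A' by auto
  have "(T * mat_exp (s \<cdot>\<^sub>m A')) $$ (i, j)
      = (\<Sum>l<n'. T $$ (i, l) * (\<Sum>k. (A' ^\<^sub>m k) $$ (l, j) / fact k * s ^ k))"
    using T E i j by (simp add: scalar_prod_def lessThan_atLeast0 mat_exp_smult_index[OF A'])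
  also have "\<dots> = (\<Sum>k. \<Sum>l<n'. T $$ (i, l) * ((A' ^\<^sub>m k) $$ (l, j) / fact k * s ^ k))"
    by (rule suminf_sum_mult_left[symmetric]) (use summable_mat_exp[OF A' _ j] in auto)
  also have "\<dots> = (\<Sum>k. (T * A' ^\<^sub>m k) $$ (i, j) / fact k * s ^ k)"
    by (simp add: index_mult_mat_sum[OF T P(2) i j] sum_distrib_right sum_divide_distrib mult.assoc)
  also have "\<dots> = (\<Sum>k. (A ^\<^sub>m k * T) $$ (i, j) / fact k * s ^ k)"
    by (simp add: pow_mat_intertwine[OF A A' T eq])
  also have "\<dots> = (\<Sum>k. \<Sum>l<n. T $$ (l, j) * ((A ^\<^sub>m k) $$ (i, l) / fact k * s ^ k))"
    by (simp add: index_mult_mat_sum[OF P(1) T i j] sum_distrib_left sum_divide_distrib ac_simps)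
  also have "\<dots> = (\<Sum>l<n. T $$ (l, j) * (\<Sum>k. (A ^\<^sub>m k) $$ (i, l) / fact k * s ^ k))"
    by (rule suminf_sum_mult_left) (use summable_mat_exp[OF A i] in auto)
  also have "\<dots> = (mat_exp (s \<cdot>\<^sub>m A) * T) $$ (i, j)"
    using T E i j
    by (simp add: scalar_prod_def lessThan_atLeast0 mat_exp_smult_index[OF A] mult.commute)
  finally show "(T * mat_exp (s \<cdot>\<^sub>m A')) $$ (i, j) = (mat_exp (s \<cdot>\<^sub>m A) * T) $$ (i, j)" .
qed (use A A' T in \<open>auto simp: mat_exp_def\<close>)

lemma has_real_derivative_mat_exp:
  fixes A :: "real mat"
  assumes A: "A \<in> carrier_mat n n" and ij: "i < n" "j < n"
  shows "((\<lambda>s. mat_exp (s \<cdot>\<^sub>m A) $$ (i, j)) has_real_derivative (A * mat_exp (s \<cdot>\<^sub>m A)) $$ (i, j)) (at s)"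
proof -
  let ?c = "\<lambda>i j k. (A ^\<^sub>m k) $$ (i, j) / fact k"
  have E: "mat_exp (s \<cdot>\<^sub>m A) \<in> carrier_mat n n" using A by auto
  have P: "A ^\<^sub>m k \<in> carrier_mat n n" for k using A by auto
  have der: "((\<lambda>s. \<Sum>k. ?c i j k * s ^ k) has_real_derivative (\<Sum>k. diffs (?c i j) k * s ^ k)) (at s)"
    by (rule termdiffs_strong_converges_everywhere) (rule summable_mat_exp[OF A ij])
  \<comment> \<open>The factor k + 1 from differentiation cancels against the factorial, which
    leaves A^(k+1) / k!; one factor \<open>A\<close> is then split off on the left.\<close>
  have diffs: "diffs (?c i j) k = (\<Sum>l<n. A $$ (i, l) * ?c l j k)" for k
  proof -
    have "A ^\<^sub>m Suc k = A * A ^\<^sub>m k"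
      using pow_mat_intertwine[OF A A A refl, of k] by simp
    then have "(A ^\<^sub>m Suc k) $$ (i, j) = (\<Sum>l<n. A $$ (i, l) * (A ^\<^sub>m k) $$ (l, j))"
      using P[of k] A ij by (simp add: scalar_prod_def lessThan_atLeast0)
    moreover have "diffs (?c i j) k = (A ^\<^sub>m Suc k) $$ (i, j) / fact k"
      by (simp add: diffs_def del: pow_mat.simps)
    ultimately show ?thesis by (simp add: sum_divide_distrib del: pow_mat.simps)
  qed
  have "(\<Sum>k. diffs (?c i j) k * s ^ k) = (\<Sum>k. \<Sum>l<n. A $$ (i, l) * (?c l j k * s ^ k))"
    by (simp only: diffs sum_distrib_right mult.assoc)
  also have "\<dots> = (\<Sum>l<n. A $$ (i, l) * mat_exp (s \<cdot>\<^sub>m A) $$ (l, j))"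
    by (subst suminf_sum_mult_left)
       (use summable_mat_exp[OF A _ ij(2)] in \<open>auto simp: mat_exp_smult_index[OF A _ ij(2)]\<close>)
  also have "\<dots> = (A * mat_exp (s \<cdot>\<^sub>m A)) $$ (i, j)"
    by (simp add: index_mult_mat_sum[OF A E ij])
  finally have "(\<Sum>k. diffs (?c i j) k * s ^ k) = (A * mat_exp (s \<cdot>\<^sub>m A)) $$ (i, j)" .
  with der show ?thesis by (simp only: mat_exp_smult_index[OF A ij])
qed

text \<open>Integrating factor: \<open>x s = exp (- s z) y s\<close> has derivative
  \<open>exp (- s z) w s\<close>, of size at most \<open>K exp (\<delta> s)\<close> with
  \<open>\<delta> = - Re z - a\<close>. The strict gap \<open>\<delta> > 0\<close> lets the solution
  keep the rate \<open>a\<close> of the forcing term; at equality a factor \<open>s\<close> could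
  appear.\<close>

lemma linear_ode_decay:
  fixes y w :: "real \<Rightarrow> complex"
  assumes der: "\<And>s. (y has_vector_derivative (z * y s + w s)) (at s)"
    and w: "\<And>s. s \<ge> 0 \<Longrightarrow> norm (w s) \<le> K * exp (- a * s)"
    and z: "Re z < - a"
  shows "\<exists>K'. \<forall>s\<ge>0. norm (y s) \<le> K' * exp (- a * s)"
proof (intro exI allI impI)
  fix s :: real
  assume s: "s \<ge> 0"
  define \<delta> where "\<delta> = - Re z - a"
  have \<delta>: "\<delta> > 0" using z by (simp add: \<delta>_def)
  have K: "K \<ge> 0" using order_trans[OF norm_ge_zero w[of 0]] by simp
  define x where "x = (\<lambda>s. exp (- (of_real s * z)) * y s)"
  have dx: "(x has_vector_derivative exp (- (of_real r * z)) * w r) (at r)" for r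
  proof -
    have "((\<lambda>s. exp (- (of_real s * z))) has_vector_derivative - z * exp (- (of_real r * z))) (at r)"
      by (rule has_vector_derivative_real_field) (rule derivative_eq_intros refl | simp)+
    then show ?thesis unfolding x_def
      by (rule has_vector_derivative_eq_rhs[OF has_vector_derivative_mult[OF _ der]])
         (simp add: algebra_simps)
  qed
  have "norm (x s - x 0) \<le> K / \<delta> * exp (\<delta> * s) - K / \<delta> * exp (\<delta> * 0)"
  proof (cases "s = 0")
    case False
    show ?thesis
    proof (rule differentiable_bound_general[of 0 s _ "\<lambda>s. K / \<delta> * exp (\<delta> * s)"
          "\<lambda>r. exp (- (of_real r * z)) * w r" "\<lambda>s. K * exp (\<delta> * s)"])
      show "0 < s" using s False by simp
      show "continuous_on {0..s} x"
        using dx by (meson continuous_at_imp_continuous_on has_vector_derivative_continuous)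
      show "continuous_on {0..s} (\<lambda>s. K / \<delta> * exp (\<delta> * s))" by (intro continuous_intros)
      fix r assume r: "0 < r" "r < s"
      show "(x has_vector_derivative exp (- (of_real r * z)) * w r) (at r)" by (rule dx)
      have "((\<lambda>s. K / \<delta> * exp (\<delta> * s)) has_real_derivative K * exp (\<delta> * r)) (at r)"
        by (rule derivative_eq_intros refl | use \<delta> in simp)+
      then show "((\<lambda>s. K / \<delta> * exp (\<delta> * s)) has_vector_derivative K * exp (\<delta> * r)) (at r)"
        unfolding has_real_derivative_iff_has_vector_derivative .
      have "norm (exp (- (of_real r * z)) * w r) \<le> exp (- r * Re z) * (K * exp (- a * r))"
        using w[of r] r by (auto simp: norm_mult intro!: mult_left_mono)
      also have "\<dots> = K * exp (\<delta> * r)"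
        by (simp add: \<delta>_def mult.left_commute[of _ K] flip: exp_add) (simp add: algebra_simps)
      finally show "norm (exp (- (of_real r * z)) * w r) \<le> K * exp (\<delta> * r)" .
    qed
  qed simp
  moreover have "K / \<delta> * exp (\<delta> * 0) \<ge> 0" using K \<delta> by simp
  ultimately have "norm (x s) \<le> norm (y 0) + K / \<delta> * exp (\<delta> * s)"
    using norm_triangle_ineq2[of "x s" "x 0"] by (simp add: x_def)
  moreover have "norm (x s) = exp (- s * Re z) * norm (y s)" by (simp add: x_def norm_mult)
  ultimately have "exp (- s * Re z) * norm (y s) \<le> norm (y 0) + K / \<delta> * exp (\<delta> * s)" by simp
  then have "exp (s * Re z) * (exp (- s * Re z) * norm (y s))
      \<le> exp (s * Re z) * (norm (y 0) + K / \<delta> * exp (\<delta> * s))"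
    by (rule mult_left_mono) simp
  then have "norm (y s) \<le> norm (y 0) * exp (s * Re z) + K / \<delta> * (exp (s * Re z) * exp (\<delta> * s))"
    by (simp add: algebra_simps flip: mult.assoc exp_add)
  also have "exp (s * Re z) * exp (\<delta> * s) = exp (- a * s)"
    by (simp add: \<delta>_def flip: exp_add) (simp add: algebra_simps)
  also have "norm (y 0) * exp (s * Re z) \<le> norm (y 0) * exp (- a * s)"
  proof (intro mult_left_mono)
    show "exp (s * Re z) \<le> exp (- a * s)" using mult_left_mono[of "Re z" "- a" s] z s by (simp add: mult.commute)
  qed simp
  finally show "norm (y s) \<le> (norm (y 0) + K / \<delta>) * exp (- a * s)" by (simp add: algebra_simps)
qed

text \<open>Back substitution: the last equation is decoupled, and row \<open>i\<close> is a scalar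
  equation forced by the later rows, which already decay. The rate \<open>a\<close> stays the same
  on the way up, only the constants grow.\<close>

lemma triangular_ode_decay:
  fixes R :: "complex mat" and y :: "nat \<Rightarrow> real \<Rightarrow> complex"
  assumes R: "R \<in> carrier_mat n n" "upper_triangular R"
    and diag: "\<And>i. i < n \<Longrightarrow> Re (R $$ (i, i)) < - a"
    and der: "\<And>i s. i < n \<Longrightarrow> (y i has_vector_derivative (\<Sum>l<n. R $$ (i, l) * y l s)) (at s)"
    and "i < n"
  shows "\<exists>K. \<forall>s\<ge>0. norm (y i s) \<le> K * exp (- a * s)"
  using \<open>i < n\<close>
proof (induction "n - i" arbitrary: i rule: less_induct)
  case less
  have "\<exists>K. \<forall>s\<ge>0. norm (y l s) \<le> K * exp (- a * s)" if "l \<in> {i<..<n}" for l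
    using less that by auto
  then obtain K where K: "\<And>l s. l \<in> {i<..<n} \<Longrightarrow> s \<ge> 0 \<Longrightarrow> norm (y l s) \<le> K l * exp (- a * s)"
    by metis
  show ?case
  proof (rule linear_ode_decay)
    let ?w = "\<lambda>s. \<Sum>l\<in>{i<..<n}. R $$ (i, l) * y l s"
    show "Re (R $$ (i, i)) < - a" using diag less by simp
    have "(\<Sum>l<n. R $$ (i, l) * y l s) = R $$ (i, i) * y i s + ?w s" for s
    proof -
      have "(\<Sum>l<n. R $$ (i, l) * y l s) = (\<Sum>l\<in>{i..<n}. R $$ (i, l) * y l s)"
        using R less.prems by (intro sum.mono_neutral_right) (auto simp: upper_triangular_def)
      also have "{i..<n} = insert i {i<..<n}" using less.prems by auto
      finally show ?thesis by simp
    qed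
    then show "(y i has_vector_derivative (R $$ (i, i) * y i s + ?w s)) (at s)" for s
      using der[of i s] less.prems by simp
    fix s :: real
    assume s: "s \<ge> 0"
    have "norm (?w s) \<le> (\<Sum>l\<in>{i<..<n}. norm (R $$ (i, l)) * (K l * exp (- a * s)))"
      by (rule order_trans[OF norm_sum], rule sum_mono)
         (use K s in \<open>auto simp: norm_mult intro!: mult_left_mono\<close>)
    then show "norm (?w s) \<le> (\<Sum>l\<in>{i<..<n}. norm (R $$ (i, l)) * K l) * exp (- a * s)"
      by (simp add: sum_distrib_right mult.assoc)
  qed
qed

text \<open>Over the complex numbers \<open>A\<close> is similar to a triangular \<open>R\<close>
  with the eigenvalues of \<open>A\<close> on its diagonal. From \<open>Q A = R Q\<close> each
  column of \<open>Q exp (s A)\<close> solves the triangular system with matrix \<open>R\<close>,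
  and multiplying back by \<open>P\<close> changes only the constants.\<close>

lemma stable_mat_exp_decay:
  fixes A :: "real mat"
  assumes A: "A \<in> carrier_mat n n" and st: "stable_mat A"
  obtains a K where "a > 0"
    "\<And>s i j. s \<ge> 0 \<Longrightarrow> i < n \<Longrightarrow> j < n \<Longrightarrow> \<bar>mat_exp (s \<cdot>\<^sub>m A) $$ (i, j)\<bar> \<le> K * exp (- a * s)"
proof -
  let ?A = "map_mat complex_of_real A"
  have cA: "?A \<in> carrier_mat n n" using A by simp
  obtain es where es: "char_poly ?A = (\<Prod>e\<leftarrow>es. [:- e, 1:])"
    using char_poly_factorized[OF cA] by auto
  obtain R P Q where "schur_decomposition ?A es = (R, P, Q)" by (cases "schur_decomposition ?A es")
  from schur_decomposition[OF cA es this]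
  have sim: "similar_mat_wit ?A R P Q" and ut: "upper_triangular R" and dg: "diag_mat R = es" by auto
  note w = similar_mat_witD2[OF cA sim]
  have neg: "Re e < 0" if "e \<in> set es" for e
  proof -
    have "poly (char_poly ?A) e = 0"
      using that by (simp add: es poly_prod_list prod_list_zero_iff image_iff)
    then show ?thesis using st eigenvalue_root_char_poly[OF cA, of e] by (simp add: stable_mat_def)
  qed
  \<comment> \<open>At most half the distance of the spectrum from the imaginary axis, which leaves
    the strict gap that the scalar equations need. The element 1 keeps the minimum meaningful for an
    empty spectrum.\<close>
  define a where "a = Min (insert 1 ((\<lambda>e. - Re e / 2) ` set es))"
  have a: "a > 0" using neg by (auto simp: a_def)
  have diag: "Re (R $$ (i, i)) < - a" if "i < n" for i
  proof -
    have "R $$ (i, i) \<in> set es" using dg that w by (auto simp: diag_mat_def)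
    then have "a \<le> - Re (R $$ (i, i)) / 2" "Re (R $$ (i, i)) < 0"
      using neg by (auto simp: a_def intro!: Min_le)
    then show ?thesis by linarith
  qed
  define E where "E = (\<lambda>s. map_mat complex_of_real (mat_exp (s \<cdot>\<^sub>m A)))"
  have cE: "E s \<in> carrier_mat n n" for s using A by (auto simp: E_def)
  have dE: "((\<lambda>s. E s $$ (i, j)) has_vector_derivative (?A * E s) $$ (i, j)) (at s)"
    if "i < n" "j < n" for i j s
  proof -
    have "((\<lambda>s. of_real (mat_exp (s \<cdot>\<^sub>m A) $$ (i, j)) :: complex) has_vector_derivative
        of_real ((A * mat_exp (s \<cdot>\<^sub>m A)) $$ (i, j))) (at s)"
      by (intro has_vector_derivative_of_real has_real_derivative_mat_exp[OF A that])
    moreover have "map_mat complex_of_real (A * mat_exp (s \<cdot>\<^sub>m A)) = ?A * E s"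
      using A by (simp add: E_def of_real_hom.mat_hom_mult[where n = n and nr = n and nc = n])
    ultimately show ?thesis
      using index_map_mat(1)[of i "A * mat_exp (s \<cdot>\<^sub>m A)" j complex_of_real] A that
        carrier_matD[OF mat_exp_carrier[of "_ \<cdot>\<^sub>m A" n]]
      by (simp add: E_def del: index_mult_mat(1))
  qed
  have decay: "\<exists>K. \<forall>s\<ge>0. norm (E s $$ (i, j)) \<le> K * exp (- a * s)" if ij: "i < n" "j < n" for i j
  proof -
    have "\<exists>K. \<forall>s\<ge>0. norm ((Q * E s) $$ (l, j)) \<le> K * exp (- a * s)" if "l < n" for l
    proof (rule triangular_ode_decay[OF _ ut diag _ that])
      show "R \<in> carrier_mat n n" using w by simp
      fix i s assume i: "i < n"
      have "Q * ?A = Q * (P * (R * Q))"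
        unfolding w(3) using w assoc_mult_mat[OF w(6) w(5) w(7)] by simp
      also have "\<dots> = (Q * P) * (R * Q)"
        by (rule assoc_mult_mat[OF w(7) w(6) mult_carrier_mat[OF w(5) w(7)], symmetric])
      finally have QA: "Q * ?A = R * Q" using w by simp
      have eq: "Q * (?A * E s) = R * (Q * E s)"
        using assoc_mult_mat[OF w(7) cA cE[of s]] assoc_mult_mat[OF w(5) w(7) cE[of s]] QA by simp
      have "((\<lambda>s. \<Sum>l<n. Q $$ (i, l) * E s $$ (l, j)) has_vector_derivative
          (\<Sum>l<n. Q $$ (i, l) * (?A * E s) $$ (l, j))) (at s)"
        by (intro has_vector_derivative_sum has_vector_derivative_mult_right dE) (use ij in auto)
      also have "(\<lambda>s. \<Sum>l<n. Q $$ (i, l) * E s $$ (l, j)) = (\<lambda>s. (Q * E s) $$ (i, j))"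
        using index_mult_mat_sum[OF w(7) cE i ij(2)] by simp
      also have "(\<Sum>l<n. Q $$ (i, l) * (?A * E s) $$ (l, j)) = (Q * (?A * E s)) $$ (i, j)"
        by (rule index_mult_mat_sum[OF w(7) mult_carrier_mat[OF cA cE] i ij(2), symmetric])
      also have "\<dots> = (\<Sum>l<n. R $$ (i, l) * (Q * E s) $$ (l, j))"
        unfolding eq by (rule index_mult_mat_sum[OF w(5) mult_carrier_mat[OF w(7) cE] i ij(2)])
      finally show "((\<lambda>s. (Q * E s) $$ (i, j)) has_vector_derivative
          (\<Sum>l<n. R $$ (i, l) * (Q * E s) $$ (l, j))) (at s)" .
    qed simp
    then obtain K where K: "\<And>l s. l < n \<Longrightarrow> s \<ge> 0 \<Longrightarrow> norm ((Q * E s) $$ (l, j)) \<le> K l * exp (- a * s)"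
      by metis
    show ?thesis
    proof (intro exI allI impI)
      fix s :: real
      assume s: "s \<ge> 0"
      have "P * (Q * E s) = E s"
        using assoc_mult_mat[OF w(6) w(7) cE[of s]] left_mult_one_mat[OF cE[of s]] unfolding w(1) by simp
      then have "E s $$ (i, j) = (P * (Q * E s)) $$ (i, j)" by simp
      also have "\<dots> = (\<Sum>l<n. P $$ (i, l) * (Q * E s) $$ (l, j))"
        by (rule index_mult_mat_sum[OF w(6) mult_carrier_mat[OF w(7) cE] ij])
      also have "norm \<dots> \<le> (\<Sum>l<n. norm (P $$ (i, l)) * (K l * exp (- a * s)))"
        by (rule order_trans[OF norm_sum], rule sum_mono)
           (use K s in \<open>auto simp: norm_mult simp del: index_mult_mat intro!: mult_left_mono\<close>)
      finally show "norm (E s $$ (i, j)) \<le> (\<Sum>l<n. norm (P $$ (i, l)) * K l) * exp (- a * s)"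
        by (simp add: sum_distrib_right mult.assoc)
    qed
  qed
  then obtain K where K: "\<And>i j s. i < n \<Longrightarrow> j < n \<Longrightarrow> s \<ge> 0 \<Longrightarrow> norm (E s $$ (i, j)) \<le> K i j * exp (- a * s)"
    by metis
  show ?thesis
  proof (rule that[OF a, of "\<Sum>i<n. \<Sum>j<n. \<bar>K i j\<bar>"])
    fix s :: real and i j
    assume *: "s \<ge> 0" "i < n" "j < n"
    have "\<bar>mat_exp (s \<cdot>\<^sub>m A) $$ (i, j)\<bar> \<le> K i j * exp (- a * s)"
      using K[of i j s] * A by (simp add: E_def mat_exp_def)
    also have "K i j \<le> \<bar>K i j\<bar>" by simp
    also have "\<bar>K i j\<bar> \<le> (\<Sum>j<n. \<bar>K i j\<bar>)"
      using * by (intro member_le_sum[where f = "\<lambda>j. \<bar>K i j\<bar>"]) auto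
    also have "\<dots> \<le> (\<Sum>i<n. \<Sum>j<n. \<bar>K i j\<bar>)"
      using * by (intro member_le_sum[where f = "\<lambda>i. \<Sum>j<n. \<bar>K i j\<bar>"]) (auto intro!: sum_nonneg)
    finally show "\<bar>mat_exp (s \<cdot>\<^sub>m A) $$ (i, j)\<bar> \<le> (\<Sum>i<n. \<Sum>j<n. \<bar>K i j\<bar>) * exp (- a * s)"
      by (simp add: mult_right_mono)
  qed
qed

declare index_mult_mat(1) [simp del]

section \<open>Intertwining with the controller form\<close>

definition adj_coeff :: "real mat \<Rightarrow> nat \<Rightarrow> real mat" where
  "adj_coeff A k = map_mat (\<lambda>q. coeff q k) (adj_mat (char_poly_matrix A))"

lemma adj_coeff_carrier [simp]: "A \<in> carrier_mat n n \<Longrightarrow> adj_coeff A k \<in> carrier_mat n n"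
  using adj_mat(1)[OF char_poly_matrix_closed] by (simp add: adj_coeff_def)

text \<open>These are the entries of (x I - A) adj (x I - A) = det (x I - A) I, with multiplication
  by x written as \<open>pCons 0\<close>.\<close>

lemma adj_char_poly_matrix_index:
  fixes A :: "real mat"
  assumes A: "A \<in> carrier_mat n n" and ij: "i < n" "j < n"
  shows "pCons 0 (adj_mat (char_poly_matrix A) $$ (i, j))
      - (\<Sum>l<n. Polynomial.smult (A $$ (i, l)) (adj_mat (char_poly_matrix A) $$ (l, j)))
    = (if i = j then char_poly A else 0)"
proof -
  let ?P = "char_poly_matrix A" and ?Q = "adj_mat (char_poly_matrix A)"
  have P: "?P \<in> carrier_mat n n" using A by simp
  have entry: "?P $$ (i, l) * q = (if i = l then pCons 0 q else 0) - Polynomial.smult (A $$ (i, l)) q"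
    if "l < n" for l and q :: "real poly"
    using A ij that by (auto simp: char_poly_matrix_def)
  have "(?P * ?Q) $$ (i, j) = (\<Sum>l<n. ?P $$ (i, l) * ?Q $$ (l, j))"
    by (rule index_mult_mat_sum[OF P adj_mat(1)[OF P] ij])
  also have "\<dots> = (\<Sum>l<n. (if i = l then pCons 0 (?Q $$ (l, j)) else 0)
      - Polynomial.smult (A $$ (i, l)) (?Q $$ (l, j)))"
    by (intro sum.cong refl) (simp add: entry)
  also have "\<dots> = pCons 0 (?Q $$ (i, j)) - (\<Sum>l<n. Polynomial.smult (A $$ (i, l)) (?Q $$ (l, j)))"
    using ij by (simp add: sum_subtractf sum.delta)
  finally show ?thesis
    using adj_mat(2)[OF P] ij by (simp add: char_poly_def del: index_mult_mat(1) split: if_splits)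
qed

text \<open>The constant coefficient of the identity above, to which the part multiplied by x does
  not contribute. It is the recursion below with D_(-1) = 0.\<close>

lemma adj_coeff_0:
  assumes A: "A \<in> carrier_mat n n"
  shows "A * adj_coeff A 0 = - coeff (char_poly A) 0 \<cdot>\<^sub>m 1\<^sub>m n"
proof (rule eq_matI)
  fix i j assume "i < dim_row (- coeff (char_poly A) 0 \<cdot>\<^sub>m 1\<^sub>m n)"
    "j < dim_col (- coeff (char_poly A) 0 \<cdot>\<^sub>m 1\<^sub>m n)"
  then have ij: "i < n" "j < n" by auto
  show "(A * adj_coeff A 0) $$ (i, j) = (- coeff (char_poly A) 0 \<cdot>\<^sub>m 1\<^sub>m n) $$ (i, j)"
    using arg_cong[OF adj_char_poly_matrix_index[OF A ij], of "\<lambda>q. coeff q 0"] ij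
      carrier_matD[OF adj_mat(1)[OF char_poly_matrix_closed[OF A]]]
    by (subst index_mult_mat_sum[OF A adj_coeff_carrier[OF A] ij])
       (auto simp: coeff_sum adj_coeff_def split: if_splits)
qed (use A in \<open>auto simp: adj_coeff_def adj_mat_def char_poly_matrix_def\<close>)

text \<open>The coefficient of x^(k+1) in the identity above. This is Horner's scheme for the
  characteristic polynomial, and it is what makes the block row intertwine the two models.\<close>

lemma adj_coeff_Suc:
  assumes A: "A \<in> carrier_mat n n"
  shows "adj_coeff A k = A * adj_coeff A (Suc k) + coeff (char_poly A) (Suc k) \<cdot>\<^sub>m 1\<^sub>m n"
proof (rule eq_matI)
  fix i j assume "i < dim_row (A * adj_coeff A (Suc k) + coeff (char_poly A) (Suc k) \<cdot>\<^sub>m 1\<^sub>m n)"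
    "j < dim_col (A * adj_coeff A (Suc k) + coeff (char_poly A) (Suc k) \<cdot>\<^sub>m 1\<^sub>m n)"
  then have ij: "i < n" "j < n" by auto
  have "(A * adj_coeff A (Suc k) + coeff (char_poly A) (Suc k) \<cdot>\<^sub>m 1\<^sub>m n) $$ (i, j)
      = (A * adj_coeff A (Suc k)) $$ (i, j) + (if i = j then coeff (char_poly A) (Suc k) else 0)"
    using ij A by (simp del: index_mult_mat(1))
  then show "adj_coeff A k $$ (i, j)
      = (A * adj_coeff A (Suc k) + coeff (char_poly A) (Suc k) \<cdot>\<^sub>m 1\<^sub>m n) $$ (i, j)"
    using arg_cong[OF adj_char_poly_matrix_index[OF A ij], of "\<lambda>q. coeff q (Suc k)"] ij
      carrier_matD[OF adj_mat(1)[OF char_poly_matrix_closed[OF A]]]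
    by (subst (asm) index_mult_mat_sum[OF A adj_coeff_carrier[OF A] ij])
       (auto simp: coeff_sum adj_coeff_def split: if_splits)
qed (use A in \<open>auto simp: adj_coeff_def adj_mat_def char_poly_matrix_def\<close>)

text \<open>For indices from \<open>n\<close> on the recursion is homogeneous, so a zero propagates
  down to \<open>n\<close>. The initial zero is taken beyond the degrees of all entries of the
  adjugate, so that no degree bound for cofactors is required.\<close>

lemma adj_coeff_eq_0:
  assumes A: "A \<in> carrier_mat n n" and "k \<ge> n"
  shows "adj_coeff A k = 0\<^sub>m n n"
proof -
  let ?Q = "adj_mat (char_poly_matrix A)"
  have Q: "?Q \<in> carrier_mat n n" using adj_mat(1)[OF char_poly_matrix_closed[OF A]] .
  define D where "D = Suc (k + (\<Sum>i<n. \<Sum>j<n. degree (?Q $$ (i, j))))"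
  have D0: "adj_coeff A D = 0\<^sub>m n n"
  proof (rule eq_matI)
    fix i j assume "i < dim_row (0\<^sub>m n n :: real mat)" "j < dim_col (0\<^sub>m n n :: real mat)"
    then have ij: "i < n" "j < n" by auto
    have "degree (?Q $$ (i, j)) \<le> (\<Sum>j<n. degree (?Q $$ (i, j)))"
      using ij by (intro member_le_sum) auto
    also have "\<dots> \<le> (\<Sum>i<n. \<Sum>j<n. degree (?Q $$ (i, j)))"
      using ij by (intro member_le_sum[where f = "\<lambda>i. \<Sum>j<n. degree (?Q $$ (i, j))"]) auto
    finally show "adj_coeff A D $$ (i, j) = 0\<^sub>m n n $$ (i, j)"
      using ij Q by (auto simp: adj_coeff_def D_def intro!: coeff_eq_0)
  qed (use Q in \<open>auto simp: adj_coeff_def\<close>)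
  have step': "adj_coeff A j = 0\<^sub>m n n" if "n \<le> j" "adj_coeff A (Suc j) = 0\<^sub>m n n" for j
  proof -
    have "coeff (char_poly A) (Suc j) = 0"
      using degree_monic_char_poly[OF A] that(1) by (intro coeff_eq_0) simp
    then show ?thesis
      unfolding adj_coeff_Suc[OF A, of j] using A that(2) by auto
  qed
  have "k \<le> D" by (simp add: D_def)
  then show ?thesis
    using \<open>k \<ge> n\<close>
  proof (induction rule: inc_induct)
    case base
    then show ?case using D0 by simp
  next
    case (step j)
    show ?case by (rule step'[OF step.prems step.IH[OF le_SucI[OF step.prems]]])
  qed
qed

text \<open>The characteristic polynomial is monic, and the recursion at \<open>n - 1\<close> leaves
  just its leading coefficient.\<close>

lemma adj_coeff_last:
  assumes A: "A \<in> carrier_mat n n" and "n \<ge> 1"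
  shows "adj_coeff A (n - 1) = 1\<^sub>m n"
proof -
  have "adj_coeff A (n - 1) = A * adj_coeff A n + coeff (char_poly A) n \<cdot>\<^sub>m 1\<^sub>m n"
    using adj_coeff_Suc[OF A, of "n - 1"] assms by simp
  also have "A * adj_coeff A n = 0\<^sub>m n n"
    using A unfolding adj_coeff_eq_0[OF A order.refl] by simp
  also have "coeff (char_poly A) n = 1" using degree_monic_char_poly[OF A] by simp
  finally show ?thesis by (auto intro!: eq_matI)
qed

section \<open>Block indices and flat indices\<close>

lemma div_mod_less:
  assumes "r < p * (m::nat)"
  shows "r div m < p" "r mod m < m"
proof -
  show "r div m < p" using assms by (rule less_mult_imp_div_less)
  show "r mod m < m" using assms by (cases "m = 0") auto
qed

lemma block_index_less:
  assumes "a < p" "l < (m::nat)"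
  shows "a * m + l < p * m"
proof -
  have "a * m + l < Suc a * m" using assms by simp
  also have "\<dots> \<le> p * m" using assms by (intro mult_right_mono) auto
  finally show ?thesis .
qed

text \<open>A flat index stands for the pair of its block and its position inside the block, with
  inverse \<open>a * m + l\<close>; every product of block matrices below is evaluated through this
  double sum.\<close>

lemma sum_div_mod:
  fixes h :: "nat \<Rightarrow> nat \<Rightarrow> 'a::comm_monoid_add"
  shows "(\<Sum>r<p * m. h (r div m) (r mod m)) = (\<Sum>a<p. \<Sum>l<m. h a l)"
proof -
  have "(\<Sum>r<p * m. h (r div m) (r mod m)) = (\<Sum>(a, l)\<in>{..<p} \<times> {..<m}. h a l)"
  proof (rule sum.reindex_bij_witness[of _ "\<lambda>(a, l). a * m + l" "\<lambda>r. (r div m, r mod m)"])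
    fix r assume "r \<in> {..<p * m}"
    then have "r < p * m" by simp
    note div_mod_less[OF this]
    then show "(r div m, r mod m) \<in> {..<p} \<times> {..<m}" by blast
  next
    fix x assume "x \<in> {..<p} \<times> {..<m}"
    then obtain a l where x: "x = (a, l)" "a < p" "l < m" by auto
    then show "(case x of (a, l) \<Rightarrow> a * m + l) \<in> {..<p * m}"
      using block_index_less[of a p l m] by simp
    show "((case x of (a, l) \<Rightarrow> a * m + l) div m, (case x of (a, l) \<Rightarrow> a * m + l) mod m) = x"
      using x by simp
  qed (simp_all only: prod.case div_mult_mod_eq)
  then show ?thesis by (simp add: sum.cartesian_product)
qed

lemma sum_mult_delta:
  fixes f :: "nat \<Rightarrow> 'a::comm_semiring_0"
  assumes "j < m"
  shows "(\<Sum>l<m. f l * (if l = j then c else 0)) = f j * c"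
    and "(\<Sum>l<m. (if l = j then c else 0) * f l) = f j * c"
proof -
  have "(\<Sum>l<m. f l * (if l = j then c else 0)) = (\<Sum>l<m. if l = j then f l * c else 0)"
    by (intro sum.cong) auto
  then show 1: "(\<Sum>l<m. f l * (if l = j then c else 0)) = f j * c" using assms by simp
  show "(\<Sum>l<m. (if l = j then c else 0) * f l) = f j * c"
    unfolding 1[symmetric] by (simp add: mult.commute)
qed

text \<open>The numbering is that of the controller form, where index \<open>i\<close> belongs to
  x^(N-i); it runs opposite to that of \<open>coeff\<close>.\<close>

definition char_coeff_mat :: "nat \<Rightarrow> real mat \<Rightarrow> nat \<Rightarrow> real mat" where
  "char_coeff_mat m A i = coeff (char_poly A) (dim_row A - i) \<cdot>\<^sub>m 1\<^sub>m m"

lemma controller_A_carrier: "controller_A m p At \<in> carrier_mat (p * m) (p * m)"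
  and controller_B_carrier: "controller_B m p \<in> carrier_mat (p * m) m"
  and controller_C_carrier: "controller_C d m p Bt \<in> carrier_mat d (p * m)"
  by (auto simp: controller_A_def controller_B_def controller_C_def block_mat_def)

lemma controller_A_index:
  assumes A: "A \<in> carrier_mat p p" and rc: "r < p * m" "c < p * m"
  shows "controller_A m p (char_coeff_mat m A) $$ (r, c) =
    (if r mod m \<noteq> c mod m then 0
     else if r div m = p - 1 then - coeff (char_poly A) (c div m)
     else if c div m = Suc (r div m) then 1 else 0)"
proof -
  note r = div_mod_less[OF rc(1)] and c = div_mod_less[OF rc(2)]
  \<comment> \<open>The reversal of the index in the last block row of \<open>controller_A\<close>
    cancels the one in \<open>char_coeff_mat\<close>; the subtraction is not truncated because the
    block number is below \<open>p\<close>.\<close>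
  have "p - (p - c div m) = c div m" using c by simp
  moreover have "controller_A m p (char_coeff_mat m A) $$ (r, c)
    = (if r div m = p - 1 then - char_coeff_mat m A (p - c div m)
       else if c div m = r div m + 1 then 1\<^sub>m m else 0\<^sub>m m m) $$ (r mod m, c mod m)"
    using rc by (simp add: controller_A_def block_mat_def)
  moreover have "char_coeff_mat m A (p - c div m) = coeff (char_poly A) (p - (p - c div m)) \<cdot>\<^sub>m 1\<^sub>m m"
    using A by (simp add: char_coeff_mat_def)
  ultimately show ?thesis using r c by simp
qed

definition block_row :: "nat \<Rightarrow> nat \<Rightarrow> nat \<Rightarrow> (nat \<Rightarrow> real mat) \<Rightarrow> real mat" where
  "block_row n p m T = mat n (p * m) (\<lambda>(i, r). T (r div m) $$ (i, r mod m))"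

lemma block_row_carrier [simp]: "block_row n p m T \<in> carrier_mat n (p * m)"
  by (simp add: block_row_def)

text \<open>Block column b of the product receives D_(b-1) B from the shifted identity, absent for b
  = 0, and -c_b D_(p-1) B = -c_b B from the last block row, where c_b is the coefficient of x^b. By
  the recursion their sum is A D_b B.\<close>

lemma block_row_controller_A:
  fixes A B :: "real mat"
  assumes A: "A \<in> carrier_mat p p" and B: "B \<in> carrier_mat p m" and p: "p \<ge> 1"
  defines "T \<equiv> block_row p p m (\<lambda>k. adj_coeff A k * B)"
  shows "T * controller_A m p (char_coeff_mat m A) = A * T"
proof (rule eq_matI)
  fix i c assume "i < dim_row (A * T)" "c < dim_col (A * T)"
  then have i: "i < p" and c: "c < p * m" using A by (auto simp: T_def block_row_def)
  let ?b = "c div m" and ?j = "c mod m"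
  let ?S = "\<lambda>k. adj_coeff A k * B"
  let ?f = "\<lambda>a. if a = p - 1 then - coeff (char_poly A) ?b else if ?b = Suc a then 1 else 0"
  have b: "?b < p" and j: "?j < m" using div_mod_less[OF c] by auto
  have S: "?S k \<in> carrier_mat p m" for k
    by (rule mult_carrier_mat[OF adj_coeff_carrier[OF A] B])
  have T: "T \<in> carrier_mat p (p * m)" by (simp add: T_def)
  have Q: "adj_coeff A k \<in> carrier_mat p p" for k using A by simp
  have S_last: "?S (p - 1) = B" using adj_coeff_last[OF A p] B by simp
  have S_Suc: "?S k $$ (i, ?j) = (A * ?S (Suc k)) $$ (i, ?j) + coeff (char_poly A) (Suc k) * B $$ (i, ?j)" for k
  proof -
    have "?S k = A * ?S (Suc k) + coeff (char_poly A) (Suc k) \<cdot>\<^sub>m B"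
      using A B Q[of "Suc k"]
      by (subst adj_coeff_Suc[OF A])
         (simp add: add_mult_distrib_mat[of _ p p] assoc_mult_mat[of A p p _ p B m]
           mult_smult_assoc_mat[of _ p p B m])
    then show ?thesis using A B i j S[of "Suc k"] by (simp del: index_mult_mat(1))
  qed
  have S_0: "(A * ?S 0) $$ (i, ?j) = - coeff (char_poly A) 0 * B $$ (i, ?j)"
  proof -
    have "A * ?S 0 = - coeff (char_poly A) 0 \<cdot>\<^sub>m B"
      using B assoc_mult_mat[OF A Q[of 0] B] adj_coeff_0[OF A]
      by (simp add: mult_smult_assoc_mat[of _ p p B m])
    then show ?thesis using B i j by (simp del: index_mult_mat(1))
  qed
  have "(T * controller_A m p (char_coeff_mat m A)) $$ (i, c)
      = (\<Sum>r<p * m. T $$ (i, r) * controller_A m p (char_coeff_mat m A) $$ (r, c))"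
    by (rule index_mult_mat_sum[OF T controller_A_carrier i c])
  also have "\<dots> = (\<Sum>r<p * m. ?S (r div m) $$ (i, r mod m) * (if r mod m = ?j then ?f (r div m) else 0))"
    using i by (intro sum.cong refl)
      (auto simp: T_def block_row_def controller_A_index[OF A _ c] simp del: index_mult_mat(1))
  also have "\<dots> = (\<Sum>a<p. \<Sum>l<m. ?S a $$ (i, l) * (if l = ?j then ?f a else 0))"
    by (rule sum_div_mod[where h = "\<lambda>a l. ?S a $$ (i, l) * (if l = ?j then ?f a else 0)"])
  also have "\<dots> = (\<Sum>a<p. ?S a $$ (i, ?j) * ?f a)"
    by (intro sum.cong refl) (rule sum_mult_delta(1)[OF j])
  \<comment> \<open>The two nonzero cases of \<open>?f\<close> may be added instead of nested: for
    \<open>a = p - 1\<close> the second one would need \<open>?b = p\<close>, which is out of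
    range.\<close>
  also have "\<dots> = (\<Sum>a<p. (if a = p - 1 then - coeff (char_poly A) ?b * B $$ (i, ?j) else 0)
      + (if Suc a = ?b then ?S a $$ (i, ?j) else 0))"
    using b S_last by (intro sum.cong refl) auto
  also have "\<dots> = - coeff (char_poly A) ?b * B $$ (i, ?j)
      + (\<Sum>a<p. if Suc a = ?b then ?S a $$ (i, ?j) else 0)"
    using p by (simp add: sum.distrib sum.delta)
  also have "\<dots> = (A * ?S ?b) $$ (i, ?j)"
  proof (cases ?b)
    case 0
    then show ?thesis using S_0 by simp
  next
    case (Suc k)
    then show ?thesis using S_Suc[of k] b by (simp add: sum.delta del: index_mult_mat(1))
  qed
  also have "\<dots> = (\<Sum>l<p. A $$ (i, l) * T $$ (l, c))"
    using c by (subst index_mult_mat_sum[OF A S i j]) (simp add: T_def block_row_def)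
  also have "\<dots> = (A * T) $$ (i, c)"
    by (rule index_mult_mat_sum[OF A T i c, symmetric])
  finally show "(T * controller_A m p (char_coeff_mat m A)) $$ (i, c) = (A * T) $$ (i, c)" .
qed (use A in \<open>auto simp: T_def block_row_def controller_A_def block_mat_def\<close>)

text \<open>Only the last block of the input matrix is nonzero, and it picks out D_(p-1) B =
  B.\<close>

lemma block_row_controller_B:
  assumes A: "A \<in> carrier_mat p p" and B: "B \<in> carrier_mat p m" and p: "p \<ge> 1"
  shows "block_row p p m (\<lambda>k. adj_coeff A k * B) * controller_B m p = B"
proof (rule eq_matI)
  fix i j assume "i < dim_row B" "j < dim_col B"
  then have i: "i < p" and j: "j < m" using B by auto
  let ?T = "block_row p p m (\<lambda>k. adj_coeff A k * B)"
  let ?S = "\<lambda>k. adj_coeff A k * B"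
  have S_last: "?S (p - 1) = B" using adj_coeff_last[OF A p] B by simp
  have "(?T * controller_B m p) $$ (i, j) = (\<Sum>r<p * m. ?T $$ (i, r) * controller_B m p $$ (r, j))"
    by (rule index_mult_mat_sum[OF block_row_carrier controller_B_carrier i j])
  also have "\<dots> = (\<Sum>r<p * m. ?S (r div m) $$ (i, r mod m) *
      (if r div m = p - 1 then if r mod m = j then 1 else 0 else 0))"
    using i j by (intro sum.cong refl)
      (simp add: block_row_def controller_B_def block_mat_def)
  also have "\<dots> = (\<Sum>a<p. \<Sum>l<m. ?S a $$ (i, l) * (if a = p - 1 then if l = j then 1 else 0 else 0))"
    by (rule sum_div_mod[where h = "\<lambda>a l. ?S a $$ (i, l) *
      (if a = p - 1 then if l = j then 1 else 0 else 0)"])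
  also have "\<dots> = (\<Sum>a<p. if a = p - 1 then ?S a $$ (i, j) else 0)"
    by (intro sum.cong refl) (simp add: sum_mult_delta(1)[OF j])
  also have "\<dots> = B $$ (i, j)"
    using p S_last by (simp add: sum.delta del: index_mult_mat(1))
  finally show "(?T * controller_B m p) $$ (i, j) = B $$ (i, j)" .
qed (use B in \<open>auto simp: block_row_def controller_B_def block_mat_def\<close>)

lemma controller_C_block_row:
  assumes C: "C \<in> carrier_mat d n" and T: "\<And>k. T k \<in> carrier_mat n m"
  shows "controller_C d m p (\<lambda>k. C * T k) = C * block_row n p m T"
proof (rule eq_matI)
  fix i r assume "i < dim_row (C * block_row n p m T)" "r < dim_col (C * block_row n p m T)"
  then have i: "i < d" and r: "r < p * m" using C by (auto simp: block_row_def)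
  have "controller_C d m p (\<lambda>k. C * T k) $$ (i, r) = (C * T (r div m)) $$ (i, r mod m)"
    using i r by (simp add: controller_C_def block_mat_def del: index_mult_mat(1))
  also have "\<dots> = (C * block_row n p m T) $$ (i, r)"
    using div_mod_less[OF r] r
    by (subst index_mult_mat_sum[OF C T i], simp,
        subst index_mult_mat_sum[OF C block_row_carrier i r]) (simp add: block_row_def)
  finally show "controller_C d m p (\<lambda>k. C * T k) $$ (i, r) = (C * block_row n p m T) $$ (i, r)" .
qed (use C in \<open>auto simp: block_row_def controller_C_def block_mat_def\<close>)

text \<open>In an eigenvector the shifted rows force the blocks to be u_a = z^a u_0, and the last
  block row then says chi(z) u_0 = 0. As u_0 cannot vanish, \<open>z\<close> is a root of the
  characteristic polynomial of \<open>A\<close>, hence an eigenvalue of \<open>A\<close>.\<close>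

lemma stable_controller_A:
  fixes A :: "real mat"
  assumes A: "A \<in> carrier_mat p p" and p: "p \<ge> 1" and st: "stable_mat A"
  shows "stable_mat (controller_A m p (char_coeff_mat m A))"
  unfolding stable_mat_def
proof (intro allI impI)
  let ?R = "controller_A m p (char_coeff_mat m A)"
  let ?RC = "map_mat complex_of_real ?R"
  fix z assume "eigenvalue ?RC z"
  then obtain v where v: "v \<in> carrier_vec (p * m)" "v \<noteq> 0\<^sub>v (p * m)" and ev: "?RC *\<^sub>v v = z \<cdot>\<^sub>v v"
    using controller_A_carrier[of m p "char_coeff_mat m A"]
    by (auto simp: eigenvalue_def eigenvector_def)
  define u where "u = (\<lambda>a l. v $ (a * m + l))"
  note am = block_index_less
  have row: "z * u a l = (if a = p - 1 then - (\<Sum>b<p. of_real (coeff (char_poly A) b) * u b l) else u (Suc a) l)"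
    if a: "a < p" and l: "l < m" for a l
  proof -
    let ?r = "a * m + l"
    let ?f = "\<lambda>b. if a = p - 1 then - of_real (coeff (char_poly A) b) else if b = Suc a then 1 else (0::complex)"
    have r: "?r < p * m" "?r div m = a" "?r mod m = l" using am[OF a l] l by auto
    have "z * u a l = (?RC *\<^sub>v v) $ ?r" using v r by (simp add: ev u_def)
    also have "\<dots> = (\<Sum>c<p * m. ?RC $$ (?r, c) * v $ c)"
      using v r carrier_matD[OF controller_A_carrier[of m p "char_coeff_mat m A"]] by (simp add: scalar_prod_def lessThan_atLeast0)
    also have "\<dots> = (\<Sum>c<p * m. (if c mod m = l then ?f (c div m) else 0) * u (c div m) (c mod m))"
      using r controller_A_carrier[of m p "char_coeff_mat m A"]
      by (intro sum.cong refl) (auto simp: controller_A_index[OF A] u_def)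
    also have "\<dots> = (\<Sum>b<p. \<Sum>j<m. (if j = l then ?f b else 0) * u b j)"
      by (rule sum_div_mod[where h = "\<lambda>b j. (if j = l then ?f b else 0) * u b j"])
    also have "\<dots> = (\<Sum>b<p. ?f b * u b l)"
      by (simp only: sum_mult_delta(2)[OF l]) (simp only: mult.commute)
    also have "\<dots> = (if a = p - 1 then - (\<Sum>b<p. of_real (coeff (char_poly A) b) * u b l) else u (Suc a) l)"
    proof (cases "a = p - 1")
      case False
      then have "(\<Sum>b<p. ?f b * u b l) = (\<Sum>b<p. if b = Suc a then u b l else 0)"
        by (intro sum.cong) auto
      then show ?thesis using a False by (simp add: sum.delta)
    qed (simp add: sum_negf)
    finally show ?thesis .
  qed
  have pow: "u a l = z ^ a * u 0 l" if "a < p" "l < m" for a l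
    using that
  proof (induction a)
    case (Suc a)
    then show ?case using row[of a l] by (simp add: mult.assoc)
  qed simp
  \<comment> \<open>Every block is a multiple of the first one, so a nonzero entry at position
    \<open>l\<close> of some block makes the entry of the first block at \<open>l\<close>
    nonzero.\<close>
  obtain r where r: "r < p * m" "v $ r \<noteq> 0"
    using v eq_vecI[of v "0\<^sub>v (p * m)"] by auto
  then have l: "r mod m < m" and a: "r div m < p" using div_mod_less by auto
  define l where "l = r mod m"
  have "u (r div m) l \<noteq> 0" using r by (simp add: u_def l_def)
  then have u0: "u 0 l \<noteq> 0" using pow[OF a l] by (auto simp: l_def)
  have lm: "l < m" using l by (simp add: l_def)
  have 1: "z * (z ^ (p - 1) * u 0 l) = - (\<Sum>b<p. of_real (coeff (char_poly A) b) * (z ^ b * u 0 l))"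
  proof -
    have "(\<Sum>b<p. of_real (coeff (char_poly A) b) * u b l)
        = (\<Sum>b<p. of_real (coeff (char_poly A) b) * (z ^ b * u 0 l))"
    proof (rule sum.cong[OF refl])
      fix b assume "b \<in> {..<p}"
      then have "u b l = z ^ b * u 0 l" by (intro pow lm) simp
      then show "of_real (coeff (char_poly A) b) * u b l = of_real (coeff (char_poly A) b) * (z ^ b * u 0 l)"
        by (rule arg_cong)
    qed
    then show ?thesis using row[of "p - 1" l] pow[of "p - 1" l] p lm by simp
  qed
  have 2: "z * (z ^ (p - 1) * u 0 l) = z ^ p * u 0 l"
  proof -
    have "z * z ^ (p - 1) = z ^ p"
      using p power_minus_mult[of p z] by (subst mult.commute) simp
    then show ?thesis by (simp only: mult.assoc[symmetric])
  qed
  have "z ^ p * u 0 l = - (\<Sum>b<p. of_real (coeff (char_poly A) b) * (z ^ b * u 0 l))"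
    by (rule trans[OF 2[symmetric] 1])
  then have "(z ^ p + (\<Sum>b<p. of_real (coeff (char_poly A) b) * z ^ b)) * u 0 l = 0"
    by (simp add: sum_distrib_right mult.assoc distrib_right)
  with u0 have "z ^ p + (\<Sum>b<p. of_real (coeff (char_poly A) b) * z ^ b) = 0" by simp
  moreover have "poly (map_poly complex_of_real (char_poly A)) z
      = (\<Sum>b\<le>p. of_real (coeff (char_poly A) b) * z ^ b)"
    using degree_monic_char_poly[OF A] by (simp add: poly_altdef coeff_map_poly degree_map_poly)
  moreover have "(\<Sum>b\<le>p. of_real (coeff (char_poly A) b) * z ^ b)
      = z ^ p + (\<Sum>b<p. of_real (coeff (char_poly A) b) * z ^ b)"
    using degree_monic_char_poly[OF A] 
    by (subst lessThan_Suc_atMost[symmetric]) simp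
  ultimately have "poly (char_poly (map_mat complex_of_real A)) z = 0"
    by (simp add: of_real_hom.char_poly_hom[OF A])
  then show "Re z < 0"
    using st A eigenvalue_root_char_poly[of "map_mat complex_of_real A" p z]
    by (auto simp: stable_mat_def)
qed

section \<open>The variogram of a scalar Levy process\<close>

lemma square_add_le: "(x + y)\<^sup>2 \<le> 2 * x\<^sup>2 + 2 * (y::real)\<^sup>2"
proof -
  have "2 * x * y \<le> x\<^sup>2 + y\<^sup>2" by (rule sum_squares_bound)
  moreover have "(x + y)\<^sup>2 = x\<^sup>2 + y\<^sup>2 + 2 * x * y" by (rule power2_sum)
  ultimately show ?thesis by linarith
qed

context prob_space
begin

lemma square_integrable_add:
  fixes X Y :: "'a \<Rightarrow> real"
  assumes [measurable]: "X \<in> borel_measurable M" "Y \<in> borel_measurable M"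
    and "integrable M (\<lambda>\<omega>. (X \<omega>)\<^sup>2)" "integrable M (\<lambda>\<omega>. (Y \<omega>)\<^sup>2)"
  shows "integrable M (\<lambda>\<omega>. (X \<omega> + Y \<omega>)\<^sup>2)"
proof (rule Bochner_Integration.integrable_bound)
  show "integrable M (\<lambda>\<omega>. 2 * (X \<omega>)\<^sup>2 + 2 * (Y \<omega>)\<^sup>2)" using assms by simp
  show "AE \<omega> in M. norm ((X \<omega> + Y \<omega>)\<^sup>2) \<le> norm (2 * (X \<omega>)\<^sup>2 + 2 * (Y \<omega>)\<^sup>2)"
    using square_add_le by (intro AE_I2) simp
qed simp

text \<open>By Fubini, \<open>(X + y)\<^sup>2\<close> is integrable for almost every value \<open>y\<close> of \<open>Y\<close>.\<close>

lemma indep_sum_square_integrable: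
  fixes X Y :: "'a \<Rightarrow> real"
  assumes ind: "indep_var borel X borel Y" and sq: "integrable M (\<lambda>\<omega>. (X \<omega> + Y \<omega>)\<^sup>2)"
  shows "integrable M (\<lambda>\<omega>. (X \<omega>)\<^sup>2)"
proof -
  have X[measurable]: "X \<in> borel_measurable M" and Y[measurable]: "Y \<in> borel_measurable M"
    and prod: "distr M borel X \<Otimes>\<^sub>M distr M borel Y = distr M (borel \<Otimes>\<^sub>M borel) (\<lambda>x. (X x, Y x))"
    using ind unfolding indep_var_distribution_eq by auto
  interpret PX: prob_space "distr M borel X" by (rule prob_space_distr[OF X])
  interpret PY: prob_space "distr M borel Y" by (rule prob_space_distr[OF Y])
  interpret pair_sigma_finite "distr M borel X" "distr M borel Y" ..
  let ?f = "\<lambda>(x, y). ennreal ((x + y)\<^sup>2)"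
  have f: "?f \<in> borel_measurable (distr M borel X \<Otimes>\<^sub>M distr M borel Y)" by measurable
  have "(\<integral>\<^sup>+y. (\<integral>\<^sup>+x. ?f (x, y) \<partial>distr M borel X) \<partial>distr M borel Y)
      = integral\<^sup>N (distr M borel X \<Otimes>\<^sub>M distr M borel Y) ?f"
    by (rule nn_integral_snd[OF f])
  also have "\<dots> = (\<integral>\<^sup>+\<omega>. ennreal ((X \<omega> + Y \<omega>)\<^sup>2) \<partial>M)"
    unfolding prod by (subst nn_integral_distr) auto
  also have "\<dots> < \<infinity>"
    using sq by (simp add: integrable_iff_bounded)
  finally have "(\<integral>\<^sup>+y. (\<integral>\<^sup>+x. ?f (x, y) \<partial>distr M borel X) \<partial>distr M borel Y) \<noteq> \<infinity>" by simp
  moreover have "(\<lambda>y. \<integral>\<^sup>+x. ennreal ((x + y)\<^sup>2) \<partial>distr M borel X) \<in> borel_measurable (distr M borel Y)"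
    by measurable
  ultimately have ae: "AE y in distr M borel Y. (\<integral>\<^sup>+x. ennreal ((x + y)\<^sup>2) \<partial>distr M borel X) \<noteq> \<infinity>"
    by (intro nn_integral_PInf_AE) simp_all
  have "\<exists>y. (\<integral>\<^sup>+x. ennreal ((x + y)\<^sup>2) \<partial>distr M borel X) \<noteq> \<infinity>"
  proof (rule ccontr)
    assume "\<nexists>y. (\<integral>\<^sup>+x. ennreal ((x + y)\<^sup>2) \<partial>distr M borel X) \<noteq> \<infinity>"
    with ae have "AE y in distr M borel Y. False" by (auto elim!: eventually_mono)
    then show False using PY.AE_False by blast
  qed
  then obtain y where "(\<integral>\<^sup>+x. ennreal ((x + y)\<^sup>2) \<partial>distr M borel X) \<noteq> \<infinity>" by blast
  then have "(\<integral>\<^sup>+\<omega>. ennreal ((X \<omega> + y)\<^sup>2) \<partial>M) < \<infinity>"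
    by (simp add: nn_integral_distr less_top)
  then have "integrable M (\<lambda>\<omega>. (X \<omega> + y)\<^sup>2)"
    by (intro integrableI_bounded) auto
  \<comment> \<open>The constant \<open>y\<close> is removed again; constants are square integrable
    because the measure is finite.\<close>
  from square_integrable_add[OF _ _ this, of "\<lambda>_. - y"] show ?thesis by simp
qed

end

text \<open>The same combination of distances arises when the covariance of two increments is
  computed from the variogram. In this form no case distinction on the order of the four endpoints
  is needed later.\<close>

lemma overlap_length:
  fixes s t s' t' :: real
  assumes "s \<le> t" "s' \<le> t'"
  shows "integrable lborel (\<lambda>u. indicator {s<..t} u * indicator {s'<..t'} u :: real)"
    and "(\<integral>u. indicator {s<..t} u * indicator {s'<..t'} u \<partial>lborel)
      = (\<bar>t - s'\<bar> + \<bar>s - t'\<bar> - \<bar>t - t'\<bar> - \<bar>s - s'\<bar>) / 2"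
proof -
  have eq: "(\<lambda>u. indicator {s<..t} u * indicator {s'<..t'} u :: real)
      = indicator {max s s'<..min t t'}"
    by (auto simp: indicator_def fun_eq_iff)
  have fin: "emeasure lborel {max s s'<..min t t'} < \<infinity>"
    by (cases "max s s' \<le> min t t'") (auto simp: emeasure_lborel_Ioc)
  show "integrable lborel (\<lambda>u. indicator {s<..t} u * indicator {s'<..t'} u :: real)"
    unfolding eq using fin by (intro integrable_real_indicator) auto
  have "measure lborel {max s s'<..min t t'} = max 0 (min t t' - max s s')"
    by (cases "max s s' \<le> min t t'") (auto simp: measure_lborel_Ioc)
  also have "\<dots> = (\<bar>t - s'\<bar> + \<bar>s - t'\<bar> - \<bar>t - t'\<bar> - \<bar>s - s'\<bar>) / 2"
    using assms by (auto simp: max_def min_def abs_if)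
  finally show "(\<integral>u. indicator {s<..t} u * indicator {s'<..t'} u \<partial>lborel)
      = (\<bar>t - s'\<bar> + \<bar>s - t'\<bar> - \<bar>t - t'\<bar> - \<bar>s - s'\<bar>) / 2"
    unfolding eq by simp
qed

text \<open>The scalar setting for all moment computations; each coordinate of the vector process
  will be an instance.\<close>

locale centred_levy = prob_space M for M :: "'w measure" +
  fixes W :: "real \<Rightarrow> 'w \<Rightarrow> real"
  assumes W_measurable [measurable]: "\<And>t. W t \<in> borel_measurable M"
    and increments_indep: "\<And>s t u. s < t \<Longrightarrow> t < u \<Longrightarrow>
      indep_var borel (\<lambda>\<omega>. W t \<omega> - W s \<omega>) borel (\<lambda>\<omega>. W u \<omega> - W t \<omega>)"
    and increments_stationary: "\<And>s t h. distr M borel (\<lambda>\<omega>. W (t + h) \<omega> - W (s + h) \<omega>)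
      = distr M borel (\<lambda>\<omega>. W t \<omega> - W s \<omega>)"
    and W_0: "AE \<omega> in M. W 0 \<omega> = 0"
    and right_continuous: "AE \<omega> in M. \<forall>t. ((\<lambda>s. W s \<omega>) \<longlongrightarrow> W t \<omega>) (at_right t)"
    and W_1_square_integrable: "integrable M (\<lambda>\<omega>. (W 1 \<omega>)\<^sup>2)"
    and W_1_mean: "expectation (W 1) = 0"
begin

section \<open>Moments of the increments\<close>

definition var_1 :: real where "var_1 = expectation (\<lambda>\<omega>. (W 1 \<omega>)\<^sup>2)"

lemma var_1_nonneg: "var_1 \<ge> 0"
  by (simp add: var_1_def)

text \<open>Stationarity with shift \<open>s\<close>. The term \<open>W 0\<close> is kept since it
  vanishes only almost surely, and \<open>t - s\<close> may be negative.\<close>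

lemma increment_shift:
  fixes f :: "real \<Rightarrow> real"
  assumes [measurable]: "f \<in> borel_measurable borel"
  shows "integrable M (\<lambda>\<omega>. f (W t \<omega> - W s \<omega>)) \<longleftrightarrow> integrable M (\<lambda>\<omega>. f (W (t - s) \<omega> - W 0 \<omega>))"
    and "expectation (\<lambda>\<omega>. f (W t \<omega> - W s \<omega>)) = expectation (\<lambda>\<omega>. f (W (t - s) \<omega> - W 0 \<omega>))"
proof -
  have d: "distr M borel (\<lambda>\<omega>. W t \<omega> - W s \<omega>) = distr M borel (\<lambda>\<omega>. W (t - s) \<omega> - W 0 \<omega>)"
    using increments_stationary[of "t - s" s 0] by simp
  have "integrable (distr M borel (\<lambda>\<omega>. W b \<omega> - W a \<omega>)) f \<longleftrightarrow> integrable M (\<lambda>\<omega>. f (W b \<omega> - W a \<omega>))" for a b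
    by (rule integrable_distr_eq) simp_all
  then show "integrable M (\<lambda>\<omega>. f (W t \<omega> - W s \<omega>)) \<longleftrightarrow> integrable M (\<lambda>\<omega>. f (W (t - s) \<omega> - W 0 \<omega>))"
    using d by metis
  have "integral\<^sup>L (distr M borel (\<lambda>\<omega>. W b \<omega> - W a \<omega>)) f = expectation (\<lambda>\<omega>. f (W b \<omega> - W a \<omega>))" for a b
    by (rule integral_distr) simp_all
  then show "expectation (\<lambda>\<omega>. f (W t \<omega> - W s \<omega>)) = expectation (\<lambda>\<omega>. f (W (t - s) \<omega> - W 0 \<omega>))"
    using d by metis
qed

lemma increment_1:
  "integrable M (\<lambda>\<omega>. (W 1 \<omega> - W 0 \<omega>)\<^sup>2)"
  "expectation (\<lambda>\<omega>. (W 1 \<omega> - W 0 \<omega>)\<^sup>2) = var_1"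
  "expectation (\<lambda>\<omega>. W 1 \<omega> - W 0 \<omega>) = 0"
proof -
  have ae: "AE \<omega> in M. (W 1 \<omega> - W 0 \<omega>)\<^sup>2 = (W 1 \<omega>)\<^sup>2" "AE \<omega> in M. W 1 \<omega> - W 0 \<omega> = W 1 \<omega>"
    using W_0 by auto
  show "integrable M (\<lambda>\<omega>. (W 1 \<omega> - W 0 \<omega>)\<^sup>2)"
    using W_1_square_integrable by (subst integrable_cong_AE[OF _ _ ae(1)]) auto
  show "expectation (\<lambda>\<omega>. (W 1 \<omega> - W 0 \<omega>)\<^sup>2) = var_1"
    unfolding var_1_def by (rule integral_cong_AE[OF _ _ ae(1)]) auto
  show "expectation (\<lambda>\<omega>. W 1 \<omega> - W 0 \<omega>) = 0"
    by (rule trans[OF integral_cong_AE[OF _ _ ae(2)] W_1_mean]) auto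
qed

text \<open>Up to time 1 the increment is one of two independent summands of the square integrable
  \<open>W 1 - W 0\<close>. Longer increments are reached by adding unit steps.\<close>

lemma increment_square_integrable_pos: "h > 0 \<Longrightarrow> h \<le> real n \<Longrightarrow> integrable M (\<lambda>\<omega>. (W h \<omega> - W 0 \<omega>)\<^sup>2)"
proof (induction n arbitrary: h)
  case (Suc n)
  show ?case
  proof (cases "h \<le> 1")
    case True
    show ?thesis
    proof (cases "h = 1")
      case False
      then have "indep_var borel (\<lambda>\<omega>. W h \<omega> - W 0 \<omega>) borel (\<lambda>\<omega>. W 1 \<omega> - W h \<omega>)"
        using True Suc.prems by (intro increments_indep) auto
      then show ?thesis by (rule indep_sum_square_integrable) (use increment_1(1) in simp)
    qed (use increment_1 in simp)
  next
    case False
    have "integrable M (\<lambda>\<omega>. (W (h - 1) \<omega> - W 0 \<omega>)\<^sup>2)"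
      using False Suc.prems by (intro Suc.IH) auto
    then have "integrable M (\<lambda>\<omega>. (W h \<omega> - W 1 \<omega>)\<^sup>2)"
      using increment_shift(1)[of "\<lambda>x. x\<^sup>2" h 1] by simp
    from square_integrable_add[OF _ _ this increment_1(1)] show ?thesis by simp
  qed
qed simp

lemma increment_square_integrable: "integrable M (\<lambda>\<omega>. (W t \<omega> - W s \<omega>)\<^sup>2)"
proof -
  have pos: "integrable M (\<lambda>\<omega>. (W t \<omega> - W s \<omega>)\<^sup>2)" if "s < t" for s t
  proof -
    obtain n where "t - s \<le> real n" using real_arch_simple by blast
    then have "integrable M (\<lambda>\<omega>. (W (t - s) \<omega> - W 0 \<omega>)\<^sup>2)"
      using that by (intro increment_square_integrable_pos) auto
    then show ?thesis using increment_shift(1)[of "\<lambda>x. x\<^sup>2" t s] by simp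
  qed
  show ?thesis
    using pos[of s t] pos[of t s] by (cases s t rule: linorder_cases) (auto simp: power2_commute)
qed

lemma increment_integrable: "integrable M (\<lambda>\<omega>. W t \<omega> - W s \<omega>)"
  by (rule square_integrable_imp_integrable[OF _ increment_square_integrable]) simp

lemma increment_mult_integrable: "integrable M (\<lambda>\<omega>. (W t \<omega> - W s \<omega>) * (W t' \<omega> - W s' \<omega>))"
proof (rule Bochner_Integration.integrable_bound)
  show "integrable M (\<lambda>\<omega>. (W t \<omega> - W s \<omega>)\<^sup>2 + (W t' \<omega> - W s' \<omega>)\<^sup>2)"
    by (intro Bochner_Integration.integrable_add increment_square_integrable)
  have "\<bar>x * y\<bar> \<le> x\<^sup>2 + y\<^sup>2" for x y :: real
    using sum_squares_bound[of x y] sum_squares_bound[of "- x" y] zero_le_power2[of x] zero_le_power2[of y]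
    by (auto simp: abs_if)
  then show "AE \<omega> in M. norm ((W t \<omega> - W s \<omega>) * (W t' \<omega> - W s' \<omega>))
      \<le> norm ((W t \<omega> - W s \<omega>)\<^sup>2 + (W t' \<omega> - W s' \<omega>)\<^sup>2)"
    by (intro AE_I2) simp
qed simp

text \<open>The mean is carried along because it is known to vanish at time 1, but not yet at a
  general time.\<close>

definition mean :: "real \<Rightarrow> real" where "mean h = expectation (\<lambda>\<omega>. W h \<omega> - W 0 \<omega>)"
definition second_moment :: "real \<Rightarrow> real" where "second_moment h = expectation (\<lambda>\<omega>. (W h \<omega> - W 0 \<omega>)\<^sup>2)"

lemma mean_0 [simp]: "mean 0 = 0" and second_moment_0 [simp]: "second_moment 0 = 0"
  by (simp_all add: mean_def second_moment_def)

lemma mean_1: "mean 1 = 0" and second_moment_1: "second_moment 1 = var_1"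
  using increment_1 by (simp_all add: mean_def second_moment_def)

lemma increment_mean: "expectation (\<lambda>\<omega>. W t \<omega> - W s \<omega>) = mean (t - s)"
  using increment_shift(2)[of "\<lambda>x. x" t s] by (simp add: mean_def)

lemma increment_second_moment: "expectation (\<lambda>\<omega>. (W t \<omega> - W s \<omega>)\<^sup>2) = second_moment (t - s)"
  using increment_shift(2)[of "\<lambda>x. x\<^sup>2" t s] by (simp add: second_moment_def)

lemma moments_add:
  assumes "h \<ge> 0" "k \<ge> 0"
  shows "mean (h + k) = mean h + mean k"
    and "second_moment (h + k) = second_moment h + second_moment k + 2 * mean h * mean k"
proof -
  let ?X = "\<lambda>\<omega>. W h \<omega> - W 0 \<omega>" and ?Y = "\<lambda>\<omega>. W (h + k) \<omega> - W h \<omega>"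
  have "mean (h + k) = expectation (\<lambda>\<omega>. ?X \<omega> + ?Y \<omega>)" by (simp add: mean_def)
  also have "\<dots> = expectation ?X + expectation ?Y"
    by (rule Bochner_Integration.integral_add[OF increment_integrable increment_integrable])
  also have "expectation ?Y = mean k" by (simp add: increment_mean)
  finally show "mean (h + k) = mean h + mean k" by (simp add: mean_def)
  \<comment> \<open>Independence is available for strictly increasing times; if \<open>h\<close> or
    \<open>k\<close> is zero the claim is trivial, and this case is split off at the end.\<close>
  have XY: "expectation (\<lambda>\<omega>. ?X \<omega> * ?Y \<omega>) = mean h * mean k" if "h > 0" "k > 0"
  proof -
    have "indep_var borel ?X borel ?Y" using that by (intro increments_indep) auto
    then have "expectation (\<lambda>\<omega>. ?X \<omega> * ?Y \<omega>) = expectation ?X * expectation ?Y"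
      by (rule indep_var_lebesgue_integral[OF _ increment_integrable increment_integrable])
    then show ?thesis using increment_mean[of "h + k" h] by (simp add: mean_def)
  qed
  have "second_moment (h + k) = expectation (\<lambda>\<omega>. (?X \<omega>)\<^sup>2 + (?Y \<omega>)\<^sup>2 + 2 * (?X \<omega> * ?Y \<omega>))"
    unfolding second_moment_def by (intro Bochner_Integration.integral_cong) (auto simp: power2_eq_square algebra_simps)
  also have "\<dots> = second_moment h + second_moment k + 2 * expectation (\<lambda>\<omega>. ?X \<omega> * ?Y \<omega>)"
    using increment_square_integrable increment_mult_integrable increment_second_moment[of "h + k" h]
    by (simp add: second_moment_def)
  finally have "second_moment (h + k) = second_moment h + second_moment k + 2 * expectation (\<lambda>\<omega>. ?X \<omega> * ?Y \<omega>)" .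
  then show "second_moment (h + k) = second_moment h + second_moment k + 2 * mean h * mean k"
    using XY assms by (cases "h = 0 \<or> k = 0") auto
qed

lemma mean_of_nat_mult: "h \<ge> 0 \<Longrightarrow> mean (real n * h) = real n * mean h"
proof (induction n)
  case (Suc n)
  then show ?case using moments_add(1)[of "real n * h" h] by (simp add: algebra_simps)
qed simp

lemma second_moment_of_nat_mult:
  assumes "h \<ge> 0" "mean h = 0"
  shows "second_moment (real n * h) = real n * second_moment h"
proof (induction n)
  case (Suc n)
  then show ?case using moments_add(2)[of "real n * h" h] assms by (simp add: algebra_simps)
qed simp

text \<open>The mean at 1/n is zero because n times it is the mean at 1. Without means the second
  moment is additive along the multiples of 1/n.\<close>

lemma second_moment_rational:
  assumes "n \<ge> 1"
  shows "second_moment (real k / real n) = real k / real n * var_1"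
proof -
  let ?h = "1 / real n"
  have n: "real n * ?h = 1" using assms by simp
  have "real n * mean ?h = 0" using mean_of_nat_mult[of ?h n] by (simp only: n mean_1) simp
  then have m: "mean ?h = 0" using assms by simp
  have "real n * second_moment ?h = var_1"
    using second_moment_of_nat_mult[OF _ m, of n] by (simp only: n second_moment_1) simp
  then have "second_moment ?h = ?h * var_1" using assms by (simp add: field_simps)
  then show ?thesis using second_moment_of_nat_mult[OF _ m, of k] by simp
qed

text \<open>Fatou's lemma along rational times decreasing to \<open>h\<close>, where the paths
  converge by right-continuity. No majorant for the increments is at hand, so at this point only an
  inequality results.\<close>

lemma second_moment_le:
  assumes "h > 0"
  shows "second_moment h \<le> h * var_1"
proof -
  \<comment> \<open>The first point of the grid of mesh 1/(n+1) strictly to the right of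
    \<open>h\<close>: it is rational and never equal to \<open>h\<close>, as a limit along
    \<open>at_right\<close> requires.\<close>
  define q where "q = (\<lambda>n. real (nat \<lfloor>real (Suc n) * h\<rfloor> + 1) / real (Suc n))"
  have q_bounds: "h < q n" "q n \<le> h + 1 / real (Suc n)" for n
  proof -
    have "real (nat \<lfloor>real (Suc n) * h\<rfloor> + 1) = of_int \<lfloor>real (Suc n) * h\<rfloor> + 1"
      using assms by simp
    moreover have "real (Suc n) * h < of_int \<lfloor>real (Suc n) * h\<rfloor> + 1"
      "of_int \<lfloor>real (Suc n) * h\<rfloor> + 1 \<le> real (Suc n) * h + 1" by linarith+
    ultimately show "h < q n" "q n \<le> h + 1 / real (Suc n)"
      unfolding q_def by (simp_all add: field_simps del: of_nat_Suc)
  qed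
  have "q \<longlonglongrightarrow> h"
  proof (rule tendsto_sandwich[of "\<lambda>_. h" _ _ "\<lambda>n. h + 1 / real (Suc n)"])
    show "(\<lambda>n. h + 1 / real (Suc n)) \<longlonglongrightarrow> h"
      using tendsto_add[OF tendsto_const LIMSEQ_inverse_real_of_nat, of h] by (simp add: inverse_eq_divide)
  qed (use q_bounds in \<open>auto intro!: always_eventually less_imp_le\<close>)
  then have q_right: "filterlim q (at_right h) sequentially"
    using q_bounds by (auto simp: filterlim_at intro!: always_eventually)
  have ae: "AE \<omega> in M. ennreal ((W h \<omega> - W 0 \<omega>)\<^sup>2) = liminf (\<lambda>n. ennreal ((W (q n) \<omega> - W 0 \<omega>)\<^sup>2))"
    using right_continuous
  proof eventually_elim
    case (elim \<omega>)
    then have "((\<lambda>s. W s \<omega>) \<longlongrightarrow> W h \<omega>) (at_right h)" by blast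
    from filterlim_compose[OF this q_right] show ?case
      by (intro lim_imp_Liminf[symmetric] tendsto_ennrealI tendsto_intros) simp_all
  qed
  have "ennreal (second_moment h) = (\<integral>\<^sup>+\<omega>. ennreal ((W h \<omega> - W 0 \<omega>)\<^sup>2) \<partial>M)"
    unfolding second_moment_def
    by (rule nn_integral_eq_integral[symmetric, OF increment_square_integrable]) simp
  also have "\<dots> = (\<integral>\<^sup>+\<omega>. liminf (\<lambda>n. ennreal ((W (q n) \<omega> - W 0 \<omega>)\<^sup>2)) \<partial>M)"
    by (rule nn_integral_cong_AE[OF ae])
  also have "\<dots> \<le> liminf (\<lambda>n. \<integral>\<^sup>+\<omega>. ennreal ((W (q n) \<omega> - W 0 \<omega>)\<^sup>2) \<partial>M)"
    by (rule nn_integral_liminf) simp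
  also have "(\<lambda>n. \<integral>\<^sup>+\<omega>. ennreal ((W (q n) \<omega> - W 0 \<omega>)\<^sup>2) \<partial>M) = (\<lambda>n. ennreal (q n * var_1))"
  proof
    fix n
    have "second_moment (q n) = q n * var_1"
      unfolding q_def by (rule second_moment_rational) simp
    then show "(\<integral>\<^sup>+\<omega>. ennreal ((W (q n) \<omega> - W 0 \<omega>)\<^sup>2) \<partial>M) = ennreal (q n * var_1)"
      by (subst nn_integral_eq_integral[OF increment_square_integrable]) (auto simp: second_moment_def)
  qed
  also have "liminf (\<lambda>n. ennreal (q n * var_1)) = ennreal (h * var_1)"
    by (intro lim_imp_Liminf tendsto_ennrealI tendsto_intros \<open>q \<longlonglongrightarrow> h\<close>) simp
  finally show ?thesis using assms var_1_nonneg by (simp add: ennreal_le_iff)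
qed

text \<open>At an integer \<open>n > h\<close> the second moment is exactly \<open>n * var_1\<close>, which leaves no room for a
  nonzero mean at \<open>h\<close> nor for strict inequality in the bound above.\<close>

lemma second_moment_eq:
  assumes "h \<ge> 0"
  shows "second_moment h = h * var_1"
proof (cases "h = 0")
  case False
  then have h: "h > 0" using assms by simp
  obtain n :: nat where n: "h < real n" using reals_Archimedean2 by blast
  have "mean (real n) = 0" using mean_of_nat_mult[of 1 n] by (simp add: mean_1)
  then have m: "mean (real n - h) = - mean h"
    using moments_add(1)[of h "real n - h"] h n by simp
  \<comment> \<open>The means at \<open>h\<close> and \<open>real n - h\<close> are opposite, so the
    cross term 2 * mean * mean becomes -2 (mean h)^2, a term of known sign.\<close>
  have "real n * var_1 = second_moment h + second_moment (real n - h) - 2 * (mean h)\<^sup>2"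
    using moments_add(2)[of h "real n - h"] second_moment_rational[of 1 n] h n m
    by (simp add: power2_eq_square)
  moreover have "second_moment h \<le> h * var_1" "second_moment (real n - h) \<le> (real n - h) * var_1"
    using h n by (auto intro!: second_moment_le)
  moreover have "(mean h)\<^sup>2 \<ge> 0" by simp
  moreover have "(real n - h) * var_1 = real n * var_1 - h * var_1" by (simp add: algebra_simps)
  ultimately show ?thesis by linarith
qed simp

section \<open>Variogram, covariances and the isometry for step functions\<close>

lemma variogram: "expectation (\<lambda>\<omega>. (W t \<omega> - W s \<omega>)\<^sup>2) = \<bar>t - s\<bar> * var_1"
proof -
  have pos: "expectation (\<lambda>\<omega>. (W t \<omega> - W s \<omega>)\<^sup>2) = (t - s) * var_1" if "s \<le> t" for s t
    using that second_moment_eq[of "t - s"] by (simp add: increment_second_moment)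
  show ?thesis
    using pos[of s t] pos[of t s] by (cases "s \<le> t") (auto simp: power2_commute)
qed

text \<open>Polarisation: twice the product of two increments is a signed sum of four squared
  increments. The variogram thus determines the covariance for every relative position of the two
  intervals.\<close>

lemma increment_covariance:
  "expectation (\<lambda>\<omega>. (W t \<omega> - W s \<omega>) * (W t' \<omega> - W s' \<omega>))
    = (\<bar>t - s'\<bar> + \<bar>s - t'\<bar> - \<bar>t - t'\<bar> - \<bar>s - s'\<bar>) / 2 * var_1"
proof -
  let ?D = "\<lambda>a b \<omega>. (W a \<omega> - W b \<omega>)\<^sup>2"
  have "(\<lambda>\<omega>. (W t \<omega> - W s \<omega>) * (W t' \<omega> - W s' \<omega>))
      = (\<lambda>\<omega>. (?D t s' \<omega> + ?D s t' \<omega> - ?D t t' \<omega> - ?D s s' \<omega>) / 2)"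
    by (auto simp: power2_eq_square algebra_simps)
  then have "expectation (\<lambda>\<omega>. (W t \<omega> - W s \<omega>) * (W t' \<omega> - W s' \<omega>))
      = (expectation (?D t s') + expectation (?D s t') - expectation (?D t t') - expectation (?D s s')) / 2"
    by (simp add: increment_square_integrable)
  then show ?thesis by (simp add: variogram algebra_simps)
qed

text \<open>Both sides expand into double sums with the same coefficients, and the covariances on
  the left are \<open>var_1\<close> times the overlap lengths on the right. Since the intervals may
  overlap, step lists never have to be refined to disjoint ones.\<close>

lemma isometry_sum:
  fixes s t c :: "nat \<Rightarrow> real"
  assumes st: "\<And>i. i < n \<Longrightarrow> s i \<le> t i"
  shows "(\<integral>\<^sup>+\<omega>. ennreal ((\<Sum>i<n. c i * (W (t i) \<omega> - W (s i) \<omega>))\<^sup>2) \<partial>M)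
    = ennreal var_1 * (\<integral>\<^sup>+u. ennreal ((\<Sum>i<n. indicator {s i<..t i} u * c i)\<^sup>2) \<partial>lborel)"
proof -
  let ?I = "\<lambda>i u. indicator {s i<..t i} u :: real" and ?D = "\<lambda>i \<omega>. W (t i) \<omega> - W (s i) \<omega>"
  have sq: "(\<Sum>i<n. f i)\<^sup>2 = (\<Sum>i<n. \<Sum>j<n. f i * f j)" for f :: "nat \<Rightarrow> real"
    by (simp add: power2_eq_square sum_product)
  have l: "(\<lambda>\<omega>. (\<Sum>i<n. c i * ?D i \<omega>)\<^sup>2) = (\<lambda>\<omega>. \<Sum>i<n. \<Sum>j<n. c i * c j * (?D i \<omega> * ?D j \<omega>))"
    unfolding sq by (intro ext sum.cong refl) (simp only: ac_simps)
  have r: "(\<lambda>u. (\<Sum>i<n. ?I i u * c i)\<^sup>2) = (\<lambda>u. \<Sum>i<n. \<Sum>j<n. c i * c j * (?I i u * ?I j u))"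
    unfolding sq by (intro ext sum.cong refl) (simp only: ac_simps)
  \<comment> \<open>Stated for an arbitrary measure, because it is applied to \<open>M\<close> as
    well as to \<open>lborel\<close>.\<close>
  have double_sum: "integrable N (\<lambda>x. \<Sum>i<n. \<Sum>j<n. c i * c j * g i j x)"
    "(\<integral>x. (\<Sum>i<n. \<Sum>j<n. c i * c j * g i j x) \<partial>N) = (\<Sum>i<n. \<Sum>j<n. c i * c j * (\<integral>x. g i j x \<partial>N))"
    if g: "\<And>i j. i < n \<Longrightarrow> j < n \<Longrightarrow> integrable N (g i j)"
    for N :: "'x measure" and g :: "nat \<Rightarrow> nat \<Rightarrow> 'x \<Rightarrow> real"
  proof -
    have 1: "integrable N (\<lambda>x. \<Sum>j<n. c i * c j * g i j x)" if "i \<in> {..<n}" for i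
      by (rule Bochner_Integration.integrable_sum) (use g that in simp)
    show "integrable N (\<lambda>x. \<Sum>i<n. \<Sum>j<n. c i * c j * g i j x)"
      by (rule Bochner_Integration.integrable_sum) (rule 1)
    have "(\<integral>x. (\<Sum>i<n. \<Sum>j<n. c i * c j * g i j x) \<partial>N) = (\<Sum>i<n. \<integral>x. (\<Sum>j<n. c i * c j * g i j x) \<partial>N)"
      by (rule Bochner_Integration.integral_sum) (rule 1)
    also have "\<dots> = (\<Sum>i<n. \<Sum>j<n. \<integral>x. c i * c j * g i j x \<partial>N)"
      by (rule sum.cong[OF refl], rule Bochner_Integration.integral_sum) (use g in simp)
    finally show "(\<integral>x. (\<Sum>i<n. \<Sum>j<n. c i * c j * g i j x) \<partial>N) = (\<Sum>i<n. \<Sum>j<n. c i * c j * (\<integral>x. g i j x \<partial>N))"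
      by simp
  qed
  have ov: "integrable lborel (\<lambda>u. ?I i u * ?I j u)"
    "expectation (\<lambda>\<omega>. ?D i \<omega> * ?D j \<omega>) = (\<integral>u. ?I i u * ?I j u \<partial>lborel) * var_1"
    if "i < n" "j < n" for i j
    unfolding overlap_length(2)[OF st[OF that(1)] st[OF that(2)]]
    by (rule overlap_length(1)[OF st[OF that(1)] st[OF that(2)]], rule increment_covariance)
  have il: "integrable M (\<lambda>\<omega>. (\<Sum>i<n. c i * ?D i \<omega>)\<^sup>2)"
    unfolding l by (rule double_sum(1)) (rule increment_mult_integrable)
  have ir: "integrable lborel (\<lambda>u. (\<Sum>i<n. ?I i u * c i)\<^sup>2)"
    unfolding r by (rule double_sum(1)) (rule ov(1))
  have "expectation (\<lambda>\<omega>. (\<Sum>i<n. c i * ?D i \<omega>)\<^sup>2)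
      = (\<Sum>i<n. \<Sum>j<n. c i * c j * expectation (\<lambda>\<omega>. ?D i \<omega> * ?D j \<omega>))"
    unfolding l by (rule double_sum(2)) (rule increment_mult_integrable)
  also have "\<dots> = (\<Sum>i<n. \<Sum>j<n. var_1 * (c i * c j * (\<integral>u. ?I i u * ?I j u \<partial>lborel)))"
    by (intro sum.cong refl) (simp add: ov(2))
  also have "\<dots> = var_1 * (\<Sum>i<n. \<Sum>j<n. c i * c j * (\<integral>u. ?I i u * ?I j u \<partial>lborel))"
    by (simp only: sum_distrib_left)
  also have "(\<Sum>i<n. \<Sum>j<n. c i * c j * (\<integral>u. ?I i u * ?I j u \<partial>lborel))
      = (\<integral>u. (\<Sum>i<n. ?I i u * c i)\<^sup>2 \<partial>lborel)"
    unfolding r by (rule double_sum(2)[symmetric]) (rule ov(1))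
  finally have "expectation (\<lambda>\<omega>. (\<Sum>i<n. c i * ?D i \<omega>)\<^sup>2) = var_1 * (\<integral>u. (\<Sum>i<n. ?I i u * c i)\<^sup>2 \<partial>lborel)" .
  moreover have "(\<integral>\<^sup>+\<omega>. ennreal ((\<Sum>i<n. c i * ?D i \<omega>)\<^sup>2) \<partial>M)
      = ennreal (expectation (\<lambda>\<omega>. (\<Sum>i<n. c i * ?D i \<omega>)\<^sup>2))"
    by (rule nn_integral_eq_integral[OF il]) simp
  moreover have "(\<integral>\<^sup>+u. ennreal ((\<Sum>i<n. ?I i u * c i)\<^sup>2) \<partial>lborel)
      = ennreal (\<integral>u. (\<Sum>i<n. ?I i u * c i)\<^sup>2 \<partial>lborel)"
    by (rule nn_integral_eq_integral[OF ir]) simp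
  moreover have "0 \<le> (\<integral>u. (\<Sum>i<n. ?I i u * c i)\<^sup>2 \<partial>lborel)"
    by (rule integral_nonneg_AE) simp
  ultimately show ?thesis by (simp only: ennreal_mult[OF var_1_nonneg])
qed

lemma sum_list_nth: "(\<Sum>x\<leftarrow>xs. f x) = (\<Sum>i<length xs. f (xs ! i))"
  for f :: "'b \<Rightarrow> real"
  by (simp add: sum_list_sum_nth lessThan_atLeast0)

text \<open>The third component has an arbitrary type and \<open>c\<close> extracts a number from
  it: in the application \<open>F\<close> is a matrix and \<open>c F\<close> one of its
  entries.\<close>

lemma isometry_sum_list:
  fixes ss :: "(real \<times> real \<times> 'b) list"
  assumes "\<And>s t F. (s, t, F) \<in> set ss \<Longrightarrow> s \<le> t"
  shows "(\<integral>\<^sup>+\<omega>. ennreal ((\<Sum>(s, t, F)\<leftarrow>ss. c F * (W t \<omega> - W s \<omega>))\<^sup>2) \<partial>M)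
    = ennreal var_1 * (\<integral>\<^sup>+u. ennreal ((\<Sum>(s, t, F)\<leftarrow>ss. indicator {s<..t} u * c F)\<^sup>2) \<partial>lborel)"
proof -
  have "fst (ss ! i) \<le> fst (snd (ss ! i))" if "i < length ss" for i
    using assms nth_mem[OF that] by (cases "ss ! i") auto
  from isometry_sum[OF this, where c = "\<lambda>i. c (snd (snd (ss ! i)))"]
  show ?thesis by (simp add: sum_list_nth case_prod_unfold)
qed

end

section \<open>Convolutions of decaying kernels with paths\<close>

lemma integrable_exp_neg_abs:
  fixes a :: real
  assumes a: "a > 0"
  shows "integrable lborel (\<lambda>u. exp (- a * \<bar>u\<bar>))"
proof -
  let ?g = "\<lambda>u. indicator {0..} u * exp (- a * u)"
  have "(\<integral>\<^sup>+u. ennreal (exp (- a * u)) * indicator {0..} u \<partial>lborel) = 0 - (- exp (- a * 0) / a)"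
  proof (rule nn_integral_FTC_atLeast)
    show "((\<lambda>u. - exp (- a * u) / a) has_real_derivative exp (- a * x)) (at x)" for x
      using a by (auto intro!: derivative_eq_intros)
    show "((\<lambda>u. - exp (- a * u) / a) \<longlongrightarrow> 0) at_top"
      using a by real_asymp
  qed simp_all
  then have fin: "(\<integral>\<^sup>+u. ennreal (exp (- a * u)) * indicator {0..} u \<partial>lborel) < \<infinity>" by simp
  have "(\<integral>\<^sup>+u. ennreal (norm (?g u)) \<partial>lborel) = (\<integral>\<^sup>+u. ennreal (exp (- a * u)) * indicator {0..} u \<partial>lborel)"
    by (intro nn_integral_cong) (auto simp: indicator_def)
  then have g: "integrable lborel ?g"
    using fin by (intro integrableI_bounded) auto
  have "integrable lborel (\<lambda>u. ?g (0 + (- 1) * u))"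
    by (rule lborel_integrable_real_affine[OF g]) simp
  from Bochner_Integration.integrable_add[OF g this] show ?thesis
  proof (rule Bochner_Integration.integrable_bound)
    show "AE u in lborel. norm (exp (- a * \<bar>u\<bar>)) \<le> norm (?g u + ?g (0 + (- 1) * u))"
      by (intro AE_I2) (auto simp: indicator_def)
  qed simp
qed

text \<open>Only \<open>s \<ge> 0\<close> counts, since kernels are evaluated at lags
  \<open>t - u\<close> with \<open>u \<le> t\<close>.\<close>

definition decays :: "real \<Rightarrow> (real \<Rightarrow> real) \<Rightarrow> bool" where
  "decays a g \<longleftrightarrow> (\<exists>K. \<forall>s\<ge>0. \<bar>g s\<bar> \<le> K * exp (- a * s))"

definition conv :: "(real \<Rightarrow> real) \<Rightarrow> (real \<Rightarrow> real) \<Rightarrow> real \<Rightarrow> real" where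
  "conv g v t = (LINT u|lborel. indicator {..t} u * (g (t - u) * v u))"

lemma decaysE:
  assumes "decays a g"
  obtains K where "K \<ge> 0" "\<And>s. s \<ge> 0 \<Longrightarrow> \<bar>g s\<bar> \<le> K * exp (- a * s)"
proof -
  obtain K where K: "\<And>s. s \<ge> 0 \<Longrightarrow> \<bar>g s\<bar> \<le> K * exp (- a * s)"
    using assms by (auto simp: decays_def)
  have "K \<ge> 0" using order_trans[OF abs_ge_zero K[of 0]] by simp
  then show ?thesis using K that by blast
qed

lemma decays_sum:
  assumes "\<And>l. l \<in> I \<Longrightarrow> decays a (g l)"
  shows "decays a (\<lambda>s. \<Sum>l\<in>I. c l * g l s)"
proof -
  have "\<forall>l. \<exists>K. l \<in> I \<longrightarrow> (\<forall>s\<ge>0. \<bar>g l s\<bar> \<le> K * exp (- a * s))"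
    using assms by (auto simp: decays_def)
  then obtain K where K: "\<And>l s. l \<in> I \<Longrightarrow> s \<ge> 0 \<Longrightarrow> \<bar>g l s\<bar> \<le> K l * exp (- a * s)" by metis
  have "\<bar>\<Sum>l\<in>I. c l * g l s\<bar> \<le> (\<Sum>l\<in>I. \<bar>c l\<bar> * K l) * exp (- a * s)" if s: "s \<ge> 0" for s
  proof -
    have "\<bar>\<Sum>l\<in>I. c l * g l s\<bar> \<le> (\<Sum>l\<in>I. \<bar>c l\<bar> * \<bar>g l s\<bar>)"
      by (rule order_trans[OF sum_abs]) (simp add: abs_mult)
    also have "\<dots> \<le> (\<Sum>l\<in>I. \<bar>c l\<bar> * (K l * exp (- a * s)))"
      by (rule sum_mono, rule mult_left_mono) (use K s in auto)
    finally show ?thesis by (simp add: sum_distrib_right mult.assoc)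
  qed
  then show ?thesis unfolding decays_def by blast
qed

text \<open>One fixed path \<open>v\<close>. The weight has the rate \<open>a\<close> at which the
  kernels decay, which is what makes kernel times path integrable over every half line
  \<open>{..t}\<close>.\<close>

locale weighted_path =
  fixes a :: real and v :: "real \<Rightarrow> real"
  assumes weighted_integrable: "integrable lborel (\<lambda>u. exp (- a * \<bar>u\<bar>) * v u)"
    and a_pos: "a > 0"
begin

lemma path_measurable [measurable]: "v \<in> borel_measurable borel"
proof -
  have [measurable]: "(\<lambda>u. exp (- a * \<bar>u\<bar>) * v u) \<in> borel_measurable borel"
    using weighted_integrable by (simp add: integrable_iff_bounded)
  have "(\<lambda>u. exp (a * \<bar>u\<bar>) * (exp (- a * \<bar>u\<bar>) * v u)) \<in> borel_measurable borel" by measurable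
  also have "(\<lambda>u. exp (a * \<bar>u\<bar>) * (exp (- a * \<bar>u\<bar>) * v u)) = v"
    by (simp add: fun_eq_iff flip: mult.assoc exp_add)
  finally show ?thesis .
qed

text \<open>From \<open>t - u \<ge> \<bar>u\<bar> - c\<close> decay in the lag becomes decay in
  \<open>\<bar>u\<bar>\<close>, at the cost of \<open>exp (a * c)\<close>. A bound \<open>c\<close>
  in place of \<open>\<bar>t\<bar>\<close> gives a single majorant for all \<open>t\<close> in a
  bounded interval, as needed for Fubini.\<close>

lemma kernel_bound:
  assumes K: "K \<ge> 0" "\<And>s. s \<ge> 0 \<Longrightarrow> \<bar>g s\<bar> \<le> K * exp (- a * s)" and t: "\<bar>t\<bar> \<le> c"
  shows "norm (indicator {..t} u * (g (t - u) * v u)) \<le> K * exp (a * c) * norm (exp (- a * \<bar>u\<bar>) * v u)"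
proof (cases "u \<le> t")
  case True
  have "\<bar>u\<bar> - c \<le> t - u" using True t by linarith
  then have "a * (\<bar>u\<bar> - c) \<le> a * (t - u)" using a_pos by (intro mult_left_mono) auto
  then have "- a * (t - u) \<le> a * c + - a * \<bar>u\<bar>" by (simp add: algebra_simps)
  then have "exp (- a * (t - u)) \<le> exp (a * c) * exp (- a * \<bar>u\<bar>)"
    by (simp flip: exp_add)
  then have "\<bar>g (t - u)\<bar> \<le> K * (exp (a * c) * exp (- a * \<bar>u\<bar>))"
    using K(2)[of "t - u"] mult_left_mono[OF _ K(1)] True by (meson diff_ge_0_iff_ge order_trans)
  then have "\<bar>g (t - u)\<bar> * \<bar>v u\<bar> \<le> K * (exp (a * c) * exp (- a * \<bar>u\<bar>)) * \<bar>v u\<bar>"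
    by (rule mult_right_mono) simp
  then show ?thesis using True by (simp add: abs_mult mult.assoc)
qed (use K in simp)

lemma conv_integrable:
  assumes [measurable]: "g \<in> borel_measurable borel" and g: "decays a g"
  shows "integrable lborel (\<lambda>u. indicator {..t} u * (g (t - u) * v u))"
proof -
  obtain K where K: "K \<ge> 0" "\<And>s. s \<ge> 0 \<Longrightarrow> \<bar>g s\<bar> \<le> K * exp (- a * s)"
    using decaysE[OF g] by blast
  show ?thesis
  proof (rule Bochner_Integration.integrable_bound)
    show "integrable lborel (\<lambda>u. K * exp (a * \<bar>t\<bar>) * norm (exp (- a * \<bar>u\<bar>) * v u))"
      by (intro integrable_mult_right integrable_norm weighted_integrable)
    show "AE u in lborel. norm (indicator {..t} u * (g (t - u) * v u))
        \<le> norm (K * exp (a * \<bar>t\<bar>) * norm (exp (- a * \<bar>u\<bar>) * v u))"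
    proof (rule AE_I2)
      fix u
      have "norm (indicator {..t} u * (g (t - u) * v u)) \<le> K * exp (a * \<bar>t\<bar>) * norm (exp (- a * \<bar>u\<bar>) * v u)"
        by (rule kernel_bound[OF K order.refl])
      from order_trans[OF this abs_ge_self]
      show "norm (indicator {..t} u * (g (t - u) * v u))
          \<le> norm (K * exp (a * \<bar>t\<bar>) * norm (exp (- a * \<bar>u\<bar>) * v u))"
        by (simp only: real_norm_def)
    qed
  qed measurable
qed

lemma conv_sum:
  assumes "\<And>l. l \<in> I \<Longrightarrow> g l \<in> borel_measurable borel" "\<And>l. l \<in> I \<Longrightarrow> decays a (g l)"
  shows "conv (\<lambda>s. \<Sum>l\<in>I. c l * g l s) v t = (\<Sum>l\<in>I. c l * conv (g l) v t)"
proof -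
  have "conv (\<lambda>s. \<Sum>l\<in>I. c l * g l s) v t
      = (LINT u|lborel. (\<Sum>l\<in>I. c l * (indicator {..t} u * (g l (t - u) * v u))))"
    unfolding conv_def
    by (intro Bochner_Integration.integral_cong refl) (simp add: sum_distrib_left sum_distrib_right ac_simps)
  also have "\<dots> = (\<Sum>l\<in>I. LINT u|lborel. c l * (indicator {..t} u * (g l (t - u) * v u)))"
    using assms by (intro Bochner_Integration.integral_sum integrable_mult_right conv_integrable)
  finally show ?thesis by (simp add: conv_def)
qed

lemma path_integrable_interval: "set_integrable lborel {s..t} v"
  unfolding set_integrable_def
proof (rule Bochner_Integration.integrable_bound)
  let ?c = "max \<bar>s\<bar> \<bar>t\<bar>"
  show "integrable lborel (\<lambda>u. exp (a * ?c) * norm (exp (- a * \<bar>u\<bar>) * v u))"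
    by (intro integrable_mult_right integrable_norm weighted_integrable)
  have "norm (indicator {s..t} u *\<^sub>R v u) \<le> exp (a * ?c) * norm (exp (- a * \<bar>u\<bar>) * v u)" for u
  proof (cases "u \<in> {s..t}")
    case True
    then have "0 \<le> a * (?c - \<bar>u\<bar>)" using a_pos by (intro mult_nonneg_nonneg) auto
    then have "1 \<le> exp (a * ?c) * exp (- a * \<bar>u\<bar>)" by (simp add: algebra_simps flip: exp_add)
    from mult_right_mono[OF this, of "\<bar>v u\<bar>"] True show ?thesis by (simp add: abs_mult mult.assoc)
  qed simp
  then show "AE u in lborel. norm (indicator {s..t} u *\<^sub>R v u)
      \<le> norm (exp (a * ?c) * norm (exp (- a * \<bar>u\<bar>) * v u))"
    by (intro AE_I2) simp
qed simp

text \<open>Variation of constants: Fubini on the triangle \<open>u \<le> r\<close>, \<open>s \<le> r \<le> t\<close>.\<close>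

lemma conv_increment:
  assumes der: "\<And>x. (g has_real_derivative g' x) (at x)" and cont: "continuous_on UNIV g'"
    and g: "decays a g" and g': "decays a g'" and st: "s \<le> t"
  shows "set_integrable lborel {s..t} (\<lambda>r. conv g' v r)"
    and "conv g v t - conv g v s = (LINT r:{s..t}|lborel. g 0 * v r + conv g' v r)"
proof -
  obtain K where K: "K \<ge> 0" "\<And>s. s \<ge> 0 \<Longrightarrow> \<bar>g' s\<bar> \<le> K * exp (- a * s)"
    using decaysE[OF g'] by blast
  have contg: "continuous_on UNIV g"
    using der by (meson DERIV_isCont continuous_at_imp_continuous_on)
  have [measurable]: "g \<in> borel_measurable borel" "g' \<in> borel_measurable borel"
    using cont contg by (auto intro: borel_measurable_continuous_onI)
  let ?f = "\<lambda>r u. indicator {s..t} r * (indicator {..r} u * (g' (r - u) * v u))"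
  let ?c = "max \<bar>s\<bar> \<bar>t\<bar>"
  \<comment> \<open>Joint measurability: \<open>u \<le> r\<close> is a measurable condition on the
    difference \<open>r - u\<close>.\<close>
  have ind: "(\<lambda>p :: real \<times> real. indicator {..fst p} (snd p) :: real) = (\<lambda>p. indicator {0..} (fst p - snd p))"
    by (auto simp: indicator_def fun_eq_iff)
  have [measurable]: "(\<lambda>p :: real \<times> real. indicator {..fst p} (snd p) :: real) \<in> borel_measurable (borel \<Otimes>\<^sub>M borel)"
    unfolding ind by (rule measurable_compose[of "\<lambda>p. fst p - snd p" _ borel "indicator {0..}"]) measurable
  have meas: "(\<lambda>(r, u). ?f r u) \<in> borel_measurable (lborel \<Otimes>\<^sub>M lborel)"
    unfolding case_prod_unfold by measurable
  have int_u: "integrable lborel (\<lambda>u. ?f r u)" for r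
    by (intro integrable_mult_right conv_integrable g') simp
  have "integrable lborel (\<lambda>r. LINT u|lborel. norm ((\<lambda>(r, u). ?f r u) (r, u)))"
  proof (rule Bochner_Integration.integrable_bound)
    let ?J = "LINT u|lborel. K * exp (a * ?c) * norm (exp (- a * \<bar>u\<bar>) * v u)"
    show "integrable lborel (\<lambda>r. indicator {s..t} r * ?J)"
      by (intro integrable_mult_left integrable_real_indicator) (use st in auto)
    have "(LINT u|lborel. norm (?f r u)) \<le> indicator {s..t} r * ?J" for r
    proof (cases "r \<in> {s..t}")
      case True
      then have "norm (?f r u) \<le> K * exp (a * ?c) * norm (exp (- a * \<bar>u\<bar>) * v u)" for u
        using kernel_bound[OF K, of r ?c u] by auto
      then have "(LINT u|lborel. norm (?f r u)) \<le> ?J"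
        by (intro integral_mono integrable_norm int_u integrable_mult_right weighted_integrable)
      then show ?thesis using True by simp
    qed simp
    then show "AE r in lborel. norm (LINT u|lborel. norm ((\<lambda>(r, u). ?f r u) (r, u)))
        \<le> norm (indicator {s..t} r * ?J)"
      by (intro AE_I2) (simp add: order_trans[OF _ abs_ge_self])
    show "(\<lambda>r. LINT u|lborel. norm ((\<lambda>(r, u). ?f r u) (r, u))) \<in> borel_measurable lborel"
      using meas by measurable
  qed
  then have int: "integrable (lborel \<Otimes>\<^sub>M lborel) (\<lambda>(r, u). ?f r u)"
    by (rule lborel_pair.Fubini_integrable[OF meas]) (rule AE_I2, simp only: prod.case, rule int_u)
  from lborel_pair.integrable_fst'[OF int]
  show int_r: "set_integrable lborel {s..t} (\<lambda>r. conv g' v r)"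
    by (simp add: set_integrable_def conv_def)
  \<comment> \<open>The point \<open>u = s\<close> lies in both \<open>{..s}\<close> and
    \<open>{s..t}\<close>, so \<open>g 0 * v u\<close> would be subtracted twice there; it is a null
    set.\<close>
  have inner: "(LINT r|lborel. ?f r u) = indicator {..t} u * (g (t - u) * v u)
      - indicator {..s} u * (g (s - u) * v u) - indicator {s..t} u *\<^sub>R (g 0 * v u)"
    if u: "u \<noteq> s" for u
  proof (cases "u \<le> t")
    case False
    then have z: "?f r u = 0" for r by (auto simp: indicator_def)
    show ?thesis using False st unfolding z by (simp add: indicator_def)
  next
    case True
    \<comment> \<open>The integral of \<open>g'\<close> over \<open>r\<close> starts at
      \<open>max s u\<close>. It yields \<open>g (t - u) - g (s - u)\<close> for
      \<open>u < s\<close> and \<open>g (t - u) - g 0\<close> for \<open>u > s\<close>, which are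
      the two regimes of the right-hand side.\<close>
    let ?m = "max s u"
    have "(LINT r|lborel. ?f r u) = (LINT r|lborel. (indicator {?m..t} r *\<^sub>R g' (r - u)) * v u)"
      by (intro Bochner_Integration.integral_cong) (auto simp: indicator_def)
    also have "\<dots> = (LINT r|lborel. indicator {?m..t} r *\<^sub>R g' (r - u)) * v u"
      by simp
    also have "(LINT r|lborel. indicator {?m..t} r *\<^sub>R g' (r - u)) = g (t - u) - g (?m - u)"
    proof (rule integral_FTC_atLeastAtMost)
      show "?m \<le> t" using True st by simp
      show "continuous_on {?m..t} (\<lambda>r. g' (r - u))"
        by (intro continuous_on_compose2[OF cont] continuous_intros) auto
      fix x
      have "((\<lambda>r. r - u) has_real_derivative 1) (at x)" by (auto intro!: derivative_eq_intros)
      from DERIV_chain2[OF der this]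
      show "((\<lambda>r. g (r - u)) has_vector_derivative g' (x - u)) (at x within {?m..t})"
        by (simp add: has_real_derivative_iff_has_vector_derivative has_vector_derivative_at_within)
    qed
    finally show ?thesis using True u by (auto simp: indicator_def max_def algebra_simps)
  qed
  have i0: "set_integrable lborel {s..t} (\<lambda>u. g 0 * v u)"
    by (intro set_integrable_mult_right path_integrable_interval)
  have "(LINT r:{s..t}|lborel. conv g' v r) = (LINT r|lborel. LINT u|lborel. ?f r u)"
    by (simp add: set_lebesgue_integral_def conv_def)
  also have "\<dots> = (LINT u|lborel. LINT r|lborel. ?f r u)"
    by (rule lborel_pair.Fubini_integral[OF int, symmetric])
  also have "\<dots> = (LINT u|lborel. indicator {..t} u * (g (t - u) * v u)
      - indicator {..s} u * (g (s - u) * v u) - indicator {s..t} u *\<^sub>R (g 0 * v u))"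
  proof (rule integral_cong_AE)
    show "(\<lambda>u. LINT r|lborel. ?f r u) \<in> borel_measurable lborel"
      using lborel_pair.integrable_snd[OF int] by (rule borel_measurable_integrable)
    show "(\<lambda>u. indicator {..t} u * (g (t - u) * v u)
      - indicator {..s} u * (g (s - u) * v u) - indicator {s..t} u *\<^sub>R (g 0 * v u)) \<in> borel_measurable lborel"
      by measurable
    show "AE u in lborel. (LINT r|lborel. ?f r u) = indicator {..t} u * (g (t - u) * v u)
      - indicator {..s} u * (g (s - u) * v u) - indicator {s..t} u *\<^sub>R (g 0 * v u)"
      using AE_lborel_singleton[of s] by eventually_elim (rule inner)
  qed
  also have "\<dots> = conv g v t - conv g v s - (LINT u:{s..t}|lborel. g 0 * v u)"
  proof -
    have ci: "integrable lborel (\<lambda>u. indicator {..r} u * (g (r - u) * v u))" for r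
      by (rule conv_integrable[OF _ g]) simp
    have i0': "integrable lborel (\<lambda>u. indicator {s..t} u *\<^sub>R (g 0 * v u))"
      using i0 unfolding set_integrable_def .
    show ?thesis
      unfolding conv_def set_lebesgue_integral_def
      by (simp only: Bochner_Integration.integral_diff Bochner_Integration.integrable_diff ci i0')
  qed
  finally have "(LINT r:{s..t}|lborel. conv g' v r) = conv g v t - conv g v s - (LINT u:{s..t}|lborel. g 0 * v u)" .
  then show "conv g v t - conv g v s = (LINT r:{s..t}|lborel. g 0 * v r + conv g' v r)"
    by (simp add: set_integral_add(2)[OF i0 int_r])
qed

end

text \<open>Half of the decay absorbs the linear factor, by
  \<open>\<bar>u\<bar> \<le> 2 / a * exp (a / 2 * \<bar>u\<bar>)\<close>. It is applied to second
  moments of the paths, which grow linearly in time.\<close>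

lemma exp_mult_linear_le:
  fixes a c d u :: real
  assumes "a > 0" "c \<ge> 0" "d \<ge> 0"
  shows "exp (- a * \<bar>u\<bar>) * (c + \<bar>u\<bar> * d) \<le> (c + 2 * d / a) * exp (- (a / 2) * \<bar>u\<bar>)"
proof -
  let ?e = "exp (a / 2 * \<bar>u\<bar>)"
  have "1 + a / 2 * \<bar>u\<bar> \<le> ?e" by (rule exp_ge_add_one_self)
  then have "\<bar>u\<bar> \<le> 2 / a * ?e" "1 \<le> ?e" using assms(1) by (auto simp: field_simps)
  from mult_right_mono[OF this(1) assms(3)] mult_left_mono[OF this(2) assms(2)]
  have "c + \<bar>u\<bar> * d \<le> c * ?e + 2 / a * ?e * d" by linarith
  also have "\<dots> = (c + 2 * d / a) * ?e" by (simp add: algebra_simps)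
  finally have "exp (- a * \<bar>u\<bar>) * (c + \<bar>u\<bar> * d) \<le> exp (- a * \<bar>u\<bar>) * ((c + 2 * d / a) * ?e)"
    by (rule mult_left_mono) simp
  also have "\<dots> = (c + 2 * d / a) * (exp (- a * \<bar>u\<bar>) * ?e)" by simp
  also have "exp (- a * \<bar>u\<bar>) * ?e = exp (- (a / 2) * \<bar>u\<bar>)"
    by (simp add: field_simps flip: exp_add)
  finally show ?thesis .
qed

section \<open>Path versions that are jointly measurable and integrable against the weight\<close>

context centred_levy
begin

text \<open>Right-continuity makes the paths jointly measurable; the weight makes them integrable.\<close>

lemma jointly_measurable_version:
  obtains V where "(\<lambda>(t, \<omega>). V t \<omega>) \<in> borel_measurable (borel \<Otimes>\<^sub>M M)" "AE \<omega> in M. \<forall>t. V t \<omega> = W t \<omega>"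
proof -
  obtain N where N: "N \<in> null_sets M" "{\<omega> \<in> space M. \<not> (\<forall>t. ((\<lambda>s. W s \<omega>) \<longlongrightarrow> W t \<omega>) (at_right t))} \<subseteq> N"
    using right_continuous by (elim AE_E) (auto simp: null_sets_def)
  \<comment> \<open>Paths in the exceptional null set are replaced by zero, so that right-continuity
    holds for every \<open>\<omega>\<close>.\<close>
  define V where "V = (\<lambda>t \<omega>. indicator (space M - N) \<omega> * W t \<omega>)"
  have [measurable]: "V t \<in> borel_measurable M" for t
    using N(1) unfolding V_def
    by (intro borel_measurable_times borel_measurable_indicator W_measurable) auto
  have rc: "((\<lambda>s. V s \<omega>) \<longlongrightarrow> V t \<omega>) (at_right t)" for t \<omega>
    using N(2) by (auto simp: V_def indicator_def)
  \<comment> \<open>The next grid point strictly to the right of \<open>t\<close>. As a function of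
    \<open>t\<close> it takes countably many values, so sampling there is jointly measurable, and
    right-continuity gives the limit.\<close>
  let ?q = "\<lambda>n t. (of_int \<lfloor>real (Suc n) * t\<rfloor> + 1) / real (Suc n)"
  have "(\<lambda>p. V (fst p) (snd p)) \<in> borel_measurable (borel \<Otimes>\<^sub>M M)"
  proof (rule borel_measurable_LIMSEQ_real)
    fix n
    have "(\<lambda>p. (\<lambda>k p. V ((of_int k + 1) / real (Suc n)) (snd p)) \<lfloor>real (Suc n) * fst p\<rfloor> p)
        \<in> borel_measurable (borel \<Otimes>\<^sub>M M)"
      by (rule measurable_compose_countable) measurable
    then show "(\<lambda>p. V (?q n (fst p)) (snd p)) \<in> borel_measurable (borel \<Otimes>\<^sub>M M)" .
  next
    fix p :: "real \<times> 'w"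
    have q: "t < ?q n t" "?q n t \<le> t + 1 / real (Suc n)" for n t
    proof -
      have "real (Suc n) * t < of_int \<lfloor>real (Suc n) * t\<rfloor> + 1"
        "of_int \<lfloor>real (Suc n) * t\<rfloor> + 1 \<le> real (Suc n) * t + 1" by linarith+
      then show "t < ?q n t" "?q n t \<le> t + 1 / real (Suc n)"
        by (simp_all add: field_simps del: of_nat_Suc)
    qed
    define Q where "Q = (\<lambda>n. ?q n (fst p))"
    have Q: "fst p < Q n" "Q n \<le> fst p + 1 / real (Suc n)" for n
      unfolding Q_def by (rule q)+
    have "Q \<longlonglongrightarrow> fst p"
    proof (rule tendsto_sandwich[of "\<lambda>_. fst p" _ _ "\<lambda>n. fst p + 1 / real (Suc n)"])
      show "(\<lambda>n. fst p + 1 / real (Suc n)) \<longlonglongrightarrow> fst p"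
        using tendsto_add[OF tendsto_const LIMSEQ_inverse_real_of_nat, of "fst p"] by (simp add: inverse_eq_divide)
    qed (use Q in \<open>auto intro!: always_eventually less_imp_le\<close>)
    moreover have "Q n \<noteq> fst p" for n using Q(1)[of n] by simp
    ultimately have "filterlim Q (at_right (fst p)) sequentially"
      using Q(1) by (auto simp: filterlim_at intro!: always_eventually)
    from filterlim_compose[OF rc this, unfolded Q_def]
    show "(\<lambda>n. V (?q n (fst p)) (snd p)) \<longlonglongrightarrow> V (fst p) (snd p)" .
  qed
  moreover have "AE \<omega> in M. \<forall>t. V t \<omega> = W t \<omega>"
    using AE_not_in[OF N(1)] AE_space by eventually_elim (simp add: V_def)
  ultimately show ?thesis using that by (simp add: case_prod_unfold)
qed

lemma W_second_moment: "(\<integral>\<^sup>+\<omega>. ennreal ((W t \<omega> - W s \<omega>)\<^sup>2) \<partial>M) = ennreal (\<bar>t - s\<bar> * var_1)"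
  by (subst nn_integral_eq_integral[OF increment_square_integrable]) (simp_all add: variogram)

text \<open>From \<open>\<bar>x\<bar> \<le> 1 + x\<^sup>2\<close> the expected absolute value at
  time \<open>u\<close> is at most \<open>1 + \<bar>u\<bar> * var_1\<close>. The weighted path
  therefore has a finite expected integral, and almost every path is integrable.\<close>

lemma weighted_version:
  assumes a: "a > 0"
  obtains V where "(\<lambda>(t, \<omega>). V t \<omega>) \<in> borel_measurable (borel \<Otimes>\<^sub>M M)" "AE \<omega> in M. \<forall>t. V t \<omega> = W t \<omega>"
    "\<And>\<omega>. \<omega> \<in> space M \<Longrightarrow> integrable lborel (\<lambda>u. exp (- a * \<bar>u\<bar>) * V u \<omega>)"
proof -
  obtain V where V: "(\<lambda>(t, \<omega>). V t \<omega>) \<in> borel_measurable (borel \<Otimes>\<^sub>M M)" "AE \<omega> in M. \<forall>t. V t \<omega> = W t \<omega>"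
    by (rule jointly_measurable_version)
  interpret pair_sigma_finite lborel M ..
  have m[measurable]: "(\<lambda>p. V (fst p) (snd p)) \<in> borel_measurable (borel \<Otimes>\<^sub>M M)"
    using V(1) by (simp add: case_prod_unfold)
  have V2 [measurable]: "V t \<in> borel_measurable M" for t
    using measurable_compose[OF measurable_Pair1' m, of t] by simp
  have V1: "(\<lambda>t. V t \<omega>) \<in> borel_measurable borel" if "\<omega> \<in> space M" for \<omega>
    using measurable_compose[OF measurable_Pair2'[OF that] m] by simp
  have [measurable]: "(\<lambda>p. V (snd p) (fst p)) \<in> borel_measurable (M \<Otimes>\<^sub>M borel)"
    using measurable_compose[OF measurable_pair_swap'[of M borel] m] by (simp add: case_prod_unfold)
  let ?I = "\<lambda>\<omega>. \<integral>\<^sup>+u. ennreal (norm (exp (- a * \<bar>u\<bar>) * V u \<omega>)) \<partial>lborel"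
  have I[measurable]: "?I \<in> borel_measurable M"
    by (rule sigma_finite_measure.borel_measurable_nn_integral[OF lborel.sigma_finite_measure_axioms])
       measurable
  have "(\<integral>\<^sup>+\<omega>. ?I \<omega> \<partial>M) = (\<integral>\<^sup>+u. (\<integral>\<^sup>+\<omega>. ennreal (norm (exp (- a * \<bar>u\<bar>) * V u \<omega>)) \<partial>M) \<partial>lborel)"
    by (rule Fubini') measurable
  also have "\<dots> \<le> (\<integral>\<^sup>+u. ennreal ((1 + 2 * var_1 / a) * exp (- (a / 2) * \<bar>u\<bar>)) \<partial>lborel)"
  proof (rule nn_integral_mono)
    fix u :: real
    have "(\<integral>\<^sup>+\<omega>. ennreal (norm (exp (- a * \<bar>u\<bar>) * V u \<omega>)) \<partial>M)
        \<le> (\<integral>\<^sup>+\<omega>. ennreal (exp (- a * \<bar>u\<bar>)) * (1 + ennreal ((W u \<omega> - W 0 \<omega>)\<^sup>2)) \<partial>M)"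
    proof (rule nn_integral_mono_AE)
      show "AE \<omega> in M. ennreal (norm (exp (- a * \<bar>u\<bar>) * V u \<omega>))
          \<le> ennreal (exp (- a * \<bar>u\<bar>)) * (1 + ennreal ((W u \<omega> - W 0 \<omega>)\<^sup>2))"
        using V(2) W_0
      proof eventually_elim
        case (elim \<omega>)
        have "\<bar>x\<bar> \<le> 1 + x\<^sup>2" for x :: real
          using sum_squares_bound[of "\<bar>x\<bar>" 1] by simp
        then have "norm (exp (- a * \<bar>u\<bar>) * V u \<omega>) \<le> exp (- a * \<bar>u\<bar>) * (1 + (W u \<omega> - W 0 \<omega>)\<^sup>2)"
          using elim by (auto simp: abs_mult intro!: mult_left_mono)
        then have "ennreal (norm (exp (- a * \<bar>u\<bar>) * V u \<omega>)) \<le> ennreal (exp (- a * \<bar>u\<bar>) * (1 + (W u \<omega> - W 0 \<omega>)\<^sup>2))"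
          by (rule ennreal_leI)
        then show ?case by (simp add: ennreal_mult ennreal_plus)
      qed
    qed
    also have "\<dots> = ennreal (exp (- a * \<bar>u\<bar>)) * (1 + ennreal (\<bar>u\<bar> * var_1))"
      using W_second_moment[of u 0] by (simp add: nn_integral_cmult nn_integral_add emeasure_space_1)
    also have "\<dots> = ennreal (exp (- a * \<bar>u\<bar>) * (1 + \<bar>u\<bar> * var_1))"
      using var_1_nonneg by (simp add: ennreal_mult ennreal_plus)
    also have "\<dots> \<le> ennreal ((1 + 2 * var_1 / a) * exp (- (a / 2) * \<bar>u\<bar>))"
      by (rule ennreal_leI, rule exp_mult_linear_le[OF a _ var_1_nonneg]) simp
    finally show "(\<integral>\<^sup>+\<omega>. ennreal (norm (exp (- a * \<bar>u\<bar>) * V u \<omega>)) \<partial>M)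
        \<le> ennreal ((1 + 2 * var_1 / a) * exp (- (a / 2) * \<bar>u\<bar>))" .
  qed
  also have "\<dots> < \<infinity>"
  proof -
    have "integrable lborel (\<lambda>u. (1 + 2 * var_1 / a) * exp (- (a / 2) * \<bar>u\<bar>))"
      using a by (intro integrable_mult_right integrable_exp_neg_abs) simp
    then have "(\<integral>\<^sup>+u. ennreal (norm ((1 + 2 * var_1 / a) * exp (- (a / 2) * \<bar>u\<bar>))) \<partial>lborel) < \<infinity>"
      unfolding integrable_iff_bounded by blast
    moreover have "norm ((1 + 2 * var_1 / a) * exp (- (a / 2) * \<bar>u\<bar>)) = (1 + 2 * var_1 / a) * exp (- (a / 2) * \<bar>u\<bar>)" for u
      using a var_1_nonneg by (simp add: abs_mult)
    ultimately show ?thesis by (simp only:)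
  qed
  finally have ae: "AE \<omega> in M. ?I \<omega> \<noteq> \<infinity>"
    by (intro nn_integral_PInf_AE I) simp
  define \<Omega>' where "\<Omega>' = {\<omega> \<in> space M. ?I \<omega> \<noteq> \<infinity>}"
  have [measurable]: "\<Omega>' \<in> sets M" unfolding \<Omega>'_def by measurable
  \<comment> \<open>Zero paths off \<open>\<Omega>'\<close> make integrability hold for every
    \<open>\<omega>\<close> in the space, so that later identities between paths carry no
    exceptional set.\<close>
  define V' where "V' = (\<lambda>t \<omega>. indicator \<Omega>' \<omega> * V t \<omega>)"
  show ?thesis
  proof (rule that[of V'])
    show "(\<lambda>(t, \<omega>). V' t \<omega>) \<in> borel_measurable (borel \<Otimes>\<^sub>M M)"
      unfolding V'_def case_prod_unfold by measurable
    show "AE \<omega> in M. \<forall>t. V' t \<omega> = W t \<omega>"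
      using V(2) ae AE_space by eventually_elim (simp add: V'_def \<Omega>'_def)
    fix \<omega> assume \<omega>: "\<omega> \<in> space M"
    show "integrable lborel (\<lambda>u. exp (- a * \<bar>u\<bar>) * V' u \<omega>)"
    proof (cases "\<omega> \<in> \<Omega>'")
      case True
      then have "integrable lborel (\<lambda>u. exp (- a * \<bar>u\<bar>) * V u \<omega>)"
        using V1[OF \<omega>] by (intro integrableI_bounded) (auto simp: \<Omega>'_def less_top)
      then show ?thesis using True by (simp add: V'_def)
    qed (simp add: V'_def)
  qed
qed

end

section \<open>Riemann sums for the stochastic integral\<close>

text \<open>The cells are half open and disjoint, so at most one term survives, the one with
  \<open>k = \<lfloor>N * s\<rfloor>\<close>.\<close>

lemma sum_grid_indicator:
  fixes N s :: real and H :: "nat \<Rightarrow> real"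
  assumes N: "N > 0"
  shows "(\<Sum>k<K. indicator {real k / N..<(real k + 1) / N} s * H k)
    = (if 0 \<le> s \<and> s < real K / N then H (nat \<lfloor>N * s\<rfloor>) else 0)"
proof -
  have mem: "s \<in> {real k / N..<(real k + 1) / N} \<longleftrightarrow> 0 \<le> s \<and> k = nat \<lfloor>N * s\<rfloor>" for k
  proof -
    have "s \<in> {real k / N..<(real k + 1) / N} \<longleftrightarrow> real k \<le> N * s \<and> N * s < real k + 1"
      using N by (auto simp: field_simps)
    also have "\<dots> \<longleftrightarrow> \<lfloor>N * s\<rfloor> = int k" by linarith
    also have "\<dots> \<longleftrightarrow> 0 \<le> s \<and> k = nat \<lfloor>N * s\<rfloor>"
    proof
      assume "\<lfloor>N * s\<rfloor> = int k"
      moreover from this have "0 \<le> N * s" by linarith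
      then have "0 \<le> s" using N by (simp add: zero_le_mult_iff)
      ultimately show "0 \<le> s \<and> k = nat \<lfloor>N * s\<rfloor>" by simp
    next
      assume *: "0 \<le> s \<and> k = nat \<lfloor>N * s\<rfloor>"
      then have "0 \<le> N * s" using N by simp
      then show "\<lfloor>N * s\<rfloor> = int k" using * by simp
    qed
    finally show ?thesis .
  qed
  have K: "nat \<lfloor>N * s\<rfloor> < K \<longleftrightarrow> s < real K / N" if "0 \<le> s"
  proof -
    have "0 \<le> N * s" using that N by simp
    then have "nat \<lfloor>N * s\<rfloor> < K \<longleftrightarrow> N * s < real K" by linarith
    also have "\<dots> \<longleftrightarrow> s < real K / N" using N by (simp add: field_simps)
    finally show ?thesis .
  qed
  have "(\<Sum>k<K. indicator {real k / N..<(real k + 1) / N} s * H k)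
      = (\<Sum>k<K. if k = nat \<lfloor>N * s\<rfloor> then (if 0 \<le> s then H k else 0) else 0)"
    by (intro sum.cong refl) (simp add: indicator_def mem del: atLeastLessThan_iff)
  also have "\<dots> = (if 0 \<le> s \<and> s < real K / N then H (nat \<lfloor>N * s\<rfloor>) else 0)"
    using K by (auto simp: sum.delta)
  finally show ?thesis .
qed

text \<open>Reflection at \<open>t\<close> exchanges open and closed ends: the left-open intervals
  of step functions become right-open cells in the lag \<open>t - u\<close>.\<close>

lemma grid_indicator_reflect:
  "indicator {t - (real k + 1) / N<..t - real k / N} u = (indicator {real k / N..<(real k + 1) / N} (t - u) :: real)"
  by (auto simp: indicator_def)

text \<open>With mesh 1/(n+1) the (n+1)^2 cells reach up to lag n+1, so refinement and truncation
  are controlled by the one index. Pointwise convergence comes from continuity of the kernel, and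
  its decay gives an integrable majorant.\<close>

lemma step_approximation:
  fixes g :: "real \<Rightarrow> real"
  assumes a: "a > 0" and cont: "continuous_on UNIV g" and g: "decays a g"
  shows "(\<lambda>n. \<integral>\<^sup>+u. ennreal (((\<Sum>k<Suc n * Suc n. indicator {t - (real k + 1) / real (Suc n)<..t - real k / real (Suc n)} u
      * g (real k / real (Suc n))) - (if u \<le> t then g (t - u) else 0))\<^sup>2) \<partial>lborel) \<longlonglongrightarrow> 0"
proof -
  obtain K where K: "K \<ge> 0" "\<And>s. s \<ge> 0 \<Longrightarrow> \<bar>g s\<bar> \<le> K * exp (- a * s)"
    using decaysE[OF g] by blast
  have [measurable]: "g \<in> borel_measurable borel"
    using cont by (rule borel_measurable_continuous_onI)
  let ?N = "\<lambda>n. real (Suc n)"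
  let ?q = "\<lambda>n s. real (nat \<lfloor>?N n * s\<rfloor>) / ?N n"
  let ?f = "\<lambda>n s. if 0 \<le> s \<and> s < ?N n then g (?q n s) else 0"
  \<comment> \<open>The sampling point lies at most 1 before \<open>s\<close>, which costs a factor
    \<open>exp a\<close>; the 2 comes from bounding the sampled and the exact kernel
    separately.\<close>
  define C where "C = 2 * K * exp a"
  have q: "s - 1 / ?N n \<le> ?q n s" "?q n s \<le> s" if "s \<ge> 0" for n s
  proof -
    have "?N n * s \<ge> 0" using that by simp
    then have b: "?N n * s - 1 \<le> real (nat \<lfloor>?N n * s\<rfloor>)" "real (nat \<lfloor>?N n * s\<rfloor>) \<le> ?N n * s" by linarith+
    have "(?N n * s - 1) / ?N n \<le> ?q n s" "?q n s \<le> (?N n * s) / ?N n"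
      by (rule divide_right_mono[OF b(1)], simp, rule divide_right_mono[OF b(2)], simp)
    moreover have "(?N n * s - 1) / ?N n = s - 1 / ?N n" "(?N n * s) / ?N n = s"
      by (simp_all add: diff_divide_distrib del: of_nat_Suc)
    ultimately show "s - 1 / ?N n \<le> ?q n s" "?q n s \<le> s" by (simp_all only:)
  qed
  have bound: "\<bar>?f n s - (if 0 \<le> s then g s else 0)\<bar> \<le> C * exp (- a * \<bar>s\<bar>)" for n s
  proof (cases "s \<ge> 0")
    case True
    have "1 / ?N n \<le> 1" by simp
    then have "s - 1 \<le> ?q n s" using q(1)[OF True, of n] by linarith
    then have "a * (s - 1) \<le> a * ?q n s" using a by (intro mult_left_mono) auto
    then have "exp (- a * ?q n s) \<le> exp (- a * (s - 1))"
      by (simp only: exp_le_cancel_iff mult_minus_left neg_le_iff_le)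
    also have "\<dots> = exp a * exp (- a * s)" by (simp add: algebra_simps flip: exp_add)
    finally have "K * exp (- a * ?q n s) \<le> K * (exp a * exp (- a * s))"
      using K(1) by (rule mult_left_mono)
    moreover have "\<bar>g (?q n s)\<bar> \<le> K * exp (- a * ?q n s)" by (rule K) simp
    moreover have "\<bar>g s\<bar> \<le> K * (exp a * exp (- a * s))"
    proof -
      have "1 * exp (- a * s) \<le> exp a * exp (- a * s)" using a by (intro mult_right_mono) auto
      from mult_left_mono[OF this K(1)] K(2)[OF True] show ?thesis by simp
    qed
    ultimately have "\<bar>?f n s\<bar> \<le> K * (exp a * exp (- a * s))" "\<bar>g s\<bar> \<le> K * (exp a * exp (- a * s))"
      using K(1) by auto
    then show ?thesis using True unfolding C_def by (simp add: mult.assoc)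
  qed (use K in \<open>simp add: C_def\<close>)
  have lim: "(\<lambda>n. ?f n s) \<longlonglongrightarrow> (if 0 \<le> s then g s else 0)" for s
  proof (cases "s \<ge> 0")
    case True
    have "(\<lambda>n. ?q n s) \<longlonglongrightarrow> s"
    proof (rule tendsto_sandwich[of "\<lambda>n. s - 1 / ?N n" _ _ "\<lambda>_. s"])
      show "(\<lambda>n. s - 1 / ?N n) \<longlonglongrightarrow> s"
        using tendsto_diff[OF tendsto_const LIMSEQ_inverse_real_of_nat, of s] by (simp add: inverse_eq_divide)
    qed (use q[OF True] in \<open>auto simp del: of_nat_Suc\<close>)
    then have "(\<lambda>n. g (?q n s)) \<longlonglongrightarrow> g s"
      using cont by (intro isCont_tendsto_compose[of s g]) (auto simp: continuous_on_eq_continuous_at)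
    moreover have "\<forall>\<^sub>F n in sequentially. s < ?N n"
    proof -
      obtain n0 where "s < real n0" using reals_Archimedean2 by blast
      then show ?thesis by (intro eventually_sequentiallyI[of n0]) auto
    qed
    then have "\<forall>\<^sub>F n in sequentially. g (?q n s) = ?f n s"
      by eventually_elim (use True in simp)
    ultimately show ?thesis using True by (simp add: tendsto_cong)
  qed simp
  have eq: "(\<Sum>k<Suc n * Suc n. indicator {t - (real k + 1) / ?N n<..t - real k / ?N n} u * g (real k / ?N n)) = ?f n (t - u)" for n u
  proof -
    have N0: "?N n > 0" by simp
    then have NN: "real (Suc n * Suc n) / ?N n = ?N n"
      by (simp only: of_nat_mult nonzero_mult_div_cancel_right[OF less_imp_neq[OF N0, symmetric]])
    show ?thesis
      unfolding grid_indicator_reflect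
      by (rule sum_grid_indicator[OF N0, where K = "Suc n * Suc n" and s = "t - u"
            and H = "\<lambda>k. g (real k / ?N n)", unfolded NN])
  qed
  have "(\<lambda>n. \<integral>\<^sup>+u. ennreal ((?f n (t - u) - (if 0 \<le> t - u then g (t - u) else 0))\<^sup>2) \<partial>lborel)
      \<longlonglongrightarrow> (\<integral>\<^sup>+u. 0 \<partial>(lborel :: real measure))"
  proof (rule nn_integral_dominated_convergence[where w = "\<lambda>u. ennreal (C\<^sup>2 * exp (- a * \<bar>t - u\<bar>))"])
    show "(\<lambda>u. ennreal ((?f n (t - u) - (if 0 \<le> t - u then g (t - u) else 0))\<^sup>2)) \<in> borel_measurable lborel" for n
      by measurable
    show "(\<lambda>u. ennreal (C\<^sup>2 * exp (- a * \<bar>t - u\<bar>))) \<in> borel_measurable lborel" by measurable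
    show "AE u in lborel. ennreal ((?f n (t - u) - (if 0 \<le> t - u then g (t - u) else 0))\<^sup>2)
        \<le> ennreal (C\<^sup>2 * exp (- a * \<bar>t - u\<bar>))" for n
    proof (intro AE_I2 ennreal_leI)
      fix u
      have "\<bar>?f n (t - u) - (if 0 \<le> t - u then g (t - u) else 0)\<bar>\<^sup>2 \<le> (C * exp (- a * \<bar>t - u\<bar>))\<^sup>2"
        by (rule power_mono[OF bound]) simp
      also have "\<dots> = C\<^sup>2 * (exp (- a * \<bar>t - u\<bar>))\<^sup>2" by (rule power_mult_distrib)
      also have "\<dots> \<le> C\<^sup>2 * (exp (- a * \<bar>t - u\<bar>) * 1)"
        unfolding power2_eq_square[of "exp _"] using a by (intro mult_left_mono) auto
      finally show "(?f n (t - u) - (if 0 \<le> t - u then g (t - u) else 0))\<^sup>2 \<le> C\<^sup>2 * exp (- a * \<bar>t - u\<bar>)"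
        by simp
    qed
    have "integrable lborel (\<lambda>u. exp (- a * \<bar>t + (- 1) * u\<bar>))"
      by (rule lborel_integrable_real_affine[OF integrable_exp_neg_abs[OF a]]) simp
    then have "integrable lborel (\<lambda>u. C\<^sup>2 * exp (- a * \<bar>t - u\<bar>))" by simp
    then show "(\<integral>\<^sup>+u. ennreal (C\<^sup>2 * exp (- a * \<bar>t - u\<bar>)) \<partial>lborel) < \<infinity>"
      by (simp add: nn_integral_eq_integral)
    show "AE u in lborel. (\<lambda>n. ennreal ((?f n (t - u) - (if 0 \<le> t - u then g (t - u) else 0))\<^sup>2)) \<longlonglongrightarrow> 0"
    proof (rule AE_I2)
      fix u
      have "(\<lambda>n. (?f n (t - u) - (if 0 \<le> t - u then g (t - u) else 0))\<^sup>2) \<longlonglongrightarrow> 0\<^sup>2"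
        by (intro tendsto_power) (use LIM_zero[OF lim[of "t - u"]] in simp)
      from tendsto_ennrealI[OF this]
      show "(\<lambda>n. ennreal ((?f n (t - u) - (if 0 \<le> t - u then g (t - u) else 0))\<^sup>2)) \<longlonglongrightarrow> 0" by simp
    qed
  qed simp
  then show ?thesis unfolding eq by simp
qed

lemma ennreal_abs_power2: "(ennreal \<bar>x\<bar>)\<^sup>2 = ennreal (x\<^sup>2)"
  by (simp add: ennreal_power)

lemma ennreal_square_add_le: "ennreal ((x - y)\<^sup>2) \<le> 2 * ennreal (x\<^sup>2) + 2 * ennreal (y\<^sup>2)"
proof -
  have "ennreal ((x - y)\<^sup>2) \<le> ennreal (2 * x\<^sup>2 + 2 * y\<^sup>2)"
    using square_add_le[of x "- y"] by (intro ennreal_leI) simp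
  also have "\<dots> = 2 * ennreal (x\<^sup>2) + 2 * ennreal (y\<^sup>2)"
    by (simp add: ennreal_plus ennreal_mult)
  finally show ?thesis .
qed

lemma ennreal_tendsto_0_le:
  fixes f h :: "nat \<Rightarrow> ennreal"
  assumes "\<And>n. f n \<le> h n" "h \<longlonglongrightarrow> 0"
  shows "f \<longlonglongrightarrow> 0"
  by (rule tendsto_sandwich[OF _ _ tendsto_const assms(2)]) (use assms(1) in auto)

text \<open>Abel summation, the discrete form of the partial integration that produces the paths of
  the state process.\<close>

lemma sum_by_parts:
  fixes x y :: "nat \<Rightarrow> real"
  shows "(\<Sum>k<K. x k * (y k - y (Suc k))) = x 0 * y 0 - x K * y K + (\<Sum>k<K. (x (Suc k) - x k) * y (Suc k))"
  by (induction K) (simp_all add: algebra_simps)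

section \<open>The pathwise error of the Riemann sums\<close>

context weighted_path
begin

text \<open>Summation by parts turns a Riemann sum for \<open>\<integral> g (t - u) dv(u)\<close> into an integral against \<open>g'\<close>.\<close>

lemma riemann_sum_error:
  fixes N t :: real and K :: nat
  assumes der: "\<And>x. (g has_real_derivative g' x) (at x)" and cont: "continuous_on UNIV g'"
    and g': "decays a g'" and N: "N > 0"
  defines "D \<equiv> \<lambda>s. (if s < real K / N then v (t - (real (nat \<lfloor>N * s\<rfloor>) + 1) / N) else 0) - v (t - s)"
  shows "integrable lborel (\<lambda>s. indicator {0..} s * (g' s * D s))"
    and "(\<Sum>k<K. g (real k / N) * (v (t - real k / N) - v (t - (real k + 1) / N))) - (g 0 * v t + conv g' v t)
      = (LINT s|lborel. indicator {0..} s * (g' s * D s)) - g (real K / N) * v (t - real K / N)"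
proof -
  have [measurable]: "g' \<in> borel_measurable borel"
    using cont by (rule borel_measurable_continuous_onI)
  let ?J = "\<lambda>k. {real k / N..<(real k + 1) / N}"
  let ?H = "\<lambda>k. v (t - (real k + 1) / N)"
  have J: "integrable lborel (\<lambda>s. indicator (?J k) s * g' s)"
    "(LINT s|lborel. indicator (?J k) s * g' s) = g ((real k + 1) / N) - g (real k / N)" for k
  proof -
    let ?I = "{real k / N..(real k + 1) / N}"
    have I: "integrable lborel (\<lambda>s. indicator ?I s *\<^sub>R g' s)"
      by (rule borel_integrable_compact) (use cont in \<open>auto intro: continuous_on_subset\<close>)
    have FTC: "(LINT s|lborel. indicator ?I s *\<^sub>R g' s) = g ((real k + 1) / N) - g (real k / N)"
    proof (rule integral_FTC_atLeastAtMost)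
      show "real k / N \<le> (real k + 1) / N" using N by (simp add: field_simps)
      show "continuous_on ?I g'" using cont by (rule continuous_on_subset) simp
      fix x
      show "(g has_vector_derivative g' x) (at x within ?I)"
        using der[of x] by (simp add: has_real_derivative_iff_has_vector_derivative has_vector_derivative_at_within)
    qed
    \<comment> \<open>The fundamental theorem is applied on the closed interval, which differs from
      the half-open cell in one point.\<close>
    have ae: "AE s in lborel. indicator (?J k) s * g' s = indicator ?I s *\<^sub>R g' s"
      using AE_lborel_singleton[of "(real k + 1) / N"] by eventually_elim (auto simp: indicator_def)
    show "integrable lborel (\<lambda>s. indicator (?J k) s * g' s)"
      using I by (subst integrable_cong_AE[OF _ _ ae]) auto
    show "(LINT s|lborel. indicator (?J k) s * g' s) = g ((real k + 1) / N) - g (real k / N)"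
      unfolding FTC[symmetric] by (rule integral_cong_AE[OF _ _ ae]) auto
  qed
  let ?T1 = "\<lambda>s. \<Sum>k<K. (indicator (?J k) s * g' s) * ?H k"
  let ?T2 = "\<lambda>s. indicator {0..} s * (g' s * v (t - s))"
  have T1: "integrable lborel ?T1"
    by (intro Bochner_Integration.integrable_sum integrable_mult_left J)
  have c: "integrable lborel (\<lambda>u. indicator {..t} u * (g' (t - u) * v u))"
    by (rule conv_integrable[OF _ g']) simp
  \<comment> \<open>The substitution \<open>s = t - u\<close> turns the convolution over
    \<open>u \<le> t\<close> into an integral over lags \<open>s \<ge> 0\<close>.\<close>
  have refl: "(\<lambda>s. indicator {..t} (t + (- 1) * s) * (g' (t - (t + (- 1) * s)) * v (t + (- 1) * s))) = ?T2"
    by (auto simp: indicator_def fun_eq_iff)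
  have T2: "integrable lborel ?T2"
    using lborel_integrable_real_affine[OF c, of "- 1" t] unfolding refl by simp
  have T2_int: "(LINT s|lborel. ?T2 s) = conv g' v t"
    unfolding conv_def
    using lborel_integral_real_affine[of "- 1" "\<lambda>u. indicator {..t} u * (g' (t - u) * v u)" t]
    unfolding refl by simp
  \<comment> \<open>Beyond \<open>real K / N\<close> the sum \<open>?T1\<close> is zero and
    \<open>D s\<close> is \<open>- v (t - s)\<close>, so the truncation error is part of the same
    integral.\<close>
  have eq: "indicator {0..} s * (g' s * D s) = ?T1 s - ?T2 s" for s
  proof -
    have "?T1 s = (\<Sum>k<K. indicator (?J k) s * (g' s * ?H k))" by (simp only: mult.assoc)
    also have "\<dots> = (if 0 \<le> s \<and> s < real K / N then g' s * ?H (nat \<lfloor>N * s\<rfloor>) else 0)"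
      by (rule sum_grid_indicator[OF N])
    finally show ?thesis by (auto simp: D_def indicator_def algebra_simps)
  qed
  show "integrable lborel (\<lambda>s. indicator {0..} s * (g' s * D s))"
    unfolding eq by (rule Bochner_Integration.integrable_diff[OF T1 T2])
  have "(LINT s|lborel. indicator {0..} s * (g' s * D s)) = (LINT s|lborel. ?T1 s) - conv g' v t"
    unfolding eq T2_int[symmetric] by (rule Bochner_Integration.integral_diff[OF T1 T2])
  also have "(LINT s|lborel. ?T1 s) = (\<Sum>k<K. LINT s|lborel. (indicator (?J k) s * g' s) * ?H k)"
    by (rule Bochner_Integration.integral_sum) (intro integrable_mult_left J)
  also have "\<dots> = (\<Sum>k<K. (g ((real k + 1) / N) - g (real k / N)) * ?H k)"
    by (simp only: integral_mult_left_zero J)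
  finally have "(LINT s|lborel. indicator {0..} s * (g' s * D s))
      = (\<Sum>k<K. (g ((real k + 1) / N) - g (real k / N)) * ?H k) - conv g' v t" .
  moreover have "(\<Sum>k<K. g (real k / N) * (v (t - real k / N) - v (t - (real k + 1) / N)))
      = g 0 * v t - g (real K / N) * v (t - real K / N) + (\<Sum>k<K. (g ((real k + 1) / N) - g (real k / N)) * ?H k)"
    using sum_by_parts[of "\<lambda>k. g (real k / N)" "\<lambda>k. v (t - real k / N)" K] by (simp add: add.commute)
  ultimately show "(\<Sum>k<K. g (real k / N) * (v (t - real k / N) - v (t - (real k + 1) / N))) - (g 0 * v t + conv g' v t)
      = (LINT s|lborel. indicator {0..} s * (g' s * D s)) - g (real K / N) * v (t - real K / N)"
    by linarith
qed

text \<open>Cauchy-Schwarz with the weight \<open>exp (- a * s)\<close> shared evenly between the two factors.\<close>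

lemma riemann_sum_error_square:
  fixes N t K' :: real and K :: nat
  assumes der: "\<And>x. (g has_real_derivative g' x) (at x)" and cont: "continuous_on UNIV g'"
    and K': "K' \<ge> 0" "\<And>s. s \<ge> 0 \<Longrightarrow> \<bar>g' s\<bar> \<le> K' * exp (- a * s)" and N: "N > 0"
  defines "D \<equiv> \<lambda>s. (if s < real K / N then v (t - (real (nat \<lfloor>N * s\<rfloor>) + 1) / N) else 0) - v (t - s)"
  shows "ennreal (((\<Sum>k<K. g (real k / N) * (v (t - real k / N) - v (t - (real k + 1) / N)))
      - (g 0 * v t + conv g' v t))\<^sup>2)
    \<le> 2 * ((\<integral>\<^sup>+s. (indicator {0..} s * ennreal (K' * exp (- (a / 2) * s)))\<^sup>2 \<partial>lborel)
        * (\<integral>\<^sup>+s. indicator {0..} s * ennreal (exp (- a * s) * (D s)\<^sup>2) \<partial>lborel))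
      + 2 * ennreal ((g (real K / N) * v (t - real K / N))\<^sup>2)"
proof -
  have g': "decays a g'" using K'(2) unfolding decays_def by blast
  let ?w = "\<lambda>s. exp (- (a / 2) * s)"
  let ?p = "\<lambda>s. indicator {0..} s * ennreal (K' * ?w s)" and ?q = "\<lambda>s. indicator {0..} s * ennreal (?w s * \<bar>D s\<bar>)"
  have exp_half: "exp (- a * s) = ?w s * ?w s" for s
    by (simp flip: exp_add)
  have [measurable]: "D \<in> borel_measurable borel" unfolding D_def by measurable
  have p: "?p \<in> borel_measurable lborel" and q: "?q \<in> borel_measurable lborel" by measurable
  have err: "integrable lborel (\<lambda>s. indicator {0..} s * (g' s * D s))"
    "(\<Sum>k<K. g (real k / N) * (v (t - real k / N) - v (t - (real k + 1) / N))) - (g 0 * v t + conv g' v t)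
      = (LINT s|lborel. indicator {0..} s * (g' s * D s)) - g (real K / N) * v (t - real K / N)"
    unfolding D_def by (rule riemann_sum_error[OF der cont g' N])+
  define x where "x = (LINT s|lborel. indicator {0..} s * (g' s * D s))"
  have "ennreal (norm x) \<le> (\<integral>\<^sup>+s. ennreal (norm (indicator {0..} s * (g' s * D s))) \<partial>lborel)"
    unfolding x_def by (rule integral_norm_bound_ennreal[OF err(1)])
  also have "\<dots> \<le> (\<integral>\<^sup>+s. ?p s * ?q s \<partial>lborel)"
  proof (rule nn_integral_mono)
    fix s :: real
    show "ennreal (norm (indicator {0..} s * (g' s * D s))) \<le> ?p s * ?q s"
    proof (cases "s \<ge> 0")
      case True
      have "\<bar>g' s\<bar> * \<bar>D s\<bar> \<le> K' * exp (- a * s) * \<bar>D s\<bar>"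
        using K'(2)[OF True] by (rule mult_right_mono) simp
      also have "\<dots> = (K' * ?w s) * (?w s * \<bar>D s\<bar>)"
        unfolding exp_half[of s] by (simp only: mult.assoc)
      finally have "ennreal (\<bar>g' s\<bar> * \<bar>D s\<bar>) \<le> ennreal ((K' * ?w s) * (?w s * \<bar>D s\<bar>))"
        by (rule ennreal_leI)
      also have "\<dots> = ennreal (K' * ?w s) * ennreal (?w s * \<bar>D s\<bar>)"
        by (rule ennreal_mult) (use K'(1) in auto)
      finally show ?thesis using True by (simp add: abs_mult)
    qed simp
  qed
  finally have "(ennreal (norm x))\<^sup>2 \<le> (\<integral>\<^sup>+s. ?p s * ?q s \<partial>lborel)\<^sup>2"
    by (rule power_mono) simp
  also have "\<dots> \<le> (\<integral>\<^sup>+s. (?p s)\<^sup>2 \<partial>lborel) * (\<integral>\<^sup>+s. (?q s)\<^sup>2 \<partial>lborel)"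
    by (rule Cauchy_Schwarz_nn_integral[OF p q])
  also have "(\<integral>\<^sup>+s. (?q s)\<^sup>2 \<partial>lborel) = (\<integral>\<^sup>+s. indicator {0..} s * ennreal (exp (- a * s) * (D s)\<^sup>2) \<partial>lborel)"
  proof (rule nn_integral_cong)
    fix s :: real
    have "(?w s * \<bar>D s\<bar>)\<^sup>2 = exp (- a * s) * (D s)\<^sup>2"
      unfolding power_mult_distrib power2_abs exp_half[of s] power2_eq_square[of "?w s"] ..
    then have "(ennreal (?w s * \<bar>D s\<bar>))\<^sup>2 = ennreal (exp (- a * s) * (D s)\<^sup>2)"
      by (subst ennreal_power) simp_all
    then show "(?q s)\<^sup>2 = indicator {0..} s * ennreal (exp (- a * s) * (D s)\<^sup>2)"
      by (cases "0 \<le> s") simp_all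
  qed
  finally have x2: "ennreal (x\<^sup>2) \<le> (\<integral>\<^sup>+s. (?p s)\<^sup>2 \<partial>lborel)
      * (\<integral>\<^sup>+s. indicator {0..} s * ennreal (exp (- a * s) * (D s)\<^sup>2) \<partial>lborel)"
    unfolding real_norm_def ennreal_abs_power2 .
  show ?thesis
    unfolding err(2) x_def[symmetric]
    by (rule order_trans[OF ennreal_square_add_le], rule add_right_mono, rule mult_left_mono, rule x2, rule zero_le)
qed

end

lemma nn_integral_linear:
  assumes [measurable]: "I \<in> borel_measurable N" "J \<in> borel_measurable N"
  shows "(\<integral>\<^sup>+x. c * I x + d * J x \<partial>N) = c * (\<integral>\<^sup>+x. I x \<partial>N) + d * (\<integral>\<^sup>+x. J x \<partial>N)"
proof -
  have "(\<integral>\<^sup>+x. c * I x + d * J x \<partial>N) = (\<integral>\<^sup>+x. c * I x \<partial>N) + (\<integral>\<^sup>+x. d * J x \<partial>N)"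
    by (rule nn_integral_add) measurable
  then show ?thesis by (simp only: nn_integral_cmult[OF assms(1)] nn_integral_cmult[OF assms(2)])
qed

section \<open>Mean-square convergence of the Riemann sums\<close>

context centred_levy
begin

text \<open>The pathwise error bound is averaged over \<open>\<omega>\<close>, and the expectation
  is exchanged with the integral over the lag. This leaves the second moment of \<open>D\<close>,
  treated by dominated convergence, and a boundary term at lag n+1, where the decay of
  \<open>g\<close> beats the linear growth of the path.\<close>

lemma step_integral_converges:
  assumes a: "a > 0" and V: "(\<lambda>(t, \<omega>). V t \<omega>) \<in> borel_measurable (borel \<Otimes>\<^sub>M M)"
    and VW: "AE \<omega> in M. \<forall>t. V t \<omega> = W t \<omega>"
    and V_int: "\<And>\<omega>. \<omega> \<in> space M \<Longrightarrow> integrable lborel (\<lambda>u. exp (- a * \<bar>u\<bar>) * V u \<omega>)"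
    and der: "\<And>x. (g has_real_derivative g' x) (at x)" and cont: "continuous_on UNIV g'"
    and g: "decays a g" and g': "decays a g'"
  shows "(\<lambda>n. \<integral>\<^sup>+\<omega>. ennreal (((\<Sum>k<Suc n * Suc n. g (real k / real (Suc n))
      * (W (t - real k / real (Suc n)) \<omega> - W (t - (real k + 1) / real (Suc n)) \<omega>))
      - (g 0 * V t \<omega> + conv g' (\<lambda>u. V u \<omega>) t))\<^sup>2) \<partial>M) \<longlonglongrightarrow> 0"
proof -
  interpret pair_sigma_finite lborel M ..
  obtain K where K: "K \<ge> 0" "\<And>s. s \<ge> 0 \<Longrightarrow> \<bar>g s\<bar> \<le> K * exp (- a * s)"
    using decaysE[OF g] by blast
  obtain K' where K': "K' \<ge> 0" "\<And>s. s \<ge> 0 \<Longrightarrow> \<bar>g' s\<bar> \<le> K' * exp (- a * s)"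
    using decaysE[OF g'] by blast
  have m[measurable]: "(\<lambda>p. V (fst p) (snd p)) \<in> borel_measurable (borel \<Otimes>\<^sub>M M)"
    using V by (simp add: case_prod_unfold)
  have V2 [measurable]: "V t \<in> borel_measurable M" for t
    using measurable_compose[OF measurable_Pair1' m, of t] by simp
  have Vdiff: "(\<integral>\<^sup>+\<omega>. ennreal ((V x \<omega> - V y \<omega>)\<^sup>2) \<partial>M) = ennreal (\<bar>x - y\<bar> * var_1)" for x y
    unfolding W_second_moment[symmetric]
    by (rule nn_integral_cong_AE) (use VW in eventually_elim, simp)
  have V_sq: "(\<integral>\<^sup>+\<omega>. ennreal ((V x \<omega>)\<^sup>2) \<partial>M) = ennreal (\<bar>x\<bar> * var_1)" for x
  proof -
    have "(\<integral>\<^sup>+\<omega>. ennreal ((V x \<omega>)\<^sup>2) \<partial>M) = (\<integral>\<^sup>+\<omega>. ennreal ((V x \<omega> - V 0 \<omega>)\<^sup>2) \<partial>M)"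
      by (rule nn_integral_cong_AE) (use VW W_0 in eventually_elim, simp)
    then show ?thesis by (simp add: Vdiff)
  qed
  let ?N = "\<lambda>n. real (Suc n)"
  let ?r = "\<lambda>n s. (real (nat \<lfloor>?N n * s\<rfloor>) + 1) / ?N n"
  define D where "D = (\<lambda>n s \<omega>. (if s < ?N n then V (t - ?r n s) \<omega> else 0) - V (t - s) \<omega>)"
  have r_meas: "(\<lambda>p. (t - ?r n (fst p), snd p)) \<in> measurable (borel \<Otimes>\<^sub>M M) (borel \<Otimes>\<^sub>M M)" for n
    by measurable
  have s_meas: "(\<lambda>p. (t - fst p, snd p)) \<in> measurable (borel \<Otimes>\<^sub>M M) (borel \<Otimes>\<^sub>M M)"
    by measurable
  have [measurable]: "(\<lambda>p. V (t - ?r n (fst p)) (snd p)) \<in> borel_measurable (borel \<Otimes>\<^sub>M M)" for n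
    using measurable_compose[OF r_meas m] by simp
  have [measurable]: "(\<lambda>p. V (t - fst p) (snd p)) \<in> borel_measurable (borel \<Otimes>\<^sub>M M)"
    using measurable_compose[OF s_meas m] by simp
  have D_meas [measurable]: "(\<lambda>p. D n (fst p) (snd p)) \<in> borel_measurable (borel \<Otimes>\<^sub>M M)" for n
    unfolding D_def by measurable
  have D1 [measurable]: "(\<lambda>s. D n s \<omega>) \<in> borel_measurable borel" if "\<omega> \<in> space M" for n \<omega>
    using measurable_compose[OF measurable_Pair2'[OF that] D_meas] by simp
  have D2 [measurable]: "(\<lambda>\<omega>. D n s \<omega>) \<in> borel_measurable M" for n s
    using measurable_compose[OF measurable_Pair1' D_meas, of s] by simp
  have D3 [measurable]: "(\<lambda>p. D n (snd p) (fst p)) \<in> borel_measurable (M \<Otimes>\<^sub>M borel)" for n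
    using measurable_compose[OF measurable_pair_swap'[of M borel] D_meas] by (simp add: case_prod_unfold)
  \<comment> \<open>A bound for the second moment of \<open>D n s\<close>: before the cutoff
    \<open>D\<close> compares the path at two times at most 1/(n+1) apart, after it only the path at
    \<open>t - s\<close> remains.\<close>
  define q where "q = (\<lambda>n s. if s < ?N n then var_1 / ?N n else \<bar>t - s\<bar> * var_1)"
  have D_sq: "(\<integral>\<^sup>+\<omega>. ennreal ((D n s \<omega>)\<^sup>2) \<partial>M) \<le> ennreal (q n s)" if s: "s \<ge> 0" for n s
  proof (cases "s < ?N n")
    case True
    have "?N n * s \<ge> 0" using s by simp
    then have "?N n * s \<le> real (nat \<lfloor>?N n * s\<rfloor>) + 1" "real (nat \<lfloor>?N n * s\<rfloor>) + 1 \<le> ?N n * s + 1" by linarith+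
    then have "s \<le> ?r n s" "?r n s \<le> s + 1 / ?N n" by (simp_all add: field_simps del: of_nat_Suc)
    then have "\<bar>t - ?r n s - (t - s)\<bar> \<le> 1 / ?N n" by linarith
    from mult_right_mono[OF this var_1_nonneg] True show ?thesis
      by (auto simp: D_def q_def Vdiff simp del: of_nat_Suc intro!: ennreal_leI)
  next
    case False
    then show ?thesis by (simp add: D_def q_def V_sq)
  qed
  have exp_half: "exp (- a * s) = exp (- (a / 2) * s) * exp (- (a / 2) * s)" for s
    by (simp flip: exp_add)
  define c1 where "c1 = (\<integral>\<^sup>+s. (indicator {0..} s * ennreal (K' * exp (- (a / 2) * s)))\<^sup>2 \<partial>lborel)"
  define R where "R = (\<lambda>n. \<integral>\<^sup>+s. indicator {0..} s * ennreal (exp (- a * s) * q n s) \<partial>lborel)"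
  have c1: "c1 < \<infinity>"
  proof -
    have "c1 \<le> (\<integral>\<^sup>+s. ennreal (K'\<^sup>2 * exp (- a * \<bar>s\<bar>)) \<partial>lborel)"
      unfolding c1_def
    proof (rule nn_integral_mono)
      fix s :: real
      have "(K' * exp (- (a / 2) * s))\<^sup>2 = K'\<^sup>2 * exp (- a * s)"
        by (simp add: power_mult_distrib power2_eq_square flip: exp_add)
      then show "(indicator {0..} s * ennreal (K' * exp (- (a / 2) * s)))\<^sup>2 \<le> ennreal (K'\<^sup>2 * exp (- a * \<bar>s\<bar>))"
        using K'(1) by (auto simp: indicator_def ennreal_power)
    qed
    also have "\<dots> < \<infinity>"
      using integrable_exp_neg_abs[OF a] by (subst nn_integral_eq_integral) auto
    finally show ?thesis .
  qed
  have bound: "(\<integral>\<^sup>+\<omega>. ennreal (((\<Sum>k<Suc n * Suc n. g (real k / ?N n)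
      * (W (t - real k / ?N n) \<omega> - W (t - (real k + 1) / ?N n) \<omega>))
      - (g 0 * V t \<omega> + conv g' (\<lambda>u. V u \<omega>) t))\<^sup>2) \<partial>M)
    \<le> 2 * (c1 * R n) + 2 * ennreal ((g (?N n))\<^sup>2 * (\<bar>t - ?N n\<bar> * var_1))" (is "?L \<le> _") for n
  proof -
    have L: "?L \<le> (\<integral>\<^sup>+\<omega>. 2 * (c1 * (\<integral>\<^sup>+s. indicator {0..} s * ennreal (exp (- a * s) * (D n s \<omega>)\<^sup>2) \<partial>lborel))
        + 2 * ennreal ((g (?N n) * V (t - ?N n) \<omega>)\<^sup>2) \<partial>M)"
    proof (rule nn_integral_mono_AE)
      have N0: "?N n > 0" by simp
      then have NN: "real (Suc n * Suc n) / ?N n = ?N n"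
        by (simp only: of_nat_mult nonzero_mult_div_cancel_right[OF less_imp_neq[OF N0, symmetric]])
      show "AE \<omega> in M. ennreal (((\<Sum>k<Suc n * Suc n. g (real k / ?N n)
          * (W (t - real k / ?N n) \<omega> - W (t - (real k + 1) / ?N n) \<omega>))
          - (g 0 * V t \<omega> + conv g' (\<lambda>u. V u \<omega>) t))\<^sup>2)
        \<le> 2 * (c1 * (\<integral>\<^sup>+s. indicator {0..} s * ennreal (exp (- a * s) * (D n s \<omega>)\<^sup>2) \<partial>lborel))
          + 2 * ennreal ((g (?N n) * V (t - ?N n) \<omega>)\<^sup>2)"
        using VW AE_space
      proof eventually_elim
        case (elim \<omega>)
        interpret path: weighted_path a "\<lambda>u. V u \<omega>"
          by unfold_locales (rule V_int[OF elim(2)], rule a)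
        show ?case
          using path.riemann_sum_error_square[OF der cont K' N0, where K = "Suc n * Suc n" and t = t, unfolded NN]
            elim(1) unfolding c1_def D_def by (simp only:)
      qed
    qed
    have L_eq: "(\<integral>\<^sup>+\<omega>. 2 * (c1 * (\<integral>\<^sup>+s. indicator {0..} s * ennreal (exp (- a * s) * (D n s \<omega>)\<^sup>2) \<partial>lborel))
        + 2 * ennreal ((g (?N n) * V (t - ?N n) \<omega>)\<^sup>2) \<partial>M)
      = 2 * (c1 * (\<integral>\<^sup>+\<omega>. (\<integral>\<^sup>+s. indicator {0..} s * ennreal (exp (- a * s) * (D n s \<omega>)\<^sup>2) \<partial>lborel) \<partial>M))
        + 2 * (\<integral>\<^sup>+\<omega>. ennreal ((g (?N n) * V (t - ?N n) \<omega>)\<^sup>2) \<partial>M)"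
    proof -
      have I: "(\<lambda>\<omega>. \<integral>\<^sup>+s. indicator {0..} s * ennreal (exp (- a * s) * (D n s \<omega>)\<^sup>2) \<partial>lborel) \<in> borel_measurable M"
        by (rule sigma_finite_measure.borel_measurable_nn_integral[OF lborel.sigma_finite_measure_axioms])
           measurable
      have lin: "(\<integral>\<^sup>+\<omega>. 2 * (c1 * I \<omega>) + 2 * J \<omega> \<partial>M) = 2 * (c1 * (\<integral>\<^sup>+\<omega>. I \<omega> \<partial>M)) + 2 * (\<integral>\<^sup>+\<omega>. J \<omega> \<partial>M)"
        if "I \<in> borel_measurable M" "J \<in> borel_measurable M" for I J :: "'w \<Rightarrow> ennreal"
        using nn_integral_linear[OF that, of "2 * c1" 2] by (simp only: mult.assoc)
      show ?thesis by (rule lin[OF I]) measurable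
    qed
    have swap: "(\<integral>\<^sup>+\<omega>. (\<integral>\<^sup>+s. indicator {0..} s * ennreal (exp (- a * s) * (D n s \<omega>)\<^sup>2) \<partial>lborel) \<partial>M)
        = (\<integral>\<^sup>+s. (\<integral>\<^sup>+\<omega>. indicator {0..} s * ennreal (exp (- a * s) * (D n s \<omega>)\<^sup>2) \<partial>M) \<partial>lborel)"
      by (rule Fubini') measurable
    have last: "(\<integral>\<^sup>+\<omega>. ennreal ((g (?N n) * V (t - ?N n) \<omega>)\<^sup>2) \<partial>M) = ennreal ((g (?N n))\<^sup>2 * (\<bar>t - ?N n\<bar> * var_1))"
      by (simp add: power_mult_distrib ennreal_mult nn_integral_cmult V_sq var_1_nonneg del: of_nat_Suc)
    have main: "(\<integral>\<^sup>+s. (\<integral>\<^sup>+\<omega>. indicator {0..} s * ennreal (exp (- a * s) * (D n s \<omega>)\<^sup>2) \<partial>M) \<partial>lborel) \<le> R n"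
      unfolding R_def
    proof (rule nn_integral_mono)
      fix s :: real
      show "(\<integral>\<^sup>+\<omega>. indicator {0..} s * ennreal (exp (- a * s) * (D n s \<omega>)\<^sup>2) \<partial>M)
          \<le> indicator {0..} s * ennreal (exp (- a * s) * q n s)"
      proof (cases "s \<ge> 0")
        case True
        have "q n s \<ge> 0" using var_1_nonneg by (simp add: q_def)
        then show ?thesis using True mult_left_mono[OF D_sq[OF True, of n], of "ennreal (exp (- a * s))"]
          by (simp add: ennreal_mult nn_integral_cmult)
      qed simp
    qed
    show ?thesis
      using L unfolding L_eq swap last
      by (rule order_trans) (rule add_right_mono, rule mult_left_mono, rule mult_left_mono, rule main, simp_all)
  qed
  have R: "R \<longlonglongrightarrow> 0"
  proof -
    have "R \<longlonglongrightarrow> (\<integral>\<^sup>+s. 0 \<partial>(lborel :: real measure))"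
      unfolding R_def
    proof (rule nn_integral_dominated_convergence[where
          w = "\<lambda>s. ennreal ((var_1 * (1 + \<bar>t\<bar>) + 2 * var_1 / a) * exp (- (a / 2) * \<bar>s\<bar>))"])
      show "(\<lambda>s. indicator {0..} s * ennreal (exp (- a * s) * q n s)) \<in> borel_measurable lborel" for n
        unfolding q_def by measurable
      show "AE s in lborel. indicator {0..} s * ennreal (exp (- a * s) * q n s)
          \<le> ennreal ((var_1 * (1 + \<bar>t\<bar>) + 2 * var_1 / a) * exp (- (a / 2) * \<bar>s\<bar>))" for n
      proof (rule AE_I2)
        fix s :: real
        show "indicator {0..} s * ennreal (exp (- a * s) * q n s)
          \<le> ennreal ((var_1 * (1 + \<bar>t\<bar>) + 2 * var_1 / a) * exp (- (a / 2) * \<bar>s\<bar>))"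
        proof (cases "s \<ge> 0")
          case True
          have "q n s \<le> var_1 * (1 + \<bar>t\<bar>) + \<bar>s\<bar> * var_1"
          proof (cases "s < ?N n")
            case True
            have "var_1 / ?N n \<le> var_1"
              using var_1_nonneg by (simp add: divide_le_eq mult_le_cancel_left1)
            moreover have "0 \<le> var_1 * \<bar>t\<bar>" "0 \<le> \<bar>s\<bar> * var_1" using var_1_nonneg by simp_all
            ultimately show ?thesis using True unfolding q_def by (simp add: distrib_left del: of_nat_Suc)
          next
            case False
            have "\<bar>t - s\<bar> * var_1 \<le> (\<bar>t\<bar> + \<bar>s\<bar>) * var_1"
              by (intro mult_right_mono var_1_nonneg) linarith
            then show ?thesis using False var_1_nonneg unfolding q_def by (simp add: algebra_simps del: of_nat_Suc)
          qed
          then have "exp (- a * s) * q n s \<le> exp (- a * \<bar>s\<bar>) * (var_1 * (1 + \<bar>t\<bar>) + \<bar>s\<bar> * var_1)"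
            using True by simp
          also have "\<dots> \<le> (var_1 * (1 + \<bar>t\<bar>) + 2 * var_1 / a) * exp (- (a / 2) * \<bar>s\<bar>)"
            by (rule exp_mult_linear_le) (use a var_1_nonneg in auto)
          finally show ?thesis using True by (simp add: ennreal_leI)
        qed simp
      qed
      have "integrable lborel (\<lambda>s. (var_1 * (1 + \<bar>t\<bar>) + 2 * var_1 / a) * exp (- (a / 2) * \<bar>s\<bar>))"
        using a by (intro integrable_mult_right integrable_exp_neg_abs) simp
      then show "(\<integral>\<^sup>+s. ennreal ((var_1 * (1 + \<bar>t\<bar>) + 2 * var_1 / a) * exp (- (a / 2) * \<bar>s\<bar>)) \<partial>lborel) < \<infinity>"
        by (subst nn_integral_eq_integral) (use a var_1_nonneg in auto)
      show "AE s in lborel. (\<lambda>n. indicator {0..} s * ennreal (exp (- a * s) * q n s)) \<longlonglongrightarrow> 0"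
      proof (rule AE_I2)
        fix s :: real
        obtain n0 where n0: "s < real n0" using reals_Archimedean2 by blast
        \<comment> \<open>A fixed lag \<open>s\<close> lies below the cutoff n+1 for all large n, so
          only the first case of \<open>q\<close> matters in the limit.\<close>
        have "\<forall>\<^sub>F n in sequentially. var_1 * inverse (?N n) = q n s"
          using n0 by (intro eventually_sequentiallyI[of n0]) (auto simp: q_def divide_inverse)
        moreover have "(\<lambda>n. var_1 * inverse (?N n)) \<longlonglongrightarrow> var_1 * 0"
          by (intro tendsto_mult tendsto_const LIMSEQ_inverse_real_of_nat)
        ultimately have "(\<lambda>n. q n s) \<longlonglongrightarrow> var_1 * 0" by (rule Lim_transform_eventually[rotated])
        then have "(\<lambda>n. ennreal (exp (- a * s) * q n s)) \<longlonglongrightarrow> ennreal (exp (- a * s) * (var_1 * 0))"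
          by (intro tendsto_ennrealI tendsto_mult tendsto_const)
        then have "(\<lambda>n. ennreal (exp (- a * s) * q n s)) \<longlonglongrightarrow> 0" by simp
        then show "(\<lambda>n. indicator {0..} s * ennreal (exp (- a * s) * q n s)) \<longlonglongrightarrow> 0"
          by (auto simp: indicator_def)
      qed
    qed simp_all
    then show ?thesis by simp
  qed
  have B: "(\<lambda>n. ennreal ((g (?N n))\<^sup>2 * (\<bar>t - ?N n\<bar> * var_1))) \<longlonglongrightarrow> 0"
  proof -
    let ?c = "K\<^sup>2 * (\<bar>t\<bar> * var_1 + 2 * var_1 / a)"
    have "(\<lambda>n. (g (?N n))\<^sup>2 * (\<bar>t - ?N n\<bar> * var_1)) \<longlonglongrightarrow> 0"
    proof (rule tendsto_sandwich[of "\<lambda>_. 0" _ _ "\<lambda>n. ?c * exp (- (a / 2) * ?N n)"])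
      have "filterlim (\<lambda>n. exp (- (a / 2) * ?N n)) (nhds 0) sequentially"
        using a by real_asymp
      from tendsto_mult[OF tendsto_const this, of ?c]
      show "(\<lambda>n. ?c * exp (- (a / 2) * ?N n)) \<longlonglongrightarrow> 0" by simp
      show "\<forall>\<^sub>F n in sequentially. (g (?N n))\<^sup>2 * (\<bar>t - ?N n\<bar> * var_1) \<le> ?c * exp (- (a / 2) * ?N n)"
      proof (rule always_eventually, rule allI)
        fix n
        have N0: "?N n \<ge> 0" by simp
        have "(g (?N n))\<^sup>2 = \<bar>g (?N n)\<bar>\<^sup>2" by simp
        also have "\<dots> \<le> (K * exp (- a * ?N n))\<^sup>2" by (rule power_mono[OF K(2)[OF N0]]) simp
        also have "\<dots> = K\<^sup>2 * (exp (- a * ?N n) * exp (- a * ?N n))" by (simp add: power2_eq_square)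
        also have "\<dots> \<le> K\<^sup>2 * (exp (- a * ?N n) * 1)" using a by (intro mult_left_mono) auto
        finally have 1: "(g (?N n))\<^sup>2 \<le> K\<^sup>2 * exp (- a * ?N n)" by simp
        have 2: "\<bar>t - ?N n\<bar> * var_1 \<le> \<bar>t\<bar> * var_1 + \<bar>?N n\<bar> * var_1"
          unfolding distrib_right[symmetric] by (intro mult_right_mono var_1_nonneg) linarith
        have "(g (?N n))\<^sup>2 * (\<bar>t - ?N n\<bar> * var_1) \<le> (K\<^sup>2 * exp (- a * ?N n)) * (\<bar>t\<bar> * var_1 + \<bar>?N n\<bar> * var_1)"
          using 1 2 var_1_nonneg by (intro mult_mono) auto
        also have "\<dots> = K\<^sup>2 * (exp (- a * \<bar>?N n\<bar>) * (\<bar>t\<bar> * var_1 + \<bar>?N n\<bar> * var_1))" by simp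
        also have "\<dots> \<le> K\<^sup>2 * ((\<bar>t\<bar> * var_1 + 2 * var_1 / a) * exp (- (a / 2) * \<bar>?N n\<bar>))"
          using a var_1_nonneg by (intro mult_left_mono exp_mult_linear_le) auto
        finally show "(g (?N n))\<^sup>2 * (\<bar>t - ?N n\<bar> * var_1) \<le> ?c * exp (- (a / 2) * ?N n)" by simp
      qed
    qed (use var_1_nonneg in auto)
    from tendsto_ennrealI[OF this] show ?thesis by simp
  qed
  have "(\<lambda>n. 2 * (c1 * R n) + 2 * ennreal ((g (?N n))\<^sup>2 * (\<bar>t - ?N n\<bar> * var_1))) \<longlonglongrightarrow> 2 * (c1 * 0) + 2 * 0"
    using c1 R B by (intro tendsto_add ennreal_tendsto_cmult) auto
  then have "(\<lambda>n. 2 * (c1 * R n) + 2 * ennreal ((g (?N n))\<^sup>2 * (\<bar>t - ?N n\<bar> * var_1))) \<longlonglongrightarrow> 0" by simp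
  with bound show ?thesis by (rule ennreal_tendsto_0_le)
qed

lemma conv_version_measurable:
  assumes V: "(\<lambda>(t, \<omega>). V t \<omega>) \<in> borel_measurable (borel \<Otimes>\<^sub>M M)" and [measurable]: "g \<in> borel_measurable borel"
  shows "(\<lambda>\<omega>. conv g (\<lambda>u. V u \<omega>) t) \<in> borel_measurable M"
proof -
  have m: "(\<lambda>p. V (fst p) (snd p)) \<in> borel_measurable (borel \<Otimes>\<^sub>M M)"
    using V by (simp add: case_prod_unfold)
  have [measurable]: "(\<lambda>p. V (snd p) (fst p)) \<in> borel_measurable (M \<Otimes>\<^sub>M borel)"
    using measurable_compose[OF measurable_pair_swap'[of M borel] m] by (simp add: case_prod_unfold)
  show ?thesis
    unfolding conv_def
    by (rule sigma_finite_measure.borel_measurable_lebesgue_integral[OF lborel.sigma_finite_measure_axioms])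
       measurable
qed

end

section \<open>Uniqueness of the stochastic integral\<close>

lemma mult_mat_vec_index_sum:
  assumes "F \<in> carrier_mat k m" "v \<in> carrier_vec m" "i < k"
  shows "(F *\<^sub>v v) $ i = (\<Sum>j<m. F $$ (i, j) * v $ j)"
  using assms by (simp add: scalar_prod_def lessThan_atLeast0)

lemma component_measurable:
  assumes "j < m"
  shows "(\<lambda>v. v $ j) \<in> borel_measurable (vec_borel m)"
proof -
  have "(\<lambda>v. \<lambda>i\<in>{..<m}. v $ i) \<in> measurable (vec_borel m) (Pi\<^sub>M {..<m} (\<lambda>_. borel :: real measure))"
    unfolding vec_borel_def by (rule measurable_vimage_algebra1) (auto simp: space_PiM)
  from measurable_compose[OF this measurable_component_singleton, of j] assms
  show ?thesis by simp
qed

lemma space_vec_borel: "space (vec_borel m) = carrier_vec m"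
  by (simp add: vec_borel_def)

lemma measurable_vec_borelI:
  assumes "\<And>\<omega>. \<omega> \<in> space M \<Longrightarrow> Z \<omega> \<in> carrier_vec k" and "\<And>i. i < k \<Longrightarrow> (\<lambda>\<omega>. Z \<omega> $ i) \<in> borel_measurable M"
  shows "Z \<in> measurable M (vec_borel k)"
  unfolding vec_borel_def
proof (rule measurable_vimage_algebra2)
  show "Z \<in> space M \<rightarrow> carrier_vec k" using assms(1) by auto
  show "(\<lambda>x. \<lambda>i\<in>{..<k}. Z x $ i) \<in> measurable M (Pi\<^sub>M {..<k} (\<lambda>_. borel))"
    by (rule measurable_restrict) (use assms(2) in auto)
qed

lemma vec_borel_carrier: "Z \<in> measurable M (vec_borel k) \<Longrightarrow> \<omega> \<in> space M \<Longrightarrow> Z \<omega> \<in> carrier_vec k"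
  using measurable_space[of Z M "vec_borel k" \<omega>] by (simp add: space_vec_borel)

lemma vec_borel_component:
  assumes "Z \<in> measurable M (vec_borel k)" "i < k"
  shows "(\<lambda>\<omega>. Z \<omega> $ i) \<in> borel_measurable M"
  using measurable_compose[OF assms(1) component_measurable[OF assms(2)]] .

lemma vec_borel_diff:
  assumes Z: "Z \<in> measurable M (vec_borel k)" and Z': "Z' \<in> measurable M (vec_borel k)"
  shows "(\<lambda>\<omega>. Z \<omega> - Z' \<omega>) \<in> measurable M (vec_borel k)"
proof (rule measurable_vec_borelI)
  fix \<omega> assume "\<omega> \<in> space M"
  then show "Z \<omega> - Z' \<omega> \<in> carrier_vec k"
    using vec_borel_carrier[OF Z] vec_borel_carrier[OF Z'] by (intro minus_carrier_vec) auto
next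
  fix i assume i: "i < k"
  have "(\<lambda>\<omega>. (Z \<omega> - Z' \<omega>) $ i) \<in> borel_measurable M \<longleftrightarrow> (\<lambda>\<omega>. Z \<omega> $ i - Z' \<omega> $ i) \<in> borel_measurable M"
    using i carrier_vecD[OF vec_borel_carrier[OF Z']] by (intro measurable_cong) simp
  moreover have "(\<lambda>\<omega>. Z \<omega> $ i - Z' \<omega> $ i) \<in> borel_measurable M"
    by (intro borel_measurable_diff vec_borel_component[OF Z i] vec_borel_component[OF Z' i])
  ultimately show "(\<lambda>\<omega>. (Z \<omega> - Z' \<omega>) $ i) \<in> borel_measurable M" by simp
qed

lemma vec_sqnorm_sum: "v \<in> carrier_vec k \<Longrightarrow> vec_sqnorm v = (\<Sum>i<k. (v $ i)\<^sup>2)"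
  by (simp add: vec_sqnorm_def scalar_prod_def power2_eq_square lessThan_atLeast0)

lemma mat_sqnorm_sum: "F \<in> carrier_mat k m \<Longrightarrow> mat_sqnorm F = (\<Sum>i<k. \<Sum>j<m. (F $$ (i, j))\<^sup>2)"
  by (simp add: mat_sqnorm_def)

lemma ennreal_sum_squares:
  "ennreal (\<Sum>i\<in>I. (x i)\<^sup>2) = (\<Sum>i\<in>I. ennreal ((x i)\<^sup>2))"
  by (simp add: sum_ennreal)

lemma nn_integral_linear3:
  assumes [measurable]: "I \<in> borel_measurable N" "J \<in> borel_measurable N" "K \<in> borel_measurable N"
  shows "(\<integral>\<^sup>+x. c * I x + d * J x + e * K x \<partial>N)
    = c * (\<integral>\<^sup>+x. I x \<partial>N) + d * (\<integral>\<^sup>+x. J x \<partial>N) + e * (\<integral>\<^sup>+x. K x \<partial>N)"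
proof -
  have "(\<integral>\<^sup>+x. c * I x + d * J x + e * K x \<partial>N) = (\<integral>\<^sup>+x. c * I x + d * J x \<partial>N) + (\<integral>\<^sup>+x. e * K x \<partial>N)"
    by (rule nn_integral_add) measurable
  then show ?thesis by (simp only: nn_integral_linear[OF assms(1,2)] nn_integral_cmult[OF assms(3)])
qed

text \<open>Cauchy-Schwarz for \<open>m\<close> summands; it separates the coordinates of the noise
  whatever their joint law.\<close>

lemma sum_square_le:
  fixes x :: "nat \<Rightarrow> real"
  shows "ennreal ((\<Sum>j<m. x j)\<^sup>2) \<le> of_nat m * (\<Sum>j<m. ennreal ((x j)\<^sup>2))"
proof -
  have "ennreal ((\<Sum>j<m. x j)\<^sup>2) \<le> ennreal (real m * (\<Sum>j<m. (x j)\<^sup>2))"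
    using sum_squared_le_sum_of_squares[of x "{..<m}"] by (intro ennreal_leI) (simp add: mult.commute)
  also have "\<dots> = of_nat m * (\<Sum>j<m. ennreal ((x j)\<^sup>2))"
    by (simp add: ennreal_mult sum_nonneg ennreal_of_nat_eq_real_of_nat flip: ennreal_sum_squares)
  finally show ?thesis .
qed

section \<open>Coordinates of the vector process and the bound for step integrals\<close>

locale centred_levy_vec =
  fixes M :: "'w measure" and m :: nat and L :: "real \<Rightarrow> 'w \<Rightarrow> real Matrix.vec"
  assumes levy: "levy_process M m L"
    and square_integrable: "integrable M (\<lambda>\<omega>. vec_sqnorm (L 1 \<omega>))"
    and centred: "\<And>i. i < m \<Longrightarrow> integral\<^sup>L M (\<lambda>\<omega>. L 1 \<omega> $ i) = 0"
begin

lemma L_measurable: "L t \<in> measurable M (vec_borel m)"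
  using levy by (simp add: levy_process_def)

lemma L_carrier: "\<omega> \<in> space M \<Longrightarrow> L t \<omega> \<in> carrier_vec m"
  by (rule vec_borel_carrier[OF L_measurable])

lemma L_diff_index: "\<omega> \<in> space M \<Longrightarrow> j < m \<Longrightarrow> (L t \<omega> - L s \<omega>) $ j = L t \<omega> $ j - L s \<omega> $ j"
  using carrier_vecD[OF L_carrier, of \<omega> s] by simp

sublocale prob_space M
  using levy by (simp add: levy_process_def)

text \<open>A coordinate of an increment is a measurable function of the vector increment, so
  stationarity and independence are inherited; square integrability follows as the squared norm
  dominates each squared coordinate.\<close>

lemma coordinate: 
  assumes j: "j < m"
  shows "centred_levy M (\<lambda>t \<omega>. L t \<omega> $ j)"
proof unfold_locales
  show meas: "(\<lambda>\<omega>. L t \<omega> $ j) \<in> borel_measurable M" for t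
    by (rule vec_borel_component[OF L_measurable j])
  show "AE \<omega> in M. L 0 \<omega> $ j = 0"
    using levy j by (auto simp: levy_process_def elim!: eventually_mono)
  show "AE \<omega> in M. \<forall>t. ((\<lambda>s. L s \<omega> $ j) \<longlongrightarrow> L t \<omega> $ j) (at_right t)"
  proof -
    have "AE \<omega> in M. \<forall>t. \<forall>i<m. ((\<lambda>s. L s \<omega> $ i) \<longlongrightarrow> L t \<omega> $ i) (at_right t) \<and>
        (\<exists>l. ((\<lambda>s. L s \<omega> $ i) \<longlongrightarrow> l) (at_left t))"
      using levy unfolding levy_process_def by (elim conjE)
    then show ?thesis by eventually_elim (use j in blast)
  qed
  show "integrable M (\<lambda>\<omega>. (L 1 \<omega> $ j)\<^sup>2)"
  proof (rule Bochner_Integration.integrable_bound[OF square_integrable])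
    show "AE \<omega> in M. norm ((L 1 \<omega> $ j)\<^sup>2) \<le> norm (vec_sqnorm (L 1 \<omega>))"
    proof (rule AE_I2)
      fix \<omega> assume "\<omega> \<in> space M"
      then have "(L 1 \<omega> $ j)\<^sup>2 \<le> vec_sqnorm (L 1 \<omega>)"
        using j by (subst vec_sqnorm_sum[OF L_carrier]) (auto intro!: member_le_sum[where f = "\<lambda>i. (L 1 \<omega> $ i)\<^sup>2"])
      then show "norm ((L 1 \<omega> $ j)\<^sup>2) \<le> norm (vec_sqnorm (L 1 \<omega>))" by simp
    qed
    show "(\<lambda>\<omega>. (L 1 \<omega> $ j)\<^sup>2) \<in> borel_measurable M" using meas by measurable
  qed
  show "expectation (\<lambda>\<omega>. L 1 \<omega> $ j) = 0" by (rule centred[OF j])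
  fix s t h :: real
  have proj: "distr M borel (\<lambda>\<omega>. L b \<omega> $ j - L a \<omega> $ j)
      = distr (distr M (vec_borel m) (\<lambda>\<omega>. L b \<omega> - L a \<omega>)) borel (\<lambda>v. v $ j)" for a b
    by (subst distr_distr[OF component_measurable[OF j] vec_borel_diff[OF L_measurable L_measurable]])
       (auto intro!: distr_cong simp: L_diff_index j)
  show "distr M borel (\<lambda>\<omega>. L (t + h) \<omega> $ j - L (s + h) \<omega> $ j) = distr M borel (\<lambda>\<omega>. L t \<omega> $ j - L s \<omega> $ j)"
    unfolding proj using levy by (simp add: levy_process_def)
next
  fix s t u :: real assume st: "s < t" "t < u"
  have inc: "indep_vars (\<lambda>_. vec_borel m)
      (\<lambda>i \<omega>. L ([s, t, u] ! Suc i) \<omega> - L ([s, t, u] ! i) \<omega>) {i. Suc i < length [s, t, u]}"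
    using levy st unfolding levy_process_def by (elim conjE allE[of _ "[s, t, u]"] impE) auto
  let ?X = "\<lambda>i \<omega>. (L ([s, t, u] ! Suc i) \<omega> - L ([s, t, u] ! i) \<omega>) $ j"
  have "indep_vars (\<lambda>_. borel) ?X {i. Suc i < length [s, t, u]}"
    by (rule indep_vars_compose2[OF inc component_measurable[OF j]])
  \<comment> \<open>The family with two indices becomes a pair by restricting it to the index sets
    \<open>{0}\<close> and \<open>{1}\<close> and evaluating there.\<close>
  then have "indep_var (Pi\<^sub>M {0} (\<lambda>_. borel)) (\<lambda>\<omega>. restrict (\<lambda>i. ?X i \<omega>) {0})
      (Pi\<^sub>M {1} (\<lambda>_. borel)) (\<lambda>\<omega>. restrict (\<lambda>i. ?X i \<omega>) {1})"
    by (rule indep_var_restrict) auto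
  from indep_var_compose[OF this, of "\<lambda>f. f 0" borel "\<lambda>f. f 1" borel]
  have ind: "indep_var borel (\<lambda>\<omega>. (L t \<omega> - L s \<omega>) $ j) borel (\<lambda>\<omega>. (L u \<omega> - L t \<omega>) $ j)"
    by (simp add: comp_def measurable_component_singleton)
  \<comment> \<open>The coordinate of a difference is the difference of the coordinates only on
    \<open>space M\<close>, where the dimensions are known; independence is therefore carried over
    through the laws.\<close>
  have d: "distr M borel (\<lambda>\<omega>. (L b \<omega> - L a \<omega>) $ j) = distr M borel (\<lambda>\<omega>. L b \<omega> $ j - L a \<omega> $ j)" for a b
    by (rule distr_cong) (auto simp: L_diff_index j)
  have d2: "distr M (borel \<Otimes>\<^sub>M borel) (\<lambda>\<omega>. ((L t \<omega> - L s \<omega>) $ j, (L u \<omega> - L t \<omega>) $ j))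
      = distr M (borel \<Otimes>\<^sub>M borel) (\<lambda>\<omega>. (L t \<omega> $ j - L s \<omega> $ j, L u \<omega> $ j - L t \<omega> $ j))"
    by (rule distr_cong) (auto simp: L_diff_index j)
  have rv: "(\<lambda>\<omega>. L b \<omega> $ j - L a \<omega> $ j) \<in> borel_measurable M" for a b
    by (intro borel_measurable_diff vec_borel_component[OF L_measurable j])
  show "indep_var borel (\<lambda>\<omega>. L t \<omega> $ j - L s \<omega> $ j) borel (\<lambda>\<omega>. L u \<omega> $ j - L t \<omega> $ j)"
    using ind unfolding indep_var_distribution_eq d d2 using rv by blast
qed

text \<open>The trace of the covariance matrix of \<open>L 1\<close>, used as one bound for the
  variances of all coordinates.\<close>

definition total_var :: real where
  "total_var = (\<Sum>j<m. centred_levy.var_1 M (\<lambda>t \<omega>. L t \<omega> $ j))"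

lemma coordinate_var_le:
  assumes "j < m"
  shows "centred_levy.var_1 M (\<lambda>t \<omega>. L t \<omega> $ j) \<le> total_var"
  unfolding total_var_def
  by (rule member_le_sum[where f = "\<lambda>j. centred_levy.var_1 M (\<lambda>t \<omega>. L t \<omega> $ j)"])
     (use assms centred_levy.var_1_nonneg[OF coordinate] in auto)

lemma sum_list_sum_swap: "(\<Sum>x\<leftarrow>xs. \<Sum>j<k. f x j) = (\<Sum>j<k. \<Sum>x\<leftarrow>xs. f x j)"
  for f :: "'b \<Rightarrow> nat \<Rightarrow> real"
  by (induction xs) (simp_all add: sum.distrib)

lemma step_integral_index:
  assumes ss: "step_list k m ss" and \<omega>: "\<omega> \<in> space M" and i: "i < k"
  shows "step_integral k L ss \<omega> $ i
    = (\<Sum>j<m. \<Sum>(s, t, F)\<leftarrow>ss. F $$ (i, j) * (L t \<omega> $ j - L s \<omega> $ j))"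
proof -
  have "step_integral k L ss \<omega> $ i = (\<Sum>x\<leftarrow>ss. \<Sum>j<m. case x of (s, t, F) \<Rightarrow> F $$ (i, j) * (L t \<omega> $ j - L s \<omega> $ j))"
  proof -
    have "(case x of (s, t, F) \<Rightarrow> (F *\<^sub>v (L t \<omega> - L s \<omega>)) $ i)
        = (\<Sum>j<m. case x of (s, t, F) \<Rightarrow> F $$ (i, j) * (L t \<omega> $ j - L s \<omega> $ j))" if "x \<in> set ss" for x
    proof -
      obtain s t F where x: "x = (s, t, F)" by (cases x)
      then have F: "F \<in> carrier_mat k m" using ss that by (auto simp: step_list_def)
      have D: "L t \<omega> - L s \<omega> \<in> carrier_vec m" using L_carrier[OF \<omega>] by (intro minus_carrier_vec)
      have "(F *\<^sub>v (L t \<omega> - L s \<omega>)) $ i = (\<Sum>j<m. F $$ (i, j) * (L t \<omega> - L s \<omega>) $ j)"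
        by (rule mult_mat_vec_index_sum[OF F D i])
      also have "\<dots> = (\<Sum>j<m. F $$ (i, j) * (L t \<omega> $ j - L s \<omega> $ j))"
        by (intro sum.cong refl) (simp add: L_diff_index[OF \<omega>])
      finally show ?thesis by (simp add: x)
    qed
    then show ?thesis using i by (simp add: step_integral_def cong: map_cong)
  qed
  also have "\<dots> = (\<Sum>j<m. \<Sum>x\<leftarrow>ss. case x of (s, t, F) \<Rightarrow> F $$ (i, j) * (L t \<omega> $ j - L s \<omega> $ j))"
    by (rule sum_list_sum_swap)
  finally show ?thesis .
qed

lemma sum_list_measurable:
  fixes f :: "'b \<Rightarrow> 'c \<Rightarrow> real"
  assumes "\<And>x. x \<in> set xs \<Longrightarrow> f x \<in> borel_measurable N"
  shows "(\<lambda>\<omega>. \<Sum>x\<leftarrow>xs. f x \<omega>) \<in> borel_measurable N"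
  using assms by (induction xs) (auto intro!: borel_measurable_add)

lemma coordinate_sum_measurable:
  assumes "j < m"
  shows "(\<lambda>\<omega>. \<Sum>(s, t, F)\<leftarrow>ss. c F * (L t \<omega> $ j - L s \<omega> $ j)) \<in> borel_measurable M"
  by (rule sum_list_measurable)
     (auto simp: split_beta intro!: borel_measurable_times borel_measurable_diff vec_borel_component[OF L_measurable assms])

lemma step_integral_measurable:
  assumes ss: "step_list k m ss"
  shows "step_integral k L ss \<in> measurable M (vec_borel k)"
proof (rule measurable_vec_borelI)
  show "step_integral k L ss \<omega> \<in> carrier_vec k" for \<omega> by (simp add: step_integral_def)
  fix i assume i: "i < k"
  have "(\<lambda>\<omega>. step_integral k L ss \<omega> $ i) \<in> borel_measurable M \<longleftrightarrow>
      (\<lambda>\<omega>. \<Sum>j<m. \<Sum>(s, t, F)\<leftarrow>ss. F $$ (i, j) * (L t \<omega> $ j - L s \<omega> $ j)) \<in> borel_measurable M"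
    by (rule measurable_cong) (rule step_integral_index[OF ss _ i])
  moreover have "(\<lambda>\<omega>. \<Sum>j<m. \<Sum>(s, t, F)\<leftarrow>ss. F $$ (i, j) * (L t \<omega> $ j - L s \<omega> $ j)) \<in> borel_measurable M"
    by (rule borel_measurable_sum) (rule coordinate_sum_measurable, simp)
  ultimately show "(\<lambda>\<omega>. step_integral k L ss \<omega> $ i) \<in> borel_measurable M" by blast
qed

text \<open>The isometry holds for each coordinate of the noise, but the coordinates may be
  correlated. They are separated by Cauchy-Schwarz at the cost of the factor \<open>m\<close>, and
  an inequality is enough for uniqueness.\<close>

lemma step_integral_bound:
  assumes ss: "step_list k m ss"
  shows "(\<integral>\<^sup>+\<omega>. ennreal (vec_sqnorm (step_integral k L ss \<omega>)) \<partial>M)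
    \<le> of_nat m * ennreal total_var * (\<integral>\<^sup>+u. ennreal (mat_sqnorm (step_fun k m ss u)) \<partial>lborel)"
proof -
  let ?I = "\<lambda>i j \<omega>. \<Sum>(s, t, F)\<leftarrow>ss. F $$ (i, j) * (L t \<omega> $ j - L s \<omega> $ j)"
  let ?f = "\<lambda>i j u. \<Sum>(s, t, F)\<leftarrow>ss. indicator {s<..t} u * F $$ (i, j)"
  have I_meas [measurable]: "?I i j \<in> borel_measurable M" if "j < m" for i j
    using that by (rule coordinate_sum_measurable)
  have f_meas [measurable]: "?f i j \<in> borel_measurable borel" for i j
    by (rule sum_list_measurable) (auto simp: split_beta)
  have iso: "(\<integral>\<^sup>+\<omega>. ennreal ((?I i j \<omega>)\<^sup>2) \<partial>M) \<le> ennreal total_var * (\<integral>\<^sup>+u. ennreal ((?f i j u)\<^sup>2) \<partial>lborel)"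
    if j: "j < m" for i j
  proof -
    have "s \<le> t" if "(s, t, F) \<in> set ss" for s t F
      using ss that by (auto simp: step_list_def)
    from centred_levy.isometry_sum_list[OF coordinate[OF j] this, where c = "\<lambda>F. F $$ (i, j)"]
    show ?thesis using coordinate_var_le[OF j] by (simp add: mult_right_mono ennreal_leI)
  qed
  have "(\<integral>\<^sup>+\<omega>. ennreal (vec_sqnorm (step_integral k L ss \<omega>)) \<partial>M)
      \<le> (\<integral>\<^sup>+\<omega>. (\<Sum>i<k. of_nat m * (\<Sum>j<m. ennreal ((?I i j \<omega>)\<^sup>2))) \<partial>M)"
  proof (rule nn_integral_mono)
    fix \<omega> assume \<omega>: "\<omega> \<in> space M"
    have "vec_sqnorm (step_integral k L ss \<omega>) = (\<Sum>i<k. (step_integral k L ss \<omega> $ i)\<^sup>2)"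
      by (rule vec_sqnorm_sum) (simp add: step_integral_def)
    also have "\<dots> = (\<Sum>i<k. (\<Sum>j<m. ?I i j \<omega>)\<^sup>2)"
      by (intro sum.cong refl) (simp only: step_integral_index[OF ss \<omega>] lessThan_iff)
    finally have "ennreal (vec_sqnorm (step_integral k L ss \<omega>)) = (\<Sum>i<k. ennreal ((\<Sum>j<m. ?I i j \<omega>)\<^sup>2))"
      by (simp only: ennreal_sum_squares)
    also have "\<dots> \<le> (\<Sum>i<k. of_nat m * (\<Sum>j<m. ennreal ((?I i j \<omega>)\<^sup>2)))"
      by (intro sum_mono sum_square_le)
    finally show "ennreal (vec_sqnorm (step_integral k L ss \<omega>))
        \<le> (\<Sum>i<k. of_nat m * (\<Sum>j<m. ennreal ((?I i j \<omega>)\<^sup>2)))" .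
  qed
  also have "\<dots> = (\<Sum>i<k. of_nat m * (\<Sum>j<m. \<integral>\<^sup>+\<omega>. ennreal ((?I i j \<omega>)\<^sup>2) \<partial>M))"
  proof -
    have meas: "(\<lambda>\<omega>. ennreal ((?I i j \<omega>)\<^sup>2)) \<in> borel_measurable M" if "j < m" for i j
      using I_meas[OF that] by measurable
    have inner: "(\<lambda>\<omega>. \<Sum>j<m. ennreal ((?I i j \<omega>)\<^sup>2)) \<in> borel_measurable M" for i
      by (rule borel_measurable_sum) (rule meas, simp)
    have "(\<integral>\<^sup>+\<omega>. (\<Sum>i<k. of_nat m * (\<Sum>j<m. ennreal ((?I i j \<omega>)\<^sup>2))) \<partial>M)
        = (\<Sum>i<k. \<integral>\<^sup>+\<omega>. of_nat m * (\<Sum>j<m. ennreal ((?I i j \<omega>)\<^sup>2)) \<partial>M)"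
    proof (rule nn_integral_sum)
      fix i
      note [measurable] = inner[of i]
      show "(\<lambda>\<omega>. of_nat m * (\<Sum>j<m. ennreal ((?I i j \<omega>)\<^sup>2))) \<in> borel_measurable M" by measurable
    qed
    also have "\<dots> = (\<Sum>i<k. of_nat m * (\<integral>\<^sup>+\<omega>. (\<Sum>j<m. ennreal ((?I i j \<omega>)\<^sup>2)) \<partial>M))"
      by (rule sum.cong[OF refl], rule nn_integral_cmult) (rule inner)
    also have "\<dots> = (\<Sum>i<k. of_nat m * (\<Sum>j<m. \<integral>\<^sup>+\<omega>. ennreal ((?I i j \<omega>)\<^sup>2) \<partial>M))"
      by (rule sum.cong[OF refl], subst nn_integral_sum) (rule meas, simp, rule refl)
    finally show ?thesis .
  qed
  also have "\<dots> \<le> (\<Sum>i<k. of_nat m * (\<Sum>j<m. ennreal total_var * (\<integral>\<^sup>+u. ennreal ((?f i j u)\<^sup>2) \<partial>lborel)))"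
    by (intro sum_mono mult_left_mono iso) auto
  also have "\<dots> = of_nat m * ennreal total_var * (\<Sum>i<k. \<Sum>j<m. \<integral>\<^sup>+u. ennreal ((?f i j u)\<^sup>2) \<partial>lborel)"
    by (simp add: sum_distrib_left mult.assoc)
  also have "(\<Sum>i<k. \<Sum>j<m. \<integral>\<^sup>+u. ennreal ((?f i j u)\<^sup>2) \<partial>lborel)
      = (\<integral>\<^sup>+u. (\<Sum>i<k. \<Sum>j<m. ennreal ((?f i j u)\<^sup>2)) \<partial>lborel)"
  proof -
    have meas: "(\<lambda>u. ennreal ((?f i j u)\<^sup>2)) \<in> borel_measurable lborel" for i j
      using f_meas by measurable
    show ?thesis
      by (subst nn_integral_sum, rule borel_measurable_sum, rule meas,
          rule sum.cong[OF refl], subst nn_integral_sum) (rule meas, rule refl)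
  qed
  also have "\<dots> = (\<integral>\<^sup>+u. ennreal (mat_sqnorm (step_fun k m ss u)) \<partial>lborel)"
  proof (rule nn_integral_cong)
    fix u :: real
    have "mat_sqnorm (step_fun k m ss u) = (\<Sum>i<k. \<Sum>j<m. (?f i j u)\<^sup>2)"
      by (subst mat_sqnorm_sum[of _ k m]) (auto simp: step_fun_def intro!: sum.cong)
    then show "(\<Sum>i<k. \<Sum>j<m. ennreal ((?f i j u)\<^sup>2)) = ennreal (mat_sqnorm (step_fun k m ss u))"
      by (simp add: sum_ennreal sum_nonneg)
  qed
  finally show ?thesis .
qed

section \<open>Differences of step functions and uniqueness\<close>

lemma step_fun_measurable:
  "i < k \<Longrightarrow> j < m \<Longrightarrow> (\<lambda>u. step_fun k m ss u $$ (i, j)) \<in> borel_measurable borel"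
  unfolding step_fun_def by (simp, rule sum_list_measurable) (auto simp: split_beta)

text \<open>Intervals in a step list may overlap, so concatenation adds step functions and their
  integrals; with the matrices negated it represents differences.\<close>

definition neg_steps :: "step list \<Rightarrow> step list" where
  "neg_steps ss = map (\<lambda>(s, t, F). (s, t, - F)) ss"

lemma neg_steps_list: "step_list k m ss \<Longrightarrow> step_list k m (neg_steps ss)"
  by (auto simp: step_list_def neg_steps_def)

lemma step_integral_diff:
  assumes ss: "step_list k m ss" "step_list k m ss'" and \<omega>: "\<omega> \<in> space M"
  shows "step_integral k L (ss @ neg_steps ss') \<omega> = step_integral k L ss \<omega> - step_integral k L ss' \<omega>"
proof (rule eq_vecI)
  fix i assume "i < dim_vec (step_integral k L ss \<omega> - step_integral k L ss' \<omega>)"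
  then have i: "i < k" by (simp add: step_integral_def)
  have "(case x of (s, t, F) \<Rightarrow> ((- F) *\<^sub>v (L t \<omega> - L s \<omega>)) $ i) = - (case x of (s, t, F) \<Rightarrow> (F *\<^sub>v (L t \<omega> - L s \<omega>)) $ i)"
    if "x \<in> set ss'" for x
  proof -
    obtain s t F where x: "x = (s, t, F)" by (cases x)
    then have F: "F \<in> carrier_mat k m" using ss(2) that by (auto simp: step_list_def)
    have D: "L t \<omega> - L s \<omega> \<in> carrier_vec m" using L_carrier[OF \<omega>] by (intro minus_carrier_vec)
    have "- F \<in> carrier_mat k m" using F by simp
    from mult_mat_vec_index_sum[OF this D i] mult_mat_vec_index_sum[OF F D i] F i
    show ?thesis by (simp add: x sum_negf del: index_mult_mat_vec)
  qed
  then have "(\<Sum>(s, t, F)\<leftarrow>neg_steps ss'. (F *\<^sub>v (L t \<omega> - L s \<omega>)) $ i) = - (\<Sum>(s, t, F)\<leftarrow>ss'. (F *\<^sub>v (L t \<omega> - L s \<omega>)) $ i)"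
    by (simp add: neg_steps_def comp_def split_beta uminus_sum_list_map cong: map_cong)
  then show "step_integral k L (ss @ neg_steps ss') \<omega> $ i = (step_integral k L ss \<omega> - step_integral k L ss' \<omega>) $ i"
    using i by (simp add: step_integral_def)
qed (simp add: step_integral_def)

lemma step_fun_diff:
  assumes ss: "step_list k m ss" "step_list k m ss'" 
  shows "step_fun k m (ss @ neg_steps ss') u = step_fun k m ss u - step_fun k m ss' u"
proof (rule eq_matI)
  fix i j assume "i < dim_row (step_fun k m ss u - step_fun k m ss' u)" "j < dim_col (step_fun k m ss u - step_fun k m ss' u)"
  then have ij: "i < k" "j < m" by (auto simp: step_fun_def)
  have "(case x of (s, t, F) \<Rightarrow> indicator {s<..t} u * (- F) $$ (i, j)) = - (case x of (s, t, F) \<Rightarrow> indicator {s<..t} u * F $$ (i, j))"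
    if "x \<in> set ss'" for x :: step
  proof -
    obtain s t F where x: "x = (s, t, F)" by (cases x)
    then have F: "F \<in> carrier_mat k m" using ss(2) that by (auto simp: step_list_def)
    show ?thesis using F ij by (simp add: x)
  qed
  then have "(\<Sum>(s, t, F)\<leftarrow>neg_steps ss'. indicator {s<..t} u * F $$ (i, j)) = - (\<Sum>(s, t, F)\<leftarrow>ss'. indicator {s<..t} u * F $$ (i, j))"
    by (simp add: neg_steps_def comp_def split_beta uminus_sum_list_map cong: map_cong)
  then show "step_fun k m (ss @ neg_steps ss') u $$ (i, j) = (step_fun k m ss u - step_fun k m ss' u) $$ (i, j)"
    using ij by (simp add: step_fun_def)
qed (simp_all add: step_fun_def)

lemma vec_sqnorm_measurable:
  assumes "Z \<in> measurable M (vec_borel k)"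
  shows "(\<lambda>\<omega>. ennreal (vec_sqnorm (Z \<omega>))) \<in> borel_measurable M"
proof -
  have "(\<lambda>\<omega>. ennreal (vec_sqnorm (Z \<omega>))) \<in> borel_measurable M \<longleftrightarrow> (\<lambda>\<omega>. ennreal (\<Sum>i<k. (Z \<omega> $ i)\<^sup>2)) \<in> borel_measurable M"
    by (rule measurable_cong) (simp add: vec_sqnorm_sum[OF vec_borel_carrier[OF assms]])
  moreover have "(\<lambda>\<omega>. ennreal (\<Sum>i<k. (Z \<omega> $ i)\<^sup>2)) \<in> borel_measurable M"
    by (rule measurable_compose[OF borel_measurable_sum measurable_ennreal])
       (rule borel_measurable_power, rule vec_borel_component[OF assms], simp)
  ultimately show ?thesis by blast
qed

text \<open>Two approximating sequences of step functions can be subtracted, so the bound above applies to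
  the difference of their integrals.\<close>

lemma has_levy_integral_unique:
  assumes Z: "has_levy_integral M k m L f Z" and Z': "has_levy_integral M k m L f Z'"
  shows "AE \<omega> in M. Z \<omega> = Z' \<omega>"
proof -
  have Zm: "Z \<in> measurable M (vec_borel k)" and Zm': "Z' \<in> measurable M (vec_borel k)"
    and fc: "\<And>u. f u \<in> carrier_mat k m"
    and fm: "\<And>i j. i < k \<Longrightarrow> j < m \<Longrightarrow> (\<lambda>u. f u $$ (i, j)) \<in> borel_measurable borel"
    using Z Z' by (auto simp: has_levy_integral_def)
  let ?d = "\<lambda>S n. \<integral>\<^sup>+u. ennreal (mat_sqnorm (step_fun k m (S n) u - f u)) \<partial>lborel"
  let ?e = "\<lambda>S Z n. \<integral>\<^sup>+\<omega>. ennreal (vec_sqnorm (step_integral k L (S n) \<omega> - Z \<omega>)) \<partial>M"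
  obtain S where S: "\<And>n. step_list k m (S n)" "?d S \<longlonglongrightarrow> 0" "?e S Z \<longlonglongrightarrow> 0"
    using Z by (auto simp: has_levy_integral_def)
  obtain S' where S': "\<And>n. step_list k m (S' n)" "?d S' \<longlonglongrightarrow> 0" "?e S' Z' \<longlonglongrightarrow> 0"
    using Z' by (auto simp: has_levy_integral_def)
  define c where "c = of_nat m * ennreal total_var"
  have c: "c < \<infinity>" by (simp add: c_def ennreal_mult_less_top ennreal_of_nat_eq_real_of_nat)
  \<comment> \<open>Two applications of \<open>square_add_le\<close>, first at \<open>y\<close> and
    then at \<open>y'\<close>; the first term would need only the constant 2 and is enlarged for
    symmetry.\<close>
  have sq3: "ennreal ((x - z)\<^sup>2) \<le> 4 * ennreal ((y - x)\<^sup>2) + 4 * ennreal ((y - y')\<^sup>2) + 4 * ennreal ((y' - z)\<^sup>2)" for x y y' z :: real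
  proof -
    have "(x - z)\<^sup>2 \<le> 4 * (y - x)\<^sup>2 + 4 * (y - y')\<^sup>2 + 4 * (y' - z)\<^sup>2"
      using square_add_le[of "x - y" "y - z"] square_add_le[of "y - y'" "y' - z"] zero_le_power2[of "y - x"]
        power2_commute[of x y] by (simp only: diff_add_cancel add_diff_eq)
    then have "ennreal ((x - z)\<^sup>2) \<le> ennreal (4 * (y - x)\<^sup>2 + 4 * (y - y')\<^sup>2 + 4 * (y' - z)\<^sup>2)" by (rule ennreal_leI)
    then show ?thesis by (simp add: ennreal_plus ennreal_mult)
  qed
  have vec3: "ennreal (vec_sqnorm (x - z)) \<le> 4 * ennreal (vec_sqnorm (y - x)) + 4 * ennreal (vec_sqnorm (y - y')) + 4 * ennreal (vec_sqnorm (y' - z))"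
    if "x \<in> carrier_vec k" "y \<in> carrier_vec k" "y' \<in> carrier_vec k" "z \<in> carrier_vec k" for x y y' z
  proof -
    have n: "ennreal (vec_sqnorm (a - b)) = (\<Sum>i<k. ennreal ((a $ i - b $ i)\<^sup>2))" if "a \<in> carrier_vec k" "b \<in> carrier_vec k" for a b
      using that by (subst vec_sqnorm_sum[of _ k]) (auto simp flip: ennreal_sum_squares)
    show ?thesis
      unfolding n[OF that(1,4)] n[OF that(2,1)] n[OF that(2,3)] n[OF that(3,4)] sum_distrib_left sum.distrib[symmetric]
      by (rule sum_mono) (rule sq3)
  qed
  have mat2: "ennreal (mat_sqnorm (F - G)) \<le> 2 * ennreal (mat_sqnorm (F - H)) + 2 * ennreal (mat_sqnorm (G - H))"
    if "F \<in> carrier_mat k m" "G \<in> carrier_mat k m" "H \<in> carrier_mat k m" for F G H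
  proof -
    have n: "ennreal (mat_sqnorm (F - G)) = (\<Sum>i<k. \<Sum>j<m. ennreal ((F $$ (i, j) - G $$ (i, j))\<^sup>2))"
      if "F \<in> carrier_mat k m" "G \<in> carrier_mat k m" for F G
      using that by (subst mat_sqnorm_sum[of _ k m]) (auto simp: sum_ennreal sum_nonneg intro!: sum.cong)
    have le: "ennreal ((x - y)\<^sup>2) \<le> 2 * ennreal ((x - z)\<^sup>2) + 2 * ennreal ((y - z)\<^sup>2)" for x y z :: real
      using ennreal_square_add_le[of "x - z" "y - z"] by simp
    show ?thesis
      unfolding n[OF that(1,2)] n[OF that(1,3)] n[OF that(2,3)] sum_distrib_left sum.distrib[symmetric]
      by (rule sum_mono, rule sum_mono, rule le)
  qed
  have sfc: "step_fun k m ss u \<in> carrier_mat k m" for ss u by (simp add: step_fun_def)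
  have d_meas: "(\<lambda>u. ennreal (mat_sqnorm (step_fun k m ss u - f u))) \<in> borel_measurable lborel" for ss
  proof -
    have "(\<lambda>u. ennreal (mat_sqnorm (step_fun k m ss u - f u)))
        = (\<lambda>u. ennreal (\<Sum>i<k. \<Sum>j<m. (step_fun k m ss u $$ (i, j) - f u $$ (i, j))\<^sup>2))"
      using sfc fc by (intro ext, subst mat_sqnorm_sum[of _ k m]) (auto intro!: sum.cong simp: carrier_matD[OF fc])
    moreover have "(\<lambda>u. \<Sum>i<k. \<Sum>j<m. (step_fun k m ss u $$ (i, j) - f u $$ (i, j))\<^sup>2) \<in> borel_measurable borel"
      by (intro borel_measurable_sum borel_measurable_power borel_measurable_diff step_fun_measurable fm) auto
    ultimately show ?thesis by simp
  qed
  \<comment> \<open>\<open>Z\<close> and \<open>Z'\<close> are compared through the two step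
    integrals. The distance between these is controlled by that of the step functions, which are
    both close to \<open>f\<close>.\<close>
  have bound: "(\<integral>\<^sup>+\<omega>. ennreal (vec_sqnorm (Z \<omega> - Z' \<omega>)) \<partial>M)
      \<le> 4 * ?e S Z n + 4 * (c * (2 * ?d S n + 2 * ?d S' n)) + 4 * ?e S' Z' n" for n
  proof -
    let ?I = "step_integral k L (S n)" and ?I' = "step_integral k L (S' n)"
    have I: "?I \<in> measurable M (vec_borel k)" "?I' \<in> measurable M (vec_borel k)"
      using S(1) S'(1) by (auto intro: step_integral_measurable)
    note meas = vec_sqnorm_measurable[OF vec_borel_diff]
    have "(\<integral>\<^sup>+\<omega>. ennreal (vec_sqnorm (Z \<omega> - Z' \<omega>)) \<partial>M)
        \<le> (\<integral>\<^sup>+\<omega>. 4 * ennreal (vec_sqnorm (?I \<omega> - Z \<omega>)) + 4 * ennreal (vec_sqnorm (?I \<omega> - ?I' \<omega>))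
          + 4 * ennreal (vec_sqnorm (?I' \<omega> - Z' \<omega>)) \<partial>M)"
      using vec_borel_carrier[OF Zm] vec_borel_carrier[OF Zm'] vec_borel_carrier[OF I(1)] vec_borel_carrier[OF I(2)]
      by (intro nn_integral_mono vec3) auto
    also have "\<dots> = 4 * ?e S Z n + 4 * (\<integral>\<^sup>+\<omega>. ennreal (vec_sqnorm (?I \<omega> - ?I' \<omega>)) \<partial>M) + 4 * ?e S' Z' n"
      by (rule nn_integral_linear3[OF meas[OF I(1) Zm] meas[OF I] meas[OF I(2) Zm']])
    finally have L: "(\<integral>\<^sup>+\<omega>. ennreal (vec_sqnorm (Z \<omega> - Z' \<omega>)) \<partial>M)
        \<le> 4 * ?e S Z n + 4 * (\<integral>\<^sup>+\<omega>. ennreal (vec_sqnorm (?I \<omega> - ?I' \<omega>)) \<partial>M) + 4 * ?e S' Z' n" .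
    have "(\<integral>\<^sup>+\<omega>. ennreal (vec_sqnorm (?I \<omega> - ?I' \<omega>)) \<partial>M)
        = (\<integral>\<^sup>+\<omega>. ennreal (vec_sqnorm (step_integral k L (S n @ neg_steps (S' n)) \<omega>)) \<partial>M)"
      by (intro nn_integral_cong) (simp add: step_integral_diff[OF S(1) S'(1)])
    also have "\<dots> \<le> c * (\<integral>\<^sup>+u. ennreal (mat_sqnorm (step_fun k m (S n @ neg_steps (S' n)) u)) \<partial>lborel)"
      unfolding c_def
      by (rule step_integral_bound)
         (use S(1)[of n] neg_steps_list[OF S'(1)[of n]] in \<open>simp only: step_list_def set_append ball_Un simp_thms\<close>)
    finally have I_le: "(\<integral>\<^sup>+\<omega>. ennreal (vec_sqnorm (?I \<omega> - ?I' \<omega>)) \<partial>M)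
        \<le> c * (\<integral>\<^sup>+u. ennreal (mat_sqnorm (step_fun k m (S n @ neg_steps (S' n)) u)) \<partial>lborel)" .
    have "(\<integral>\<^sup>+u. ennreal (mat_sqnorm (step_fun k m (S n @ neg_steps (S' n)) u)) \<partial>lborel)
        \<le> (\<integral>\<^sup>+u. 2 * ennreal (mat_sqnorm (step_fun k m (S n) u - f u)) + 2 * ennreal (mat_sqnorm (step_fun k m (S' n) u - f u)) \<partial>lborel)"
      unfolding step_fun_diff[OF S(1) S'(1)] by (intro nn_integral_mono mat2 sfc fc)
    also have "\<dots> = 2 * ?d S n + 2 * ?d S' n"
      by (rule nn_integral_linear[OF d_meas d_meas])
    finally have f_le: "(\<integral>\<^sup>+u. ennreal (mat_sqnorm (step_fun k m (S n @ neg_steps (S' n)) u)) \<partial>lborel)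
        \<le> 2 * ?d S n + 2 * ?d S' n" .
    show ?thesis
      by (rule order_trans[OF L], rule add_right_mono, rule add_left_mono, rule mult_left_mono,
          rule order_trans[OF I_le], rule mult_left_mono, rule f_le) simp_all
  qed
  have "(\<lambda>n. 4 * ?e S Z n + 4 * (c * (2 * ?d S n + 2 * ?d S' n)) + 4 * ?e S' Z' n)
      \<longlonglongrightarrow> 4 * 0 + 4 * (c * (2 * 0 + 2 * 0)) + 4 * 0"
    using c S S' by (intro tendsto_add ennreal_tendsto_cmult) auto
  then have "(\<integral>\<^sup>+\<omega>. ennreal (vec_sqnorm (Z \<omega> - Z' \<omega>)) \<partial>M) \<le> 0"
    by (intro tendsto_lowerbound[where F = sequentially]) (use bound in auto)
  then have "AE \<omega> in M. ennreal (vec_sqnorm (Z \<omega> - Z' \<omega>)) = 0"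
    using nn_integral_0_iff_AE[OF vec_sqnorm_measurable[OF vec_borel_diff[OF Zm Zm']]] by simp
  then show ?thesis
    using AE_space
  proof eventually_elim
    case (elim \<omega>)
    have zc: "Z \<omega> \<in> carrier_vec k" "Z' \<omega> \<in> carrier_vec k"
      using elim vec_borel_carrier[OF Zm] vec_borel_carrier[OF Zm'] by auto
    then have s: "vec_sqnorm (Z \<omega> - Z' \<omega>) = (\<Sum>i<k. (Z \<omega> $ i - Z' \<omega> $ i)\<^sup>2)"
      by (subst vec_sqnorm_sum[of _ k]) auto
    moreover have "vec_sqnorm (Z \<omega> - Z' \<omega>) \<le> 0" using elim(1) by (simp add: ennreal_eq_0_iff)
    ultimately have "(\<Sum>i<k. (Z \<omega> $ i - Z' \<omega> $ i)\<^sup>2) = 0"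
      by (intro antisym sum_nonneg) auto
    then have "\<forall>i<k. Z \<omega> $ i = Z' \<omega> $ i" by (simp add: sum_nonneg_eq_0_iff)
    then show ?case using zc by (intro eq_vecI) auto
  qed
qed

end

section \<open>The state process\<close>

definition exp_kernel :: "real mat \<Rightarrow> real mat \<Rightarrow> nat \<Rightarrow> nat \<Rightarrow> real \<Rightarrow> real" where
  "exp_kernel A B i j s = (mat_exp (s \<cdot>\<^sub>m A) * B) $$ (i, j)"

lemma exp_kernel_sum:
  assumes "A \<in> carrier_mat n n" "B \<in> carrier_mat n m" "i < n" "j < m"
  shows "exp_kernel A B i j s = (\<Sum>l<n. mat_exp (s \<cdot>\<^sub>m A) $$ (i, l) * B $$ (l, j))"
  unfolding exp_kernel_def using assms by (intro index_mult_mat_sum) auto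

lemma exp_kernel_0:
  assumes A: "A \<in> carrier_mat n n" and B: "B \<in> carrier_mat n m" and "i < n" "j < m"
  shows "exp_kernel A B i j 0 = B $$ (i, j)"
  using B by (simp add: exp_kernel_def mat_exp_zero[OF A])

lemma exp_kernel_intertwine:
  assumes A: "A \<in> carrier_mat n n" and A': "A' \<in> carrier_mat n' n'" and T: "T \<in> carrier_mat n n'"
    and eq: "T * A' = A * T" and B: "B \<in> carrier_mat n' m" and ij: "i < n" "j < m"
  shows "(\<Sum>l<n'. T $$ (i, l) * exp_kernel A' B l j s) = exp_kernel A (T * B) i j s"
proof -
  have E: "mat_exp (s \<cdot>\<^sub>m A) \<in> carrier_mat n n" "mat_exp (s \<cdot>\<^sub>m A') \<in> carrier_mat n' n'"
    using A A' by auto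
  have "(\<Sum>l<n'. T $$ (i, l) * exp_kernel A' B l j s) = (T * (mat_exp (s \<cdot>\<^sub>m A') * B)) $$ (i, j)"
    unfolding exp_kernel_def
    by (rule index_mult_mat_sum[OF T mult_carrier_mat[OF E(2) B] ij, symmetric])
  also have "T * (mat_exp (s \<cdot>\<^sub>m A') * B) = (T * mat_exp (s \<cdot>\<^sub>m A')) * B"
    by (rule assoc_mult_mat[OF T E(2) B, symmetric])
  also have "\<dots> = (mat_exp (s \<cdot>\<^sub>m A) * T) * B"
    by (simp only: mat_exp_intertwine[OF A A' T eq])
  also have "\<dots> = mat_exp (s \<cdot>\<^sub>m A) * (T * B)"
    by (rule assoc_mult_mat[OF E(1) T B])
  finally show ?thesis by (simp only: exp_kernel_def)
qed

text \<open>\<open>A\<close> commutes with its exponential, so differentiation only replaces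
  \<open>B\<close> by \<open>A * B\<close>. Derivatives of kernels are kernels again and inherit
  continuity and decay.\<close>

lemma exp_kernel_deriv:
  assumes A: "A \<in> carrier_mat n n" and B: "B \<in> carrier_mat n m" and ij: "i < n" "j < m"
  shows "(exp_kernel A B i j has_real_derivative exp_kernel A (A * B) i j s) (at s)"
proof -
  have E: "mat_exp (s \<cdot>\<^sub>m A) \<in> carrier_mat n n" using A by auto
  have "((\<lambda>s. \<Sum>l<n. mat_exp (s \<cdot>\<^sub>m A) $$ (i, l) * B $$ (l, j)) has_real_derivative
      (\<Sum>l<n. (A * mat_exp (s \<cdot>\<^sub>m A)) $$ (i, l) * B $$ (l, j))) (at s)"
    by (intro DERIV_sum DERIV_cmult_right has_real_derivative_mat_exp[OF A ij(1)]) simp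
  moreover have "(\<Sum>l<n. (A * mat_exp (s \<cdot>\<^sub>m A)) $$ (i, l) * B $$ (l, j)) = exp_kernel A (A * B) i j s"
  proof -
    have "(\<Sum>l<n. (A * mat_exp (s \<cdot>\<^sub>m A)) $$ (i, l) * B $$ (l, j)) = ((A * mat_exp (s \<cdot>\<^sub>m A)) * B) $$ (i, j)"
      by (rule index_mult_mat_sum[OF mult_carrier_mat[OF A E] B ij, symmetric])
    also have "\<dots> = (A * (mat_exp (s \<cdot>\<^sub>m A) * B)) $$ (i, j)"
      by (simp only: assoc_mult_mat[OF A E B])
    also have "\<dots> = (\<Sum>l<n. A $$ (i, l) * exp_kernel A B l j s)"
      unfolding exp_kernel_def by (rule index_mult_mat_sum[OF A mult_carrier_mat[OF E B] ij])
    also have "\<dots> = exp_kernel A (A * B) i j s"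
      by (rule exp_kernel_intertwine[OF A A A refl B ij])
    finally show ?thesis .
  qed
  moreover have "exp_kernel A B i j = (\<lambda>s. \<Sum>l<n. mat_exp (s \<cdot>\<^sub>m A) $$ (i, l) * B $$ (l, j))"
    using exp_kernel_sum[OF A B ij] by (intro ext)
  ultimately show ?thesis by simp
qed

lemma exp_kernel_continuous:
  assumes "A \<in> carrier_mat n n" "B \<in> carrier_mat n m" "i < n" "j < m"
  shows "continuous_on UNIV (exp_kernel A B i j)"
  using exp_kernel_deriv[OF assms] by (meson DERIV_isCont continuous_at_imp_continuous_on)

lemma exp_kernel_measurable:
  assumes "A \<in> carrier_mat n n" "B \<in> carrier_mat n m" "i < n" "j < m"
  shows "exp_kernel A B i j \<in> borel_measurable borel"
  using exp_kernel_continuous[OF assms] by (rule borel_measurable_continuous_onI)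

lemma exp_kernel_decays:
  assumes A: "A \<in> carrier_mat n n" and B: "B \<in> carrier_mat n m" and ij: "i < n" "j < m"
    and dec: "\<And>i l. i < n \<Longrightarrow> l < n \<Longrightarrow> decays a (\<lambda>s. mat_exp (s \<cdot>\<^sub>m A) $$ (i, l))"
  shows "decays a (exp_kernel A B i j)"
proof -
  have "exp_kernel A B i j = (\<lambda>s. \<Sum>l<n. B $$ (l, j) * mat_exp (s \<cdot>\<^sub>m A) $$ (i, l))"
    using exp_kernel_sum[OF A B ij] by (intro ext) (simp add: mult.commute)
  then show ?thesis using decays_sum[of "{..<n}" a "\<lambda>l s. mat_exp (s \<cdot>\<^sub>m A) $$ (i, l)" "\<lambda>l. B $$ (l, j)"] dec ij by simp
qed

text \<open>As an indefinite integral \<open>x\<close> is continuous on \<open>{t..t + 1}\<close>,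
  and rationals in this interval approach \<open>t\<close> from the right.\<close>

lemma vanishing_on_rationals:
  fixes x :: "real \<Rightarrow> real"
  assumes int: "\<And>s t. s \<le> t \<Longrightarrow> set_integrable lborel {s..t} h"
    and eq: "\<And>s t. s \<le> t \<Longrightarrow> x t = x s + (LINT u:{s..t}|lborel. h u)"
    and zero: "\<And>q :: rat. x (of_rat q) = 0"
  shows "x t = 0"
proof -
  have x: "x r = x t + integral {t..r} h" if "r \<in> {t..t + 1}" for r
  proof -
    have "t \<le> r" using that by simp
    from eq[OF this] set_borel_integral_eq_integral(2)[OF int[OF this]] show ?thesis by (simp only:)
  qed
  have "continuous_on {t..t + 1} (\<lambda>r. integral {t..r} h)"
    by (rule indefinite_integral_continuous_1[OF set_borel_integral_eq_integral(1)[OF int]]) simp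
  then have "continuous_on {t..t + 1} (\<lambda>r. x t + integral {t..r} h)"
    by (rule continuous_on_add[OF continuous_on_const])
  then have cont: "continuous_on {t..t + 1} x"
    by (rule continuous_on_eq) (rule x[symmetric])
  have "\<forall>n. \<exists>q. t < of_rat q \<and> of_rat q < t + 1 / real (Suc n)"
    by (rule allI, rule of_rat_dense) simp
  from choice[OF this] obtain q where "\<forall>n. t < of_rat (q n) \<and> of_rat (q n) < t + 1 / real (Suc n)"
    by (elim exE)
  then have q: "t < of_rat (q n)" "of_rat (q n) < t + 1 / real (Suc n)" for n by simp_all
  have "(\<lambda>n. of_rat (q n) :: real) \<longlonglongrightarrow> t"
  proof (rule tendsto_sandwich[of "\<lambda>_. t" _ _ "\<lambda>n. t + 1 / real (Suc n)"])
    show "(\<lambda>n. t + 1 / real (Suc n)) \<longlonglongrightarrow> t"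
      using tendsto_add[OF tendsto_const LIMSEQ_inverse_real_of_nat, of t] by (simp add: inverse_eq_divide)
    show "\<forall>\<^sub>F n in sequentially. t \<le> of_rat (q n)"
      by (rule always_eventually, rule allI, rule less_imp_le, rule q)
    show "\<forall>\<^sub>F n in sequentially. of_rat (q n) \<le> t + 1 / real (Suc n)"
      by (rule always_eventually, rule allI, rule less_imp_le, rule q)
  qed (rule tendsto_const)
  moreover have q_mem: "of_rat (q n) \<in> {t..t + 1}" for n
  proof -
    have "1 / real (Suc n) \<le> 1" by simp
    then show ?thesis using q(1)[of n] q(2)[of n] unfolding atLeastAtMost_iff by linarith
  qed
  ultimately have "(\<lambda>n. x (of_rat (q n))) \<longlonglongrightarrow> x t"
    by (intro continuous_on_tendsto_compose[OF cont] always_eventually allI) simp_all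
  then have "(\<lambda>n. 0) \<longlonglongrightarrow> x t" by (simp only: zero)
  then show ?thesis by (rule LIMSEQ_unique[OF _ tendsto_const])
qed

section \<open>Uniqueness and construction of the state process\<close>

context centred_levy_vec
begin

lemma state_process_unique:
  assumes A: "A \<in> carrier_mat N N" and B: "B \<in> carrier_mat N m"
    and X: "state_process M L A B X" and X': "state_process M L A B X'"
  shows "AE \<omega> in M. \<forall>t. X t \<omega> = X' t \<omega>"
proof -
  have dims: "dim_row A = N" "dim_col B = m" using A B by auto
  note Xd = X[unfolded state_process_def dims] and Xd' = X'[unfolded state_process_def dims]
  have I: "has_levy_integral M N m L
        (\<lambda>u. if u \<le> t then mat_exp ((t - u) \<cdot>\<^sub>m A) * B else 0\<^sub>m N m) (X t)"
    and I': "has_levy_integral M N m L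
        (\<lambda>u. if u \<le> t then mat_exp ((t - u) \<cdot>\<^sub>m A) * B else 0\<^sub>m N m) (X' t)" for t
    by (rule Xd[THEN conjunct2, THEN spec], rule Xd'[THEN conjunct2, THEN spec])
  have Xm: "X t \<in> measurable M (vec_borel N)" "X' t \<in> measurable M (vec_borel N)" for t
    using I[of t] I'[of t] by (auto simp: has_levy_integral_def)
  have eq: "AE \<omega> in M. X t \<omega> = X' t \<omega>" for t
    by (rule has_levy_integral_unique[OF I I'])
  have ae_q: "AE \<omega> in M. \<forall>q :: rat. X (of_rat q) \<omega> = X' (of_rat q) \<omega>"
    unfolding AE_all_countable by (rule allI, rule eq)
  have se: "AE \<omega> in M. \<forall>s t. s \<le> t \<longrightarrow>
        (\<forall>i<N. set_integrable lborel {s..t} (\<lambda>u. (A *\<^sub>v X u \<omega>) $ i)) \<and>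
        X t \<omega> = X s \<omega> + vec N (\<lambda>i. LINT u:{s..t}|lborel. (A *\<^sub>v X u \<omega>) $ i) + B *\<^sub>v (L t \<omega> - L s \<omega>)"
    and se': "AE \<omega> in M. \<forall>s t. s \<le> t \<longrightarrow>
        (\<forall>i<N. set_integrable lborel {s..t} (\<lambda>u. (A *\<^sub>v X' u \<omega>) $ i)) \<and>
        X' t \<omega> = X' s \<omega> + vec N (\<lambda>i. LINT u:{s..t}|lborel. (A *\<^sub>v X' u \<omega>) $ i) + B *\<^sub>v (L t \<omega> - L s \<omega>)"
    by (rule Xd[THEN conjunct1, unfolded state_equation_def dims],
        rule Xd'[THEN conjunct1, unfolded state_equation_def dims])
  show ?thesis
    using ae_q se se' AE_space
  proof eventually_elim
    case (elim \<omega>)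
    have c: "X t \<omega> \<in> carrier_vec N" "X' t \<omega> \<in> carrier_vec N" for t
      using vec_borel_carrier[OF Xm(1) elim(4)] vec_borel_carrier[OF Xm(2) elim(4)] by auto
    have BL: "B *\<^sub>v (L t \<omega> - L s \<omega>) \<in> carrier_vec N" for s t
      by (rule mult_mat_vec_carrier[OF B minus_carrier_vec[OF L_carrier[OF elim(4)] L_carrier[OF elim(4)]]])
    show ?case
    proof
      fix t
      show "X t \<omega> = X' t \<omega>"
      proof (rule eq_vecI)
        fix i assume "i < dim_vec (X' t \<omega>)"
        then have i: "i < N" using carrier_vecD[OF c(2)[of t]] by simp
        \<comment> \<open>The noise term is the same in both state equations and cancels, so the
          difference of the two states is an integral of \<open>?h\<close>.\<close>
        let ?h = "\<lambda>u. (A *\<^sub>v X u \<omega>) $ i - (A *\<^sub>v X' u \<omega>) $ i"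
        have "X t \<omega> $ i - X' t \<omega> $ i = 0"
        proof (rule vanishing_on_rationals[of ?h "\<lambda>t. X t \<omega> $ i - X' t \<omega> $ i"])
          fix s t :: real assume st: "s \<le> t"
          note e2 = elim(2)[THEN spec, THEN spec, THEN mp, OF st]
            and e3 = elim(3)[THEN spec, THEN spec, THEN mp, OF st]
          have h: "set_integrable lborel {s..t} (\<lambda>u. (A *\<^sub>v X u \<omega>) $ i)"
            "set_integrable lborel {s..t} (\<lambda>u. (A *\<^sub>v X' u \<omega>) $ i)"
            by (rule e2[THEN conjunct1, THEN spec, THEN mp, OF i], rule e3[THEN conjunct1, THEN spec, THEN mp, OF i])
          then show "set_integrable lborel {s..t} ?h" by (rule set_integral_diff(1))
          have 1: "X t \<omega> $ i = X s \<omega> $ i + (LINT u:{s..t}|lborel. (A *\<^sub>v X u \<omega>) $ i) + (B *\<^sub>v (L t \<omega> - L s \<omega>)) $ i"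
          proof -
            from arg_cong[OF e2[THEN conjunct2], of "\<lambda>v. v $ i"] show ?thesis
              using i c[of s] carrier_vecD[OF BL[of t s]] by (simp del: index_mult_mat_vec)
          qed
          have 2: "X' t \<omega> $ i = X' s \<omega> $ i + (LINT u:{s..t}|lborel. (A *\<^sub>v X' u \<omega>) $ i) + (B *\<^sub>v (L t \<omega> - L s \<omega>)) $ i"
          proof -
            from arg_cong[OF e3[THEN conjunct2], of "\<lambda>v. v $ i"] show ?thesis
              using i c[of s] carrier_vecD[OF BL[of t s]] by (simp del: index_mult_mat_vec)
          qed
          show "X t \<omega> $ i - X' t \<omega> $ i = X s \<omega> $ i - X' s \<omega> $ i + (LINT u:{s..t}|lborel. ?h u)"
            unfolding set_integral_diff(2)[OF h] using 1 2 by linarith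
        next
          fix q :: rat
          show "X (of_rat q) \<omega> $ i - X' (of_rat q) \<omega> $ i = 0" using elim(1) by simp
        qed
        then show "X t \<omega> $ i = X' t \<omega> $ i" by simp
      qed (simp add: carrier_vecD[OF c(1)] carrier_vecD[OF c(2)])
    qed
  qed
qed

text \<open>The paths of the state process, obtained from the stochastic integral by partial integration.\<close>

definition explicit_state :: "(nat \<Rightarrow> real \<Rightarrow> 'w \<Rightarrow> real) \<Rightarrow> nat \<Rightarrow> real mat \<Rightarrow> real mat \<Rightarrow> real \<Rightarrow> 'w \<Rightarrow> real Matrix.vec" where
  "explicit_state V N A B t \<omega> = vec N (\<lambda>i. \<Sum>j<m. B $$ (i, j) * V j t \<omega> + conv (exp_kernel A (A * B) i j) (\<lambda>u. V j u \<omega>) t)"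

text \<open>An identity for every \<open>t\<close> and every \<open>\<omega>\<close> of the space,
  because \<open>T\<close> only passes through finite sums and Lebesgue integrals. Apart from the
  block row it is used with \<open>T = A' = A\<close>, where it evaluates \<open>A\<close> times the
  state.\<close>

lemma explicit_state_intertwine:
  assumes V: "\<And>j \<omega>. j < m \<Longrightarrow> \<omega> \<in> space M \<Longrightarrow> weighted_path a (\<lambda>u. V j u \<omega>)"
    and A: "A \<in> carrier_mat n n" and A': "A' \<in> carrier_mat n' n'" and T: "T \<in> carrier_mat n n'"
    and B: "B \<in> carrier_mat n' m" and eq: "T * A' = A * T"
    and dec: "\<And>i l. i < n' \<Longrightarrow> l < n' \<Longrightarrow> decays a (\<lambda>s. mat_exp (s \<cdot>\<^sub>m A') $$ (i, l))"
    and \<omega>: "\<omega> \<in> space M"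
  shows "T *\<^sub>v explicit_state V n' A' B t \<omega> = explicit_state V n A (T * B) t \<omega>"
proof (rule eq_vecI)
  fix i assume "i < dim_vec (explicit_state V n A (T * B) t \<omega>)"
  then have i: "i < n" by (simp add: explicit_state_def)
  have AB: "A' * B \<in> carrier_mat n' m" using A' B by (rule mult_carrier_mat)
  have TAB: "T * (A' * B) = A * (T * B)"
    using assoc_mult_mat[OF T A' B] assoc_mult_mat[OF A T B] eq by simp
  have "(T *\<^sub>v explicit_state V n' A' B t \<omega>) $ i
      = (\<Sum>l<n'. T $$ (i, l) * (\<Sum>j<m. B $$ (l, j) * V j t \<omega> + conv (exp_kernel A' (A' * B) l j) (\<lambda>u. V j u \<omega>) t))"
    by (subst mult_mat_vec_index_sum[OF T _ i]) (simp_all add: explicit_state_def)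
  also have "\<dots> = (\<Sum>j<m. \<Sum>l<n'. T $$ (i, l) * (B $$ (l, j) * V j t \<omega> + conv (exp_kernel A' (A' * B) l j) (\<lambda>u. V j u \<omega>) t))"
    by (simp only: sum_distrib_left) (rule sum.swap)
  also have "\<dots> = (\<Sum>j<m. (\<Sum>l<n'. T $$ (i, l) * B $$ (l, j)) * V j t \<omega>
      + (\<Sum>l<n'. T $$ (i, l) * conv (exp_kernel A' (A' * B) l j) (\<lambda>u. V j u \<omega>) t))"
    by (intro sum.cong refl) (simp only: distrib_left sum.distrib sum_distrib_right mult.assoc)
  also have "\<dots> = (\<Sum>j<m. (T * B) $$ (i, j) * V j t \<omega> + conv (exp_kernel A (A * (T * B)) i j) (\<lambda>u. V j u \<omega>) t)"
  proof (rule sum.cong[OF refl])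
    fix j assume "j \<in> {..<m}"
    then have j: "j < m" by simp
    interpret weighted_path a "\<lambda>u. V j u \<omega>" by (rule V[OF j \<omega>])
    have "(\<Sum>l<n'. T $$ (i, l) * conv (exp_kernel A' (A' * B) l j) (\<lambda>u. V j u \<omega>) t)
        = conv (\<lambda>s. \<Sum>l<n'. T $$ (i, l) * exp_kernel A' (A' * B) l j s) (\<lambda>u. V j u \<omega>) t"
      by (rule conv_sum[symmetric])
         (auto intro!: exp_kernel_measurable[OF A' AB] exp_kernel_decays[OF A' AB] dec j)
    also have "(\<lambda>s. \<Sum>l<n'. T $$ (i, l) * exp_kernel A' (A' * B) l j s) = exp_kernel A (A * (T * B)) i j"
      using exp_kernel_intertwine[OF A A' T eq AB i j] TAB by (intro ext) simp
    finally show "(\<Sum>l<n'. T $$ (i, l) * B $$ (l, j)) * V j t \<omega>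
      + (\<Sum>l<n'. T $$ (i, l) * conv (exp_kernel A' (A' * B) l j) (\<lambda>u. V j u \<omega>) t)
      = (T * B) $$ (i, j) * V j t \<omega> + conv (exp_kernel A (A * (T * B)) i j) (\<lambda>u. V j u \<omega>) t"
      by (simp only: index_mult_mat_sum[OF T B i j])
  qed
  finally show "(T *\<^sub>v explicit_state V n' A' B t \<omega>) $ i = explicit_state V n A (T * B) t \<omega> $ i"
    using i by (simp add: explicit_state_def)
qed (use T in \<open>simp add: explicit_state_def\<close>)

text \<open>\<open>A\<close> times the state is the explicit state with \<open>A * B\<close> in
  place of \<open>B\<close>. By variation of constants, its integral over \<open>{s..t}\<close> is
  the increment of the convolution part; the part \<open>B V\<close> supplies the noise.\<close>

lemma explicit_state_increment:
  assumes V: "\<And>j \<omega>. j < m \<Longrightarrow> \<omega> \<in> space M \<Longrightarrow> weighted_path a (\<lambda>u. V j u \<omega>)"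
    and A: "A \<in> carrier_mat N N" and B: "B \<in> carrier_mat N m"
    and dec: "\<And>i l. i < N \<Longrightarrow> l < N \<Longrightarrow> decays a (\<lambda>s. mat_exp (s \<cdot>\<^sub>m A) $$ (i, l))"
    and \<omega>: "\<omega> \<in> space M" and st: "s \<le> t" and i: "i < N"
  shows "set_integrable lborel {s..t} (\<lambda>u. (A *\<^sub>v explicit_state V N A B u \<omega>) $ i)"
    and "explicit_state V N A B t \<omega> $ i = explicit_state V N A B s \<omega> $ i
      + (LINT u:{s..t}|lborel. (A *\<^sub>v explicit_state V N A B u \<omega>) $ i)
      + (\<Sum>j<m. B $$ (i, j) * (V j t \<omega> - V j s \<omega>))"
proof -
  have AB: "A * B \<in> carrier_mat N m" and AAB: "A * (A * B) \<in> carrier_mat N m" using A B by auto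
  let ?k = "\<lambda>j u. (A * B) $$ (i, j) * V j u \<omega> + conv (exp_kernel A (A * (A * B)) i j) (\<lambda>u. V j u \<omega>) u"
  have AX: "(\<lambda>u. (A *\<^sub>v explicit_state V N A B u \<omega>) $ i) = (\<lambda>u. \<Sum>j<m. ?k j u)"
  proof
    fix u
    have "A *\<^sub>v explicit_state V N A B u \<omega> = explicit_state V N A (A * B) u \<omega>"
      by (rule explicit_state_intertwine[OF V A A A B refl dec \<omega>])
    then show "(A *\<^sub>v explicit_state V N A B u \<omega>) $ i = (\<Sum>j<m. ?k j u)"
      using i by (simp only: explicit_state_def index_vec)
  qed
  have k: "set_integrable lborel {s..t} (?k j)"
    "conv (exp_kernel A (A * B) i j) (\<lambda>u. V j u \<omega>) t - conv (exp_kernel A (A * B) i j) (\<lambda>u. V j u \<omega>) s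
      = (LINT u:{s..t}|lborel. ?k j u)" if j: "j < m" for j
  proof -
    interpret weighted_path a "\<lambda>u. V j u \<omega>" by (rule V[OF j \<omega>])
    note inc = conv_increment[OF exp_kernel_deriv[OF A AB i j] exp_kernel_continuous[OF A AAB i j]
        exp_kernel_decays[OF A AB i j dec] exp_kernel_decays[OF A AAB i j dec] st]
    show "set_integrable lborel {s..t} (?k j)"
      by (intro set_integral_add(1) set_integrable_mult_right path_integrable_interval inc(1))
    show "conv (exp_kernel A (A * B) i j) (\<lambda>u. V j u \<omega>) t - conv (exp_kernel A (A * B) i j) (\<lambda>u. V j u \<omega>) s
      = (LINT u:{s..t}|lborel. ?k j u)"
      using inc(2) by (simp only: exp_kernel_0[OF A AB i j])
  qed
  show "set_integrable lborel {s..t} (\<lambda>u. (A *\<^sub>v explicit_state V N A B u \<omega>) $ i)"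
    unfolding AX set_integrable_def scaleR_sum_right
    by (rule Bochner_Integration.integrable_sum) (use k(1) in \<open>simp add: set_integrable_def\<close>)
  have "(LINT u:{s..t}|lborel. (A *\<^sub>v explicit_state V N A B u \<omega>) $ i) = (\<Sum>j<m. LINT u:{s..t}|lborel. ?k j u)"
    unfolding AX set_lebesgue_integral_def scaleR_sum_right
    by (rule Bochner_Integration.integral_sum) (use k(1) in \<open>simp add: set_integrable_def\<close>)
  also have "\<dots> = (\<Sum>j<m. conv (exp_kernel A (A * B) i j) (\<lambda>u. V j u \<omega>) t - conv (exp_kernel A (A * B) i j) (\<lambda>u. V j u \<omega>) s)"
    by (intro sum.cong refl) (simp only: k(2) lessThan_iff)
  finally have int: "(LINT u:{s..t}|lborel. (A *\<^sub>v explicit_state V N A B u \<omega>) $ i) = \<dots>" .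
  show "explicit_state V N A B t \<omega> $ i = explicit_state V N A B s \<omega> $ i
      + (LINT u:{s..t}|lborel. (A *\<^sub>v explicit_state V N A B u \<omega>) $ i)
      + (\<Sum>j<m. B $$ (i, j) * (V j t \<omega> - V j s \<omega>))"
    unfolding int using i
    by (simp add: explicit_state_def right_diff_distrib sum.distrib sum_subtractf)
qed

text \<open>The versions \<open>V\<close> are a parameter, so that two models can be built on the
  same paths. The required L2 limits are assembled from scalar ones, entry by entry.\<close>

lemma explicit_state_process:
  assumes a: "a > 0" and VJ: "\<And>j. j < m \<Longrightarrow> (\<lambda>(t, \<omega>). V j t \<omega>) \<in> borel_measurable (borel \<Otimes>\<^sub>M M)"
    and VL: "\<And>j. j < m \<Longrightarrow> AE \<omega> in M. \<forall>t. V j t \<omega> = L t \<omega> $ j"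
    and VI: "\<And>j \<omega>. j < m \<Longrightarrow> \<omega> \<in> space M \<Longrightarrow> integrable lborel (\<lambda>u. exp (- a * \<bar>u\<bar>) * V j u \<omega>)"
    and A: "A \<in> carrier_mat N N" and B: "B \<in> carrier_mat N m"
    and dec: "\<And>i l. i < N \<Longrightarrow> l < N \<Longrightarrow> decays a (\<lambda>s. mat_exp (s \<cdot>\<^sub>m A) $$ (i, l))"
  shows "state_process M L A B (explicit_state V N A B)"
proof -
  let ?X = "explicit_state V N A B"
  have V: "weighted_path a (\<lambda>u. V j u \<omega>)" if "j < m" "\<omega> \<in> space M" for j \<omega>
    using VI[OF that] a by unfold_locales
  have dims: "dim_row A = N" "dim_col B = m" "dim_row B = N" using A B by auto
  have AB: "A * B \<in> carrier_mat N m" using A B by auto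
  have all: "AE \<omega> in M. \<forall>j\<in>{..<m}. \<forall>t. V j t \<omega> = L t \<omega> $ j"
    using VL by (intro AE_finite_allI) auto
  have se: "state_equation M L A B ?X"
    unfolding state_equation_def dims
    using all AE_space
  proof eventually_elim
    case (elim \<omega>)
    show ?case
    proof (intro allI impI conjI)
      fix s t :: real and i assume "s \<le> t" "i < N"
      then show "set_integrable lborel {s..t} (\<lambda>u. (A *\<^sub>v ?X u \<omega>) $ i)"
        by (intro explicit_state_increment(1)[OF V A B dec elim(2)])
    next
      fix s t :: real assume st: "s \<le> t"
      have D: "L t \<omega> - L s \<omega> \<in> carrier_vec m" using L_carrier[OF elim(2)] by (intro minus_carrier_vec)
      show "?X t \<omega> = ?X s \<omega> + vec N (\<lambda>i. LINT u:{s..t}|lborel. (A *\<^sub>v ?X u \<omega>) $ i) + B *\<^sub>v (L t \<omega> - L s \<omega>)"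
      proof (rule eq_vecI)
        fix i assume "i < dim_vec (?X s \<omega> + vec N (\<lambda>i. LINT u:{s..t}|lborel. (A *\<^sub>v ?X u \<omega>) $ i) + B *\<^sub>v (L t \<omega> - L s \<omega>))"
        then have i: "i < N" using dims by simp
        have "(B *\<^sub>v (L t \<omega> - L s \<omega>)) $ i = (\<Sum>j<m. B $$ (i, j) * (L t \<omega> - L s \<omega>) $ j)"
          by (rule mult_mat_vec_index_sum[OF B D i])
        also have "\<dots> = (\<Sum>j<m. B $$ (i, j) * (V j t \<omega> - V j s \<omega>))"
          using elim by (intro sum.cong refl) (simp add: L_diff_index)
        finally have BL: "(B *\<^sub>v (L t \<omega> - L s \<omega>)) $ i = (\<Sum>j<m. B $$ (i, j) * (V j t \<omega> - V j s \<omega>))" .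
        have inc: "?X t \<omega> $ i = ?X s \<omega> $ i + (LINT u:{s..t}|lborel. (A *\<^sub>v ?X u \<omega>) $ i)
            + (\<Sum>j<m. B $$ (i, j) * (V j t \<omega> - V j s \<omega>))"
          by (rule explicit_state_increment(2)[OF V A B dec elim(2) st i])
        have dimB: "dim_vec (B *\<^sub>v (L t \<omega> - L s \<omega>)) = N" using dims by simp
        show "?X t \<omega> $ i = (?X s \<omega> + vec N (\<lambda>i. LINT u:{s..t}|lborel. (A *\<^sub>v ?X u \<omega>) $ i) + B *\<^sub>v (L t \<omega> - L s \<omega>)) $ i"
          using i by (simp only: inc BL index_add_vec dimB dim_vec index_vec)
      qed (simp add: explicit_state_def dims)
    qed
  qed
  have li: "has_levy_integral M N m L
      (\<lambda>u. if u \<le> t then mat_exp ((t - u) \<cdot>\<^sub>m A) * B else 0\<^sub>m N m) (?X t)" for t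
  proof -
    let ?F = "\<lambda>u. if u \<le> t then mat_exp ((t - u) \<cdot>\<^sub>m A) * B else 0\<^sub>m N m"
    let ?n = "\<lambda>n. real (Suc n)"
    let ?P = "\<lambda>i j \<omega>. B $$ (i, j) * V j t \<omega> + conv (exp_kernel A (A * B) i j) (\<lambda>u. V j u \<omega>) t"
    have EB: "mat_exp (s \<cdot>\<^sub>m A) * B \<in> carrier_mat N m" for s
      by (rule mult_carrier_mat[OF mat_exp_carrier[OF smult_carrier_mat[OF A]] B])
    then have F: "?F u \<in> carrier_mat N m" for u by simp
    have Fij: "?F u $$ (i, j) = (if u \<le> t then exp_kernel A B i j (t - u) else 0)" if "i < N" "j < m" for u i j
      using that by (simp add: exp_kernel_def)
    \<comment> \<open>The grid of \<open>step_approximation\<close>, running back from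
      \<open>t\<close>; on each interval the kernel is frozen at its value for the right end, that
      is at lag k/(n+1).\<close>
    define S where "S = (\<lambda>n. map (\<lambda>k. (t - (real k + 1) / ?n n, t - real k / ?n n, mat_exp (real k / ?n n \<cdot>\<^sub>m A) * B)) [0..<Suc n * Suc n])"
    have S: "step_list N m (S n)" for n
      unfolding step_list_def S_def
      by (auto simp: EB divide_right_mono simp del: of_nat_Suc upt_Suc mult_Suc mult_Suc_right)
    have P_meas: "?P i j \<in> borel_measurable M" if "i < N" "j < m" for i j
    proof -
      interpret C: centred_levy M "\<lambda>t \<omega>. L t \<omega> $ j" by (rule coordinate[OF that(2)])
      have m: "(\<lambda>p. V j (fst p) (snd p)) \<in> borel_measurable (borel \<Otimes>\<^sub>M M)"
        using VJ[OF that(2)] by (simp add: case_prod_unfold)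
      have "V j t \<in> borel_measurable M"
        using measurable_compose[OF measurable_Pair1' m, of t] by simp
      moreover have "(\<lambda>\<omega>. conv (exp_kernel A (A * B) i j) (\<lambda>u. V j u \<omega>) t) \<in> borel_measurable M"
        by (rule C.conv_version_measurable[OF VJ[OF that(2)] exp_kernel_measurable[OF A AB that]])
      ultimately show ?thesis by (intro borel_measurable_add borel_measurable_times borel_measurable_const)
    qed
    have X_meas: "?X t \<in> measurable M (vec_borel N)"
    proof (rule measurable_vec_borelI)
      fix i assume i: "i < N"
      have "(\<lambda>\<omega>. \<Sum>j<m. ?P i j \<omega>) \<in> borel_measurable M"
        by (rule borel_measurable_sum) (use P_meas i in simp)
      then show "(\<lambda>\<omega>. ?X t \<omega> $ i) \<in> borel_measurable M" using i by (simp add: explicit_state_def)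
    qed (simp add: explicit_state_def)
    have F_meas: "(\<lambda>u. ?F u $$ (i, j)) \<in> borel_measurable borel" if "i < N" "j < m" for i j
    proof -
      note [measurable] = exp_kernel_measurable[OF A B that]
      have "(\<lambda>u. if u \<le> t then exp_kernel A B i j (t - u) else 0) \<in> borel_measurable borel" by measurable
      then show ?thesis by (simp only: Fij[OF that])
    qed
    let ?d = "\<lambda>i j n u. (\<Sum>k<Suc n * Suc n. indicator {t - (real k + 1) / ?n n<..t - real k / ?n n} u
        * exp_kernel A B i j (real k / ?n n)) - (if u \<le> t then exp_kernel A B i j (t - u) else 0)"
    let ?e = "\<lambda>i j n \<omega>. (\<Sum>k<Suc n * Suc n. exp_kernel A B i j (real k / ?n n)
        * (L (t - real k / ?n n) \<omega> $ j - L (t - (real k + 1) / ?n n) \<omega> $ j)) - ?P i j \<omega>"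
    have d_lim: "(\<lambda>n. \<integral>\<^sup>+u. ennreal ((?d i j n u)\<^sup>2) \<partial>lborel) \<longlonglongrightarrow> 0" if "i < N" "j < m" for i j
      by (rule step_approximation[OF a exp_kernel_continuous[OF A B that] exp_kernel_decays[OF A B that dec]])
    have e_lim: "(\<lambda>n. \<integral>\<^sup>+\<omega>. ennreal ((?e i j n \<omega>)\<^sup>2) \<partial>M) \<longlonglongrightarrow> 0" if ij: "i < N" "j < m" for i j
    proof -
      interpret C: centred_levy M "\<lambda>t \<omega>. L t \<omega> $ j" by (rule coordinate[OF ij(2)])
      from C.step_integral_converges[OF a VJ[OF ij(2)] VL[OF ij(2)] VI[OF ij(2)]
          exp_kernel_deriv[OF A B ij] exp_kernel_continuous[OF A AB ij]
          exp_kernel_decays[OF A B ij dec] exp_kernel_decays[OF A AB ij dec], of t]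
      show ?thesis by (simp only: exp_kernel_0[OF A B ij])
    qed
    have d_meas: "(\<lambda>u. ennreal ((?d i j n u)\<^sup>2)) \<in> borel_measurable lborel" if "i < N" "j < m" for i j n
    proof -
      note [measurable] = exp_kernel_measurable[OF A B that]
      show ?thesis by measurable
    qed
    have e_meas: "(\<lambda>\<omega>. ennreal ((?e i j n \<omega>)\<^sup>2)) \<in> borel_measurable M" if "i < N" "j < m" for i j n
    proof -
      have L: "(\<lambda>\<omega>. L r \<omega> $ j) \<in> borel_measurable M" for r by (rule vec_borel_component[OF L_measurable that(2)])
      note [measurable] = L P_meas[OF that]
      have "(\<lambda>\<omega>. ?e i j n \<omega>) \<in> borel_measurable M"
        by (intro borel_measurable_diff borel_measurable_sum borel_measurable_times borel_measurable_const L P_meas[OF that])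
      then show ?thesis by measurable
    qed
    have D: "(\<integral>\<^sup>+u. ennreal (mat_sqnorm (step_fun N m (S n) u - ?F u)) \<partial>lborel)
        = (\<Sum>i<N. \<Sum>j<m. \<integral>\<^sup>+u. ennreal ((?d i j n u)\<^sup>2) \<partial>lborel)" for n
    proof -
      have sf: "(step_fun N m (S n) u - ?F u) $$ (i, j) = ?d i j n u" if "i < N" "j < m" for i j u
      proof -
        have "step_fun N m (S n) u $$ (i, j) = (\<Sum>k<Suc n * Suc n. indicator {t - (real k + 1) / ?n n<..t - real k / ?n n} u
            * exp_kernel A B i j (real k / ?n n))"
          using that
          by (simp add: step_fun_def S_def comp_def interv_sum_list_conv_sum_set_nat exp_kernel_def lessThan_atLeast0
              del: upt_Suc of_nat_Suc mult_Suc mult_Suc_right)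
        then show ?thesis using that F[of u] by (simp only: index_minus_mat carrier_matD Fij[OF that])
      qed
      have "ennreal (mat_sqnorm (step_fun N m (S n) u - ?F u)) = (\<Sum>i<N. \<Sum>j<m. ennreal ((?d i j n u)\<^sup>2))" for u
      proof -
        have "step_fun N m (S n) u - ?F u \<in> carrier_mat N m" using F[of u] by (rule minus_carrier_mat)
        then have "mat_sqnorm (step_fun N m (S n) u - ?F u) = (\<Sum>i<N. \<Sum>j<m. ((step_fun N m (S n) u - ?F u) $$ (i, j))\<^sup>2)"
          by (rule mat_sqnorm_sum)
        also have "\<dots> = (\<Sum>i<N. \<Sum>j<m. (?d i j n u)\<^sup>2)"
          by (intro sum.cong refl) (simp only: sf lessThan_iff)
        finally show ?thesis by (simp only: sum_ennreal sum_nonneg zero_le_power2)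
      qed
      then have "(\<integral>\<^sup>+u. ennreal (mat_sqnorm (step_fun N m (S n) u - ?F u)) \<partial>lborel)
          = (\<integral>\<^sup>+u. (\<Sum>i<N. \<Sum>j<m. ennreal ((?d i j n u)\<^sup>2)) \<partial>lborel)" by (simp only:)
      also have "\<dots> = (\<Sum>i<N. \<integral>\<^sup>+u. (\<Sum>j<m. ennreal ((?d i j n u)\<^sup>2)) \<partial>lborel)"
        by (rule nn_integral_sum, rule borel_measurable_sum, rule d_meas) (simp_all only: lessThan_iff)
      also have "\<dots> = (\<Sum>i<N. \<Sum>j<m. \<integral>\<^sup>+u. ennreal ((?d i j n u)\<^sup>2) \<partial>lborel)"
        by (rule sum.cong[OF refl], rule nn_integral_sum, rule d_meas) (simp_all only: lessThan_iff)
      finally show ?thesis .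
    qed
    \<comment> \<open>Each component of the integral sums over the coordinates of the noise, so the
      error splits only up to the factor \<open>m\<close>. The distance of the matrix functions
      splits exactly.\<close>
    have E: "(\<integral>\<^sup>+\<omega>. ennreal (vec_sqnorm (step_integral N L (S n) \<omega> - ?X t \<omega>)) \<partial>M)
        \<le> (\<Sum>i<N. of_nat m * (\<Sum>j<m. \<integral>\<^sup>+\<omega>. ennreal ((?e i j n \<omega>)\<^sup>2) \<partial>M))" for n
    proof -
      have "(\<integral>\<^sup>+\<omega>. ennreal (vec_sqnorm (step_integral N L (S n) \<omega> - ?X t \<omega>)) \<partial>M)
          \<le> (\<integral>\<^sup>+\<omega>. (\<Sum>i<N. of_nat m * (\<Sum>j<m. ennreal ((?e i j n \<omega>)\<^sup>2))) \<partial>M)"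
      proof (rule nn_integral_mono)
        fix \<omega> assume \<omega>: "\<omega> \<in> space M"
        have comp: "(step_integral N L (S n) \<omega> - ?X t \<omega>) $ i = (\<Sum>j<m. ?e i j n \<omega>)" if i: "i < N" for i
        proof -
          have "step_integral N L (S n) \<omega> $ i = (\<Sum>j<m. \<Sum>k<Suc n * Suc n. exp_kernel A B i j (real k / ?n n)
              * (L (t - real k / ?n n) \<omega> $ j - L (t - (real k + 1) / ?n n) \<omega> $ j))"
            unfolding step_integral_index[OF S \<omega> i]
            by (simp add: S_def comp_def interv_sum_list_conv_sum_set_nat exp_kernel_def lessThan_atLeast0
                del: upt_Suc of_nat_Suc mult_Suc mult_Suc_right)
          moreover have "?X t \<omega> $ i = (\<Sum>j<m. ?P i j \<omega>)" using i by (simp add: explicit_state_def)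
          moreover have "(step_integral N L (S n) \<omega> - ?X t \<omega>) $ i = step_integral N L (S n) \<omega> $ i - ?X t \<omega> $ i"
            using i by (simp add: explicit_state_def)
          ultimately show ?thesis by (simp only: sum_subtractf)
        qed
        have "step_integral N L (S n) \<omega> - ?X t \<omega> \<in> carrier_vec N"
          by (rule carrier_vecI) (simp only: index_minus_vec explicit_state_def dim_vec)
        then have "vec_sqnorm (step_integral N L (S n) \<omega> - ?X t \<omega>) = (\<Sum>i<N. ((step_integral N L (S n) \<omega> - ?X t \<omega>) $ i)\<^sup>2)"
          by (rule vec_sqnorm_sum)
        also have "\<dots> = (\<Sum>i<N. (\<Sum>j<m. ?e i j n \<omega>)\<^sup>2)"
          by (intro sum.cong refl) (simp only: comp lessThan_iff)
        finally have "ennreal (vec_sqnorm (step_integral N L (S n) \<omega> - ?X t \<omega>)) = (\<Sum>i<N. ennreal ((\<Sum>j<m. ?e i j n \<omega>)\<^sup>2))"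
          by (simp only: ennreal_sum_squares)
        also have "\<dots> \<le> (\<Sum>i<N. of_nat m * (\<Sum>j<m. ennreal ((?e i j n \<omega>)\<^sup>2)))"
          by (intro sum_mono sum_square_le)
        finally show "ennreal (vec_sqnorm (step_integral N L (S n) \<omega> - ?X t \<omega>))
            \<le> (\<Sum>i<N. of_nat m * (\<Sum>j<m. ennreal ((?e i j n \<omega>)\<^sup>2)))" .
      qed
      also have "\<dots> = (\<Sum>i<N. \<integral>\<^sup>+\<omega>. of_nat m * (\<Sum>j<m. ennreal ((?e i j n \<omega>)\<^sup>2)) \<partial>M)"
      proof (rule nn_integral_sum)
        fix i assume "i \<in> {..<N}"
        then have [measurable]: "(\<lambda>\<omega>. \<Sum>j<m. ennreal ((?e i j n \<omega>)\<^sup>2)) \<in> borel_measurable M"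
          by (intro borel_measurable_sum e_meas) (simp_all only: lessThan_iff)
        show "(\<lambda>\<omega>. of_nat m * (\<Sum>j<m. ennreal ((?e i j n \<omega>)\<^sup>2))) \<in> borel_measurable M" by measurable
      qed
      also have "\<dots> = (\<Sum>i<N. of_nat m * (\<integral>\<^sup>+\<omega>. (\<Sum>j<m. ennreal ((?e i j n \<omega>)\<^sup>2)) \<partial>M))"
        by (rule sum.cong[OF refl], rule nn_integral_cmult, rule borel_measurable_sum, rule e_meas) (simp_all only: lessThan_iff)
      also have "\<dots> = (\<Sum>i<N. of_nat m * (\<Sum>j<m. \<integral>\<^sup>+\<omega>. ennreal ((?e i j n \<omega>)\<^sup>2) \<partial>M))"
        by (rule sum.cong[OF refl], rule arg_cong[where f = "\<lambda>x. of_nat m * x"], rule nn_integral_sum, rule e_meas) (simp_all only: lessThan_iff)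
      finally show ?thesis .
    qed
    have mt: "(of_nat m :: ennreal) < \<infinity>" by (simp add: ennreal_of_nat_eq_real_of_nat)
    have z: "(\<Sum>i<N. \<Sum>j<m. 0) = (0 :: ennreal)" "(\<Sum>i<N. of_nat m * (\<Sum>j<m. 0)) = (0 :: ennreal)" by simp_all
    have "(\<lambda>n. \<Sum>i<N. \<Sum>j<m. \<integral>\<^sup>+u. ennreal ((?d i j n u)\<^sup>2) \<partial>lborel) \<longlonglongrightarrow> (\<Sum>i<N. \<Sum>j<m. 0)"
      by (rule tendsto_sum, rule tendsto_sum, rule d_lim) (simp_all only: lessThan_iff)
    then have D_lim: "(\<lambda>n. \<integral>\<^sup>+u. ennreal (mat_sqnorm (step_fun N m (S n) u - ?F u)) \<partial>lborel) \<longlonglongrightarrow> 0"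
      unfolding D z .
    have "(\<lambda>n. \<Sum>i<N. of_nat m * (\<Sum>j<m. \<integral>\<^sup>+\<omega>. ennreal ((?e i j n \<omega>)\<^sup>2) \<partial>M)) \<longlonglongrightarrow> (\<Sum>i<N. of_nat m * (\<Sum>j<m. 0))"
      by (rule tendsto_sum, rule ennreal_tendsto_cmult[OF mt[unfolded infinity_ennreal_def]], rule tendsto_sum, rule e_lim) (simp_all only: lessThan_iff)
    then have E_lim: "(\<lambda>n. \<integral>\<^sup>+\<omega>. ennreal (vec_sqnorm (step_integral N L (S n) \<omega> - ?X t \<omega>)) \<partial>M) \<longlonglongrightarrow> 0"
      unfolding z by (rule ennreal_tendsto_0_le[OF E])
    show ?thesis
      unfolding has_levy_integral_def
    proof (rule conjI[OF X_meas], rule conjI, rule allI, rule F, rule conjI)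
      show "\<forall>i<N. \<forall>j<m. (\<lambda>u. ?F u $$ (i, j)) \<in> borel_measurable borel"
        using F_meas by (intro allI impI)
    qed (rule exI[of _ S], rule conjI[OF allI[OF S]], rule conjI[OF D_lim E_lim])
  qed
  show ?thesis unfolding state_process_def dims by (rule conjI[OF se allI[OF li]])
qed

end

section \<open>Transfer of the output process to the controller form\<close>

theorem proposition2p2:
  fixes d m N :: nat
    and M :: "'w measure"
    and L Y :: "real \<Rightarrow> 'w \<Rightarrow> real Matrix.vec"
    and A B C :: "real mat"
  assumes "d \<ge> 1" and "m \<ge> 1" and "N \<ge> 1"
    and "levy_process M m L"
    and "integrable M (\<lambda>\<omega>. vec_sqnorm (L 1 \<omega>))"
    and "\<And>i. i < m \<Longrightarrow> integral\<^sup>L M (\<lambda>\<omega>. L 1 \<omega> $ i) = 0"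
    and "A \<in> carrier_mat N N" and "B \<in> carrier_mat N m" and "C \<in> carrier_mat d N"
    and "stable_mat A"
    and "output_process M L A B C Y"
  shows "\<exists>p (At :: nat \<Rightarrow> real mat) (Bt :: nat \<Rightarrow> real mat).
    p \<ge> 1 \<and>
    (\<forall>i\<in>{1..p}. At i \<in> carrier_mat m m) \<and>
    (\<forall>i<p. Bt i \<in> carrier_mat d m) \<and>
    output_process M L (controller_A m p At) (controller_B m p) (controller_C d m p Bt) Y"
proof -
  note A = assms(7) and B = assms(8) and C = assms(9) and N = assms(3) and stable = assms(10)
  interpret centred_levy_vec M m L
    by unfold_locales (fact assms(4), fact assms(5), fact assms(6))
  let ?At = "char_coeff_mat m A" and ?S = "\<lambda>k. adj_coeff A k * B"
  let ?Bt = "\<lambda>k. C * ?S k"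
  let ?A = "controller_A m N ?At" and ?B = "controller_B m N" and ?C = "controller_C d m N ?Bt"
  let ?T = "block_row N N m ?S"
  have S: "?S k \<in> carrier_mat N m" for k by (rule mult_carrier_mat[OF adj_coeff_carrier[OF A] B])
  have cA: "?A \<in> carrier_mat (N * m) (N * m)" and cB: "?B \<in> carrier_mat (N * m) m"
    by (rule controller_A_carrier, rule controller_B_carrier)
  have T: "?T \<in> carrier_mat N (N * m)" by simp
  have TA: "?T * ?A = A * ?T" by (rule block_row_controller_A[OF A B N])
  have TB: "?T * ?B = B" by (rule block_row_controller_B[OF A B N])
  have TC: "?C = C * ?T" by (rule controller_C_block_row[OF C S])
  have stable': "stable_mat ?A" by (rule stable_controller_A[OF A N stable])
  obtain a1 K1 where 1: "a1 > 0" "\<And>s i j. s \<ge> 0 \<Longrightarrow> i < N \<Longrightarrow> j < N \<Longrightarrow> \<bar>mat_exp (s \<cdot>\<^sub>m A) $$ (i, j)\<bar> \<le> K1 * exp (- a1 * s)"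
    using stable_mat_exp_decay[OF A stable] by blast
  obtain a2 K2 where 2: "a2 > 0" "\<And>s i j. s \<ge> 0 \<Longrightarrow> i < N * m \<Longrightarrow> j < N * m \<Longrightarrow> \<bar>mat_exp (s \<cdot>\<^sub>m ?A) $$ (i, j)\<bar> \<le> K2 * exp (- a2 * s)"
    using stable_mat_exp_decay[OF cA stable'] by blast
  \<comment> \<open>A common decay rate, so that one choice of weighted versions \<open>V\<close>
    serves both models and \<open>?T\<close> maps the paths of \<open>?G\<close> exactly onto those
    of \<open>?X\<close>.\<close>
  define a where "a = min a1 a2"
  have a: "a > 0" using 1(1) 2(1) by (simp add: a_def)
  have weaken: "decays a f" if "b \<ge> a" and f: "\<And>s. s \<ge> 0 \<Longrightarrow> \<bar>f s\<bar> \<le> K * exp (- b * s)" for b K and f :: "real \<Rightarrow> real"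
  proof -
    have K: "K \<ge> 0" using order_trans[OF abs_ge_zero f[of 0]] by simp
    have "\<bar>f s\<bar> \<le> K * exp (- a * s)" if s: "s \<ge> 0" for s
    proof -
      have "a * s \<le> b * s" using \<open>b \<ge> a\<close> s by (rule mult_right_mono)
      then have "K * exp (- b * s) \<le> K * exp (- a * s)" using K by (intro mult_left_mono) auto
      then show ?thesis using f[OF s] by linarith
    qed
    then show ?thesis unfolding decays_def by blast
  qed
  have dec: "decays a (\<lambda>s. mat_exp (s \<cdot>\<^sub>m A) $$ (i, l))" if "i < N" "l < N" for i l
    by (rule weaken[of a1 _ K1]) (use 1(2) that in \<open>auto simp: a_def\<close>)
  have dec': "decays a (\<lambda>s. mat_exp (s \<cdot>\<^sub>m ?A) $$ (i, l))" if "i < N * m" "l < N * m" for i l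
    by (rule weaken[of a2 _ K2]) (use 2(2) that in \<open>auto simp: a_def\<close>)
  define version where "version = (\<lambda>j V. (\<lambda>(t, \<omega>). V t \<omega>) \<in> borel_measurable (borel \<Otimes>\<^sub>M M)
      \<and> (AE \<omega> in M. \<forall>t. V t \<omega> = L t \<omega> $ j)
      \<and> (\<forall>\<omega>\<in>space M. integrable lborel (\<lambda>u. exp (- a * \<bar>u\<bar>) * V u \<omega>)))"
  have "\<forall>j\<in>{..<m}. \<exists>V. version j V"
  proof
    fix j assume "j \<in> {..<m}"
    then have j: "j < m" by simp
    show "\<exists>V. version j V"
      by (rule centred_levy.weighted_version[OF coordinate[OF j] a])
         (rule exI, unfold version_def, intro conjI ballI)
  qed
  from bchoice[OF this] obtain V where "\<forall>j\<in>{..<m}. version j (V j)" by (elim exE)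
  then have ver: "version j (V j)" if "j < m" for j using that by blast
  have V: "\<And>j. j < m \<Longrightarrow> (\<lambda>(t, \<omega>). V j t \<omega>) \<in> borel_measurable (borel \<Otimes>\<^sub>M M)"
    "\<And>j. j < m \<Longrightarrow> AE \<omega> in M. \<forall>t. V j t \<omega> = L t \<omega> $ j"
    "\<And>j \<omega>. j < m \<Longrightarrow> \<omega> \<in> space M \<Longrightarrow> integrable lborel (\<lambda>u. exp (- a * \<bar>u\<bar>) * V j u \<omega>)"
    using ver unfolding version_def by blast+
  let ?X = "explicit_state V N A B" and ?G = "explicit_state V (N * m) ?A ?B"
  have G: "state_process M L ?A ?B ?G"
    by (rule explicit_state_process[OF a V cA cB dec'])
  have X: "state_process M L A B ?X"
    by (rule explicit_state_process[OF a V A B dec])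
  have TG: "?T *\<^sub>v ?G t \<omega> = ?X t \<omega>" if "\<omega> \<in> space M" for t \<omega>
  proof -
    have "weighted_path a (\<lambda>u. V j u \<omega>)" if "j < m" "\<omega> \<in> space M" for j \<omega>
      using V(3)[OF that] a by unfold_locales
    from explicit_state_intertwine[OF this A cA T cB TA dec' that] show ?thesis by (simp only: TB)
  qed
  obtain X0 where X0: "state_process M L A B X0" "AE \<omega> in M. \<forall>t. Y t \<omega> = C *\<^sub>v X0 t \<omega>"
    and Y: "\<And>t. Y t \<in> measurable M (vec_borel d)"
    using assms(11) C by (auto simp: output_process_def)
  \<comment> \<open>The state behind \<open>Y\<close> is some unknown \<open>X0\<close>. Uniqueness
    replaces it, at all times outside one null set, by the explicit \<open>?X\<close>, which is the
    image of \<open>?G\<close> under \<open>?T\<close>.\<close>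
  have "AE \<omega> in M. \<forall>t. Y t \<omega> = ?C *\<^sub>v ?G t \<omega>"
    using X0(2) state_process_unique[OF A B X0(1) X] AE_space
  proof eventually_elim
    case (elim \<omega>)
    have G_carrier: "?G t \<omega> \<in> carrier_vec (N * m)" for t by (simp add: explicit_state_def)
    show ?case
    proof
      fix t
      have "?C *\<^sub>v ?G t \<omega> = C *\<^sub>v (?T *\<^sub>v ?G t \<omega>)"
        unfolding TC by (rule assoc_mult_mat_vec[OF C T G_carrier])
      then show "Y t \<omega> = ?C *\<^sub>v ?G t \<omega>"
        by (simp only: elim(1)[THEN spec] elim(2)[THEN spec] TG[OF elim(3)])
    qed
  qed
  moreover have "dim_row ?C = d" using controller_C_carrier[of d m N ?Bt] by simp
  ultimately have out: "output_process M L ?A ?B ?C Y"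
    unfolding output_process_def using stable' Y G by (intro conjI allI exI[of _ ?G]) (simp_all only:)
  moreover have "?At i \<in> carrier_mat m m" for i by (simp add: char_coeff_mat_def)
  moreover have "?Bt i \<in> carrier_mat d m" for i by (rule mult_carrier_mat[OF C S])
  ultimately show ?thesis
    using N by (intro exI[of _ N] exI[of _ ?At] exI[of _ ?Bt] conjI ballI allI impI)
qed

end
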